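(* Let $M\ge 1$. There exists a constant $C_M>0$ (depending only on $M$) such that for every centered probability measure $f\,d\gamma$ on $\mathbb{R}$ with $\int_{\mathbb{R}}|x|^2 f\,d\gamma\le M$ and $\sqrt f\in W^{1,2}(\mathbb{R},d\gamma)$, $$\|f-1\|_{L^1(d\gamma)}\le C_M\,\delta(f)^{\frac14}.$$
   Context: On $\mathbb{R}^n$ (here $n=1$), $d\gamma=(2\pi)^{-n/2}e^{-|x|^2/2}dx$ is the standard Gaussian measure. For a probability measure $f\,d\gamma$ with $\sqrt f\in W^{1,2}(\mathbb{R}^n,d\gamma)$, the Fisher information is $\mathrm{I}(f)=\int \frac{|\nabla f|^2}{f}\,d\gamma$, the relative entropy is $\mathrm{H}(f)=\int f\log f\,d\gamma$, and the log-Sobolev deficit is $\delta(f)=\frac12 \mathrm{I}(f)-\mathrm{H}(f)\ge 0$. A probability measure $\mu$ is centered if $\int x\,d\mu=0$. *)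

theory Defs
  imports "HOL-Probability.Probability"
begin

definition gauss :: "real measure" where
  "gauss = density lborel (\<lambda>x. ennreal (std_normal_density x))"

definition test_function :: "(real \<Rightarrow> real) \<Rightarrow> bool" where
  "test_function \<phi> \<longleftrightarrow>
     (\<forall>k x. (deriv ^^ k) \<phi> field_differentiable (at x)) \<and>
     compact (closure {x. \<phi> x \<noteq> 0})"

definition locally_integrable :: "(real \<Rightarrow> real) \<Rightarrow> bool" where
  "locally_integrable u \<longleftrightarrow> (\<forall>K. compact K \<longrightarrow> set_integrable lborel K u)"

definition has_weak_deriv :: "(real \<Rightarrow> real) \<Rightarrow> (real \<Rightarrow> real) \<Rightarrow> bool" where
  "has_weak_deriv u g \<longleftrightarrow>
     locally_integrable u \<and> locally_integrable g \<and>
     (\<forall>\<phi>. test_function \<phi> \<longrightarrow>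
        (\<integral>x. u x * deriv \<phi> x \<partial>lborel) = - (\<integral>x. g x * \<phi> x \<partial>lborel))"

(* A weak derivative is unique only up to Lebesgue null sets (equivalently, gauss null sets);
   weak_deriv picks a representative, and is used below only under integrals. *)
definition weak_deriv :: "(real \<Rightarrow> real) \<Rightarrow> real \<Rightarrow> real" where
  "weak_deriv u = (SOME g. has_weak_deriv u g)"

definition sobolev_W12_gauss :: "(real \<Rightarrow> real) set" where
  "sobolev_W12_gauss = {u. u \<in> borel_measurable borel \<and> integrable gauss (\<lambda>x. (u x)\<^sup>2) \<and>
     (\<exists>g. has_weak_deriv u g \<and> integrable gauss (\<lambda>x. (g x)\<^sup>2))}"

(* The measure f dgamma is a probability measure: f is a density, i.e. Borel and a.e. nonnegative.
   The explicit sign condition is needed since ennreal truncates negative values to 0. *)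
definition gauss_prob_density :: "(real \<Rightarrow> real) \<Rightarrow> bool" where
  "gauss_prob_density f \<longleftrightarrow>
     f \<in> borel_measurable borel \<and> (AE x in gauss. 0 \<le> f x) \<and>
     prob_space (density gauss (\<lambda>x. ennreal (f x)))"

definition centered :: "real measure \<Rightarrow> bool" where
  "centered \<mu> \<longleftrightarrow> integrable \<mu> (\<lambda>x. x) \<and> (\<integral>x. x \<partial>\<mu>) = 0"

(* The three functionals are meant for probability densities f with sqrt f in W^{1,2}(gauss),
   where both integrals are finite (for the entropy, by the log-Sobolev inequality).
   Since x / 0 = 0 and 0 * ln 0 = 0, the set where f vanishes contributes nothing. *)
definition fisher_information :: "(real \<Rightarrow> real) \<Rightarrow> real" where
  "fisher_information f = (\<integral>x. \<bar>weak_deriv f x\<bar>\<^sup>2 / f x \<partial>gauss)"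

definition relative_entropy :: "(real \<Rightarrow> real) \<Rightarrow> real" where
  "relative_entropy f = (\<integral>x. f x * ln (f x) \<partial>gauss)"

definition lsi_deficit :: "(real \<Rightarrow> real) \<Rightarrow> real" where
  "lsi_deficit f = 1 / 2 * fisher_information f - relative_entropy f"

end

theory Submission
  imports Defs
begin

text \<open>
  Let \<open>\<phi>\<close> and \<open>\<Phi>\<close> be the standard Gaussian density and distribution function, let \<open>p = f \<phi>\<close>, and let \<open>T\<close> be the
  monotone map that transports \<open>p dx\<close> to the Gaussian measure, so that \<open>p = T' \<phi>(T)\<close>. This expresses the entropy
  through \<open>T\<close>, and completing the square in the Fisher information and integrating the derivative of
  \<open>p (x - T)\<close> leads to

    \<open>\<delta>(f) = 1/2 \<integral>(p'/p + T)\<^sup>2 p dx + \<integral>(T' - 1 - ln T') p dx\<close>.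

  The last integrand is nonnegative, so the first integral is at most \<open>2 \<delta>\<close> (\<open>transport_deficit\<close>). Now
  \<open>p' + T p\<close> is the derivative of \<open>q = p - \<phi>(T)\<close>, and \<open>q\<close> vanishes at both ends of the support of \<open>p\<close>.
  Hence Cauchy-Schwarz gives \<open>q\<^sup>2 \<le> 2 \<delta> min(F, 1 - F) \<le> 6 \<delta> \<phi>(T)\<close> pointwise, where \<open>F = \<Phi>(T)\<close>
  (\<open>q_square_bound\<close>), and therefore \<open>|T' - 1| = |q| / \<phi>(T)\<close> is of order \<open>\<delta>\<^sup>1\<^sup>/\<^sup>2 exp(T\<^sup>2/4)\<close>.

  Put \<open>h = \<delta>\<^sup>1\<^sup>/\<^sup>4\<close> and restrict to the core \<open>|T| \<le> R\<close> with \<open>exp(- R\<^sup>2/4) = h\<close>. Integrating \<open>T' - 1\<close> shows that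
  \<open>T - x\<close> is within \<open>O(h)\<close> of a constant there (\<open>displacement_on_G\<close>); that constant is itself \<open>O(h)\<close>
  because both \<open>p\<close> and the Gaussian measure are centered (\<open>X0_bound\<close>). The mass outside the core is \<open>O(h\<^sup>2)\<close>, so
  the bound \<open>M\<close> on the second moment limits the first moment there to \<open>O(sqrt M h)\<close>. Altogether the
  transport cost \<open>\<integral>|x - T| p dx\<close> is \<open>O(h)\<close>, and

    \<open>\<integral>|f'| d\<gamma> = \<integral>|p' + x p| dx \<le> \<integral>|p' + T p| dx + \<integral>|x - T| p dx = O(h)\<close>

  (\<open>stein_L1_bound\<close>). The \<open>L\<^sup>1\<close> Poincare inequality of the Gaussian measure (\<open>gauss_L1_poincare\<close>) turns this into
  the claim.

  As for regularity, a weakly differentiable function on the line agrees almost everywhere with an indefinite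
  integral of its weak derivative (\<open>has_weak_deriv_imp_AE_primitive\<close>), and all integrations by parts are carried out
  for indefinite integrals. The boundary terms vanish because finite Fisher information forces
  \<open>p \<le> K sqrt(min(F, 1 - F))\<close> and the second moment is finite.
\<close>

section \<open>Smooth compactly supported functions\<close>

definition smooth :: "(real \<Rightarrow> real) \<Rightarrow> bool" where
  "smooth \<phi> \<longleftrightarrow> (\<forall>k x. (deriv ^^ k) \<phi> field_differentiable (at x))"

text \<open>Smoothness is coinductive: it suffices to find a class of functions containing \<open>f\<close> in which every
  member has its derivative in the class again. All closure properties below are obtained by
  naming such a class.\<close>

lemma smooth_coinduct:
  assumes "P f"
    and "\<And>g. P g \<Longrightarrow> \<exists>g'. P g' \<and> (\<forall>x. (g has_field_derivative g' x) (at x))"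
  shows "smooth f"
proof -
  have "P ((deriv ^^ k) f)" for k
  proof (induction k)
    case (Suc k)
    then obtain g' where g': "P g'" "\<And>x. ((deriv ^^ k) f has_field_derivative g' x) (at x)"
      using assms(2) by blast
    then have "deriv ((deriv ^^ k) f) = g'"
      by (auto intro!: DERIV_imp_deriv)
    with g'(1) show ?case by simp
  qed (use assms in simp)
  then show ?thesis
    unfolding smooth_def field_differentiable_def using assms(2) by blast
qed

lemma smooth_imp_DERIV: "smooth f \<Longrightarrow> (f has_field_derivative deriv f x) (at x)"
  unfolding smooth_def by (metis DERIV_deriv_iff_field_differentiable funpow_0)

lemma smooth_deriv: "smooth f \<Longrightarrow> smooth (deriv f)"
  unfolding smooth_def by (metis funpow_Suc_right comp_apply)

lemma smooth_of_deriv: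
  assumes "\<And>x. (f has_field_derivative g x) (at x)" "smooth g"
  shows "smooth f"
  by (rule smooth_coinduct[where P = "\<lambda>h. h = f \<or> smooth h"])
     (use assms smooth_imp_DERIV smooth_deriv in blast)+

lemma smooth_const: "smooth (\<lambda>x. c)"
  by (rule smooth_coinduct[where P = "\<lambda>h. \<exists>c. h = (\<lambda>x. c)"]) (auto intro!: exI[of _ "\<lambda>x. 0"])

text \<open>Products alone are not closed under differentiation, but by Leibniz' rule finite sums of products
  of smooth functions are; this is the class to which coinduction is applied.\<close>

lemma smooth_sum_list_mult:
  assumes "\<forall>(a, b) \<in> set L. smooth a \<and> smooth b"
  shows "smooth (\<lambda>x. \<Sum>(a, b)\<leftarrow>L. a x * b x)"
proof (rule smooth_coinduct[where P = "\<lambda>h. \<exists>L. (\<forall>(a, b) \<in> set L. smooth a \<and> smooth b) \<and>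
      h = (\<lambda>x. \<Sum>(a, b)\<leftarrow>L. a x * b x)"])
  fix g :: "real \<Rightarrow> real"
  assume "\<exists>L. (\<forall>(a, b) \<in> set L. smooth a \<and> smooth b) \<and> g = (\<lambda>x. \<Sum>(a, b)\<leftarrow>L. a x * b x)"
  then obtain L where L: "\<forall>(a, b) \<in> set L. smooth a \<and> smooth b" and g: "g = (\<lambda>x. \<Sum>(a, b)\<leftarrow>L. a x * b x)"
    by blast
  let ?L' = "map (\<lambda>(a, b). (deriv a, b)) L @ map (\<lambda>(a, b). (a, deriv b)) L"
  have "((\<lambda>x. \<Sum>(a, b)\<leftarrow>L. a x * b x) has_field_derivative (\<Sum>(a, b)\<leftarrow>?L'. a x * b x)) (at x)" for x
    using L
  proof (induction L)
    case (Cons ab L)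
    obtain a b where ab: "ab = (a, b)" by fastforce
    have "((\<lambda>x. a x * b x) has_field_derivative (deriv a x * b x + deriv b x * a x)) (at x)"
      using Cons.prems ab by (intro DERIV_mult smooth_imp_DERIV) auto
    from DERIV_add[OF this Cons.IH] Cons.prems ab show ?case
      by (auto simp: algebra_simps split: prod.splits)
  qed simp
  moreover have "\<forall>(a, b) \<in> set ?L'. smooth a \<and> smooth b"
    using L by (auto intro: smooth_deriv)
  ultimately show "\<exists>g'. (\<exists>L. (\<forall>(a, b) \<in> set L. smooth a \<and> smooth b) \<and> g' = (\<lambda>x. \<Sum>(a, b)\<leftarrow>L. a x * b x)) \<and>
      (\<forall>x. (g has_field_derivative g' x) (at x))"
    unfolding g by (intro exI[of _ "\<lambda>x. \<Sum>(a, b)\<leftarrow>?L'. a x * b x"] conjI exI[of _ ?L']) auto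
qed (use assms in blast)

lemma smooth_mult: "smooth a \<Longrightarrow> smooth b \<Longrightarrow> smooth (\<lambda>x. a x * b x)"
  using smooth_sum_list_mult[of "[(a, b)]"] by simp

lemma smooth_diff_scaled: "smooth a \<Longrightarrow> smooth b \<Longrightarrow> smooth (\<lambda>x. c * a x - d * b x)"
  using smooth_sum_list_mult[of "[(\<lambda>x. c, a), (\<lambda>x. - d, b)]"] smooth_const by simp

lemma smooth_affine:
  assumes "smooth f"
  shows "smooth (\<lambda>x. f (c * x + d))"
proof (rule smooth_coinduct[where P = "\<lambda>h. \<exists>f e. smooth f \<and> h = (\<lambda>x. e * f (c * x + d))"])
  fix g
  assume "\<exists>f e. smooth f \<and> g = (\<lambda>x. e * f (c * x + d))"
  then obtain f e where f: "smooth f" and g: "g = (\<lambda>x. e * f (c * x + d))"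
    by blast
  have "(g has_field_derivative e * c * deriv f (c * x + d)) (at x)" for x
    unfolding g by (rule derivative_eq_intros DERIV_chain2[OF smooth_imp_DERIV[OF f]] refl | simp)+
  then show "\<exists>g'. (\<exists>f e. smooth f \<and> g' = (\<lambda>x. e * f (c * x + d))) \<and> (\<forall>x. (g has_field_derivative g' x) (at x))"
    using smooth_deriv[OF f] by blast
qed (auto intro!: exI[of _ f] exI[of _ 1] assms)

text \<open>The functions \<open>P(1/x) exp(-1/x)\<close>, extended by \<open>0\<close> to the left half-line. Carrying the polynomial
  factor \<open>P\<close> along makes the family closed under differentiation, the derivative belonging to the
  polynomial \<open>X\<^sup>2 (P - P')\<close>.\<close>

definition exp_germ :: "real poly \<Rightarrow> real \<Rightarrow> real" where
  "exp_germ P x = (if x \<le> 0 then 0 else poly P (1 / x) * exp (- (1 / x)))"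

lemma poly_exp_tendsto_0: "((\<lambda>y::real. poly P y * exp (- y)) \<longlongrightarrow> 0) at_top"
proof (induction P)
  case (pCons a P)
  have *: "((\<lambda>y::real. y ^ k / exp y) \<longlongrightarrow> 0) at_top" for k by (rule tendsto_power_div_exp_0)
  have "poly (pCons a P) y * exp (- y) = (\<Sum>i\<le>degree (pCons a P). coeff (pCons a P) i * (y ^ i / exp y))" for y :: real
    by (simp add: poly_altdef sum_distrib_right exp_minus divide_inverse mult.assoc del: coeff_pCons degree_pCons_eq_if)
  moreover have "((\<lambda>y::real. \<Sum>i\<le>degree (pCons a P). coeff (pCons a P) i * (y ^ i / exp y)) \<longlongrightarrow> (\<Sum>i\<le>degree (pCons a P). coeff (pCons a P) i * 0)) at_top"
    by (intro tendsto_intros *)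
  ultimately show ?case by simp
qed simp

text \<open>Only the point \<open>0\<close> needs an argument: there the right difference quotient is \<open>y P(y) exp(-y)\<close> with
  \<open>y = 1/h\<close> tending to infinity.\<close>

lemma exp_germ_DERIV:
  "(exp_germ P has_field_derivative exp_germ (monom 1 2 * (P - pderiv P)) x) (at x)"
proof -
  consider "x < 0" | "x = 0" | "x > 0" by linarith
  then show ?thesis
  proof cases
    case 1
    have "((\<lambda>x::real. 0::real) has_field_derivative 0) (at x)" by simp
    moreover have "exp_germ P y = 0" if "y \<in> {..<0}" for y using that by (simp add: exp_germ_def)
    ultimately show ?thesis
      using 1 by (subst DERIV_cong_ev[OF refl _ refl, where g = "\<lambda>x. 0"])
        (auto simp: exp_germ_def eventually_nhds intro!: exI[of _ "{..<0}"])
  next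
    case 2
    have "((\<lambda>h. exp_germ P h / h) \<longlongrightarrow> 0) (at_right 0)"
    proof (rule Lim_transform_eventually)
      show "((\<lambda>h::real. poly (pCons 0 P) (inverse h) * exp (- inverse h)) \<longlongrightarrow> 0) (at_right 0)"
        by (rule filterlim_compose[OF poly_exp_tendsto_0 filterlim_inverse_at_top_right])
      show "\<forall>\<^sub>F h in at_right 0. poly (pCons 0 P) (inverse h) * exp (- inverse h) = exp_germ P h / h"
        using eventually_at_right_less[of 0]
        by eventually_elim (simp add: exp_germ_def field_simps)
    qed
    moreover have "((\<lambda>h. exp_germ P h / h) \<longlongrightarrow> 0) (at_left 0)"
    proof (rule Lim_transform_eventually)
      show "\<forall>\<^sub>F h in at_left 0. 0 = exp_germ P h / h"
        by (auto simp: exp_germ_def eventually_at_filter)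
    qed simp
    ultimately have "((\<lambda>h. exp_germ P h / h) \<longlongrightarrow> 0) (at 0)"
      by (simp add: filterlim_split_at)
    with 2 show ?thesis
      by (simp add: DERIV_def exp_germ_def)
  next
    case 3
    have "((\<lambda>x. poly P (1 / x) * exp (- (1 / x))) has_field_derivative
        exp_germ (monom 1 2 * (P - pderiv P)) x) (at x)"
      using 3 by (auto intro!: derivative_eq_intros DERIV_chain2[OF poly_DERIV]
          simp: exp_germ_def poly_monom field_simps power2_eq_square)
    then show ?thesis
      using 3 by (subst DERIV_cong_ev[OF refl _ refl, where g = "\<lambda>x. poly P (1 / x) * exp (- (1 / x))"])
        (auto simp: exp_germ_def eventually_nhds intro!: exI[of _ "{0<..}"])
  qed
qed

lemma smooth_exp_germ: "smooth (exp_germ P)"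
  by (rule smooth_coinduct[where P = "\<lambda>h. \<exists>P. h = exp_germ P"]) (use exp_germ_DERIV in blast)+

text \<open>Smooth functions supported in \<open>[a, b]\<close> that increase to the indicator of \<open>(a, b)\<close> as \<open>n\<close> grows. They allow
  a weak formulation to be tested, in the limit, against intervals.\<close>

definition bump :: "real \<Rightarrow> real \<Rightarrow> nat \<Rightarrow> real \<Rightarrow> real" where
  "bump a b n x = exp_germ 1 (real n * (x - a)) * exp_germ 1 (real n * (b - x))"

lemma smooth_bump: "smooth (bump a b n)"
proof -
  have "smooth (\<lambda>x. exp_germ 1 (real n * x + (- real n * a)) * exp_germ 1 (- real n * x + real n * b))"
    by (intro smooth_mult smooth_affine smooth_exp_germ)
  then show ?thesis by (simp add: bump_def[abs_def] algebra_simps)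
qed

lemma bump_bounds: "0 \<le> bump a b n x" "bump a b n x \<le> 1"
  by (auto simp: bump_def exp_germ_def zero_less_mult_iff mult_le_0_iff intro!: mult_le_one)

lemma bump_outside: "x \<notin> {a<..<b} \<Longrightarrow> bump a b n x = 0"
  by (auto simp: bump_def exp_germ_def mult_le_0_iff zero_less_mult_iff not_less not_le)

lemma bump_tendsto: "(\<lambda>n. bump a b n x) \<longlonglongrightarrow> indicator {a<..<b} x"
proof (cases "x \<in> {a<..<b}")
  case True
  have "(\<lambda>n. exp (- (1 / (real n * (x - a)))) * exp (- (1 / (real n * (b - x))))) \<longlonglongrightarrow> exp (-0) * exp (-0)"
  proof (intro tendsto_intros)
    have *: "(\<lambda>n. (1 / c) * inverse (real n)) \<longlonglongrightarrow> (1 / c) * 0" for c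
      by (intro tendsto_intros LIMSEQ_inverse_real_of_nat lim_inverse_n)
    show "(\<lambda>n. 1 / (real n * (x - a))) \<longlonglongrightarrow> 0" "(\<lambda>n. 1 / (real n * (b - x))) \<longlonglongrightarrow> 0"
      using *[of "x - a"] *[of "b - x"] by (simp_all add: field_simps)
  qed
  moreover have "\<forall>\<^sub>F n in sequentially. exp (- (1 / (real n * (x - a)))) * exp (- (1 / (real n * (b - x)))) = bump a b n x"
    using eventually_gt_at_top[of 0]
    by eventually_elim (use True in \<open>auto simp: bump_def exp_germ_def mult_le_0_iff zero_less_mult_iff\<close>)
  ultimately show ?thesis using True by (simp add: Lim_transform_eventually)
qed (simp add: bump_outside)

section \<open>Indefinite Lebesgue integrals\<close>

text \<open>The Lebesgue version of an antiderivative: on every compact subinterval of \<open>S\<close> the function \<open>u\<close> is an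
  indefinite integral of \<open>g\<close>. This is absolute continuity in the form in which it is used; \<open>g\<close> is
  determined almost everywhere. The set \<open>S\<close> is a
  parameter because the transport map of a density lives on an open interval only.\<close>

definition primitive_on :: "real set \<Rightarrow> (real \<Rightarrow> real) \<Rightarrow> (real \<Rightarrow> real) \<Rightarrow> bool" where
  "primitive_on S u g \<longleftrightarrow> (\<forall>a b. a \<le> b \<and> {a..b} \<subseteq> S \<longrightarrow>
     set_integrable lborel {a..b} g \<and> (LBINT x:{a..b}. g x) = u b - u a)"

lemma primitive_onD:
  assumes "primitive_on S u g" "a \<le> b" "{a..b} \<subseteq> S"
  shows "set_integrable lborel {a..b} g" "(LBINT x:{a..b}. g x) = u b - u a"
  using assms unfolding primitive_on_def by blast+

lemma primitive_on_subset: "primitive_on S u g \<Longrightarrow> T \<subseteq> S \<Longrightarrow> primitive_on T u g"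
  unfolding primitive_on_def by blast

lemma primitive_on_cong:
  assumes "primitive_on S u g" "\<And>x. x \<in> S \<Longrightarrow> u x = u' x" "\<And>x. x \<in> S \<Longrightarrow> g x = g' x"
  shows "primitive_on S u' g'"
  unfolding primitive_on_def
proof (intro allI impI)
  fix a b assume ab: "a \<le> b \<and> {a..b} \<subseteq> S"
  have "set_integrable lborel {a..b} g' \<longleftrightarrow> set_integrable lborel {a..b} g"
    by (rule set_integrable_cong) (use ab assms(3) in auto)
  moreover have "(LBINT x:{a..b}. g' x) = (LBINT x:{a..b}. g x)"
    by (rule set_lebesgue_integral_cong) (use ab assms(3) in auto)
  moreover have "u a = u' a" "u b = u' b" using ab by (auto intro!: assms(2))
  ultimately show "set_integrable lborel {a..b} g' \<and> (LBINT x:{a..b}. g' x) = u' b - u' a"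
    using primitive_onD[OF assms(1)] ab by auto
qed

lemma primitive_on_diff:
  "primitive_on S u g \<Longrightarrow> primitive_on S v h \<Longrightarrow> primitive_on S (\<lambda>x. u x - v x) (\<lambda>x. g x - h x)"
  unfolding primitive_on_def by auto

lemma primitive_on_DERIV:
  assumes "\<And>x. x \<in> S \<Longrightarrow> (u has_field_derivative g x) (at x)" "continuous_on S g"
  shows "primitive_on S u g"
  unfolding primitive_on_def set_lebesgue_integral_def
proof (intro allI impI conjI)
  fix a b assume ab: "a \<le> b \<and> {a..b} \<subseteq> S"
  then have c: "continuous_on {a..b} g" using assms(2) continuous_on_subset by blast
  then show "set_integrable lborel {a..b} g" by (rule borel_integrable_atLeastAtMost')
  show "(LINT x|lborel. indicat_real {a..b} x *\<^sub>R g x) = u b - u a"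
  proof (rule integral_FTC_atLeastAtMost[OF _ _ c])
    fix x assume "a \<le> x" "x \<le> b"
    with ab have "(u has_field_derivative g x) (at x)" by (intro assms(1)) auto
    then show "(u has_vector_derivative g x) (at x within {a..b})"
      unfolding has_real_derivative_iff_has_vector_derivative[symmetric]
      by (rule has_field_derivative_at_within)
  qed (use ab in simp)
qed

lemma primitive_on_continuous_Icc:
  assumes "primitive_on S u g" "{a..b} \<subseteq> S"
  shows "continuous_on {a..b} u"
proof (cases "a \<le> b")
  case True
  note I = primitive_onD(1)[OF assms(1) True assms(2)]
  have "u x = u a + integral {a..x} g" if "x \<in> {a..b}" for x
  proof -
    have sub: "{a..x} \<subseteq> S" using that assms(2) by auto
    have "u x - u a = (LBINT y:{a..x}. g y)"
      using primitive_onD(2)[OF assms(1) _ sub] that by simp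
    also have "\<dots> = integral {a..x} g"
      using primitive_onD(1)[OF assms(1) _ sub] that by (intro set_borel_integral_eq_integral) auto
    finally show ?thesis by simp
  qed
  moreover have "continuous_on {a..b} (\<lambda>x. u a + integral {a..x} g)"
    using set_borel_integral_eq_integral(1)[OF I] by (intro continuous_intros indefinite_integral_continuous_1)
  ultimately show ?thesis by (rule continuous_on_eq[OF _ sym, rotated])
qed simp

lemma primitive_continuous:
  assumes "primitive_on UNIV u g"
  shows "continuous_on UNIV u"
  unfolding continuous_on_eq_continuous_at[OF open_UNIV]
proof safe
  fix x
  have "continuous_on {x - 1..x + 1} u" using primitive_on_continuous_Icc[OF assms] by blast
  then show "isCont u x" by (rule continuous_on_interior) (auto simp: interior_atLeastAtMost_real)
qed

lemma set_integrable_continuous_mult: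
  fixes u g :: "real \<Rightarrow> real"
  assumes "continuous_on {a..b} u" "set_integrable lborel {a..b} g"
  shows "set_integrable lborel {a..b} (\<lambda>x. u x * g x)"
proof -
  obtain B where B: "\<And>x. x \<in> {a..b} \<Longrightarrow> norm (u x) \<le> B"
    using compact_imp_bounded[OF compact_continuous_image[OF assms(1) compact_Icc]]
    by (force simp: bounded_iff)
  have m: "(\<lambda>x. indicator {a..b} x *\<^sub>R u x) \<in> borel_measurable borel"
    by (rule borel_measurable_continuous_on_indicator) (use assms in auto)
  have m2: "(\<lambda>x. indicator {a..b} x *\<^sub>R g x) \<in> borel_measurable borel"
    using borel_measurable_integrable[OF assms(2)[unfolded set_integrable_def]] by simp
  have "(\<lambda>x. (indicator {a..b} x *\<^sub>R u x) * (indicator {a..b} x *\<^sub>R g x)) \<in> borel_measurable borel"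
    using m m2 by (rule borel_measurable_times)
  also have "(\<lambda>x. (indicator {a..b} x *\<^sub>R u x) * (indicator {a..b} x *\<^sub>R g x)) = (\<lambda>x. indicator {a..b} x *\<^sub>R (u x * g x))"
    by (auto simp: indicator_def)
  finally have m3: "(\<lambda>x. indicator {a..b} x *\<^sub>R (u x * g x)) \<in> borel_measurable lborel" by simp
  have "integrable lborel (\<lambda>x. B * (indicator {a..b} x *\<^sub>R g x))"
    using assms(2) unfolding set_integrable_def by (rule integrable_mult_right)
  then show ?thesis
    unfolding set_integrable_def
  proof (rule Bochner_Integration.integrable_bound[OF _ m3], intro AE_I2)
    fix x
    show "norm (indicator {a..b} x *\<^sub>R (u x * g x)) \<le> norm (B * (indicator {a..b} x *\<^sub>R g x))"
      using B[of x] by (auto simp: indicator_def abs_mult intro!: mult_right_mono)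
  qed
qed

text \<open>Integration by parts for indefinite integrals: \<open>H(x) G(s)\<close> is integrated over the plane, which is
  cut along the diagonal into two triangles.\<close>

lemma integral_parts_by_Fubini:
  fixes G H :: "real \<Rightarrow> real"
  assumes G: "integrable lborel G" and H: "integrable lborel H"
  shows "integrable lborel (\<lambda>x. H x * (\<integral>s. indicator {..x} s * G s \<partial>lborel))"
    and "(\<integral>x. H x * (\<integral>s. indicator {..x} s * G s \<partial>lborel) \<partial>lborel)
       + (\<integral>x. G x * (\<integral>s. indicator {..x} s * H s \<partial>lborel) \<partial>lborel)
       = (\<integral>x. G x \<partial>lborel) * (\<integral>x. H x \<partial>lborel)"
proof -
  have [measurable]: "G \<in> borel_measurable borel" "H \<in> borel_measurable borel"
    using G H by (auto dest: borel_measurable_integrable)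
  have P: "integrable (lborel \<Otimes>\<^sub>M lborel) (\<lambda>(x, s). H x * G s)"
    by (rule lborel_pair.Fubini_integrable)
      (use G H in \<open>auto simp: abs_mult\<close>)
  define f where "f x s = (if s \<le> x then H x * G s else 0)" for x s
  define k where "k x s = (if x \<le> s then H x * G s else 0)" for x s
  have "case_prod f \<in> borel_measurable (borel \<Otimes>\<^sub>M borel)" "case_prod k \<in> borel_measurable (borel \<Otimes>\<^sub>M borel)"
    unfolding f_def k_def by measurable
  then have fk: "case_prod f \<in> borel_measurable (lborel \<Otimes>\<^sub>M lborel)" "case_prod k \<in> borel_measurable (lborel \<Otimes>\<^sub>M lborel)"
    by (simp_all cong: measurable_cong_sets sets_pair_measure_cong)
  have fint: "integrable (lborel \<Otimes>\<^sub>M lborel) (case_prod f)"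
    by (rule Bochner_Integration.integrable_bound[OF P fk(1)])
      (auto simp: f_def case_prod_beta)
  have kint: "integrable (lborel \<Otimes>\<^sub>M lborel) (case_prod k)"
    by (rule Bochner_Integration.integrable_bound[OF P fk(2)])
      (auto simp: k_def case_prod_beta)
  have f1: "(\<integral>s. f x s \<partial>lborel) = H x * (\<integral>s. indicator {..x} s * G s \<partial>lborel)" for x
    unfolding f_def integral_mult_right_zero[symmetric]
    by (rule Bochner_Integration.integral_cong) auto
  show "integrable lborel (\<lambda>x. H x * (\<integral>s. indicator {..x} s * G s \<partial>lborel))"
    using lborel_pair.integrable_fst[OF fint] unfolding f1 by simp
  have "(\<integral>x. G x * (\<integral>s. indicator {..x} s * H s \<partial>lborel) \<partial>lborel) = (\<integral>y. (\<integral>x. k x y \<partial>lborel) \<partial>lborel)"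
    unfolding k_def integral_mult_right_zero[symmetric]
    by (intro Bochner_Integration.integral_cong refl) auto
  also have "\<dots> = (\<integral>x. (\<integral>y. k x y \<partial>lborel) \<partial>lborel)"
    by (rule lborel_pair.Fubini_integral[OF kint])
  finally have 2: "(\<integral>x. G x * (\<integral>s. indicator {..x} s * H s \<partial>lborel) \<partial>lborel) = (\<integral>x. (\<integral>y. k x y \<partial>lborel) \<partial>lborel)" .
  have "(\<integral>x. H x * (\<integral>s. indicator {..x} s * G s \<partial>lborel) \<partial>lborel)
       + (\<integral>x. G x * (\<integral>s. indicator {..x} s * H s \<partial>lborel) \<partial>lborel)
     = (\<integral>x. (\<integral>s. f x s \<partial>lborel) + (\<integral>s. k x s \<partial>lborel) \<partial>lborel)"
    unfolding 2 f1[symmetric]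
    using lborel_pair.integrable_fst[OF fint] lborel_pair.integrable_fst[OF kint] by simp
  also have "\<dots> = (\<integral>x. H x * (\<integral>s. G s \<partial>lborel) \<partial>lborel)"
  proof (rule Bochner_Integration.integral_cong[OF refl])
    fix x
    have "integrable lborel (f x)" "integrable lborel (k x)"
      by (rule Bochner_Integration.integrable_bound[of _ "\<lambda>s. H x * G s"];
          use G in \<open>auto simp: f_def[abs_def] k_def[abs_def]\<close>)+
    then have "(\<integral>s. f x s \<partial>lborel) + (\<integral>s. k x s \<partial>lborel) = (\<integral>s. f x s + k x s \<partial>lborel)"
      by simp
    also have "\<dots> = (\<integral>s. H x * G s \<partial>lborel)"
    proof (rule integral_cong_AE)
      show "AE s in lborel. f x s + k x s = H x * G s"
        using AE_lborel_singleton[of x] by eventually_elim (auto simp: f_def k_def)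
    qed (auto simp: f_def k_def)
    finally show "(\<integral>s. f x s \<partial>lborel) + (\<integral>s. k x s \<partial>lborel) = H x * (\<integral>s. G s \<partial>lborel)" by simp
  qed
  finally show "(\<integral>x. H x * (\<integral>s. indicator {..x} s * G s \<partial>lborel) \<partial>lborel)
       + (\<integral>x. G x * (\<integral>s. indicator {..x} s * H s \<partial>lborel) \<partial>lborel)
       = (\<integral>x. G x \<partial>lborel) * (\<integral>x. H x \<partial>lborel)" by (simp add: mult.commute)
qed

text \<open>The product rule for indefinite integrals. Writing \<open>u = u(a) + \<integral>g\<close> and \<open>v = v(a) + \<integral>h\<close> on \<open>[a, b]\<close>, the
  only nontrivial term is the product of the two integrals, treated by Fubini's theorem.\<close>

lemma primitive_on_mult:
  assumes "primitive_on S u g" "primitive_on S v h"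
  shows "primitive_on S (\<lambda>x. u x * v x) (\<lambda>x. u x * h x + v x * g x)"
  unfolding primitive_on_def
proof (intro allI impI)
  fix a b assume ab: "a \<le> b \<and> {a..b} \<subseteq> S"
  note gi = primitive_onD[OF assms(1), of a b] and hi = primitive_onD[OF assms(2), of a b]
  have uh: "set_integrable lborel {a..b} (\<lambda>x. u x * h x)"
    using primitive_on_continuous_Icc[OF assms(1)] hi ab by (intro set_integrable_continuous_mult) auto
  have vg: "set_integrable lborel {a..b} (\<lambda>x. v x * g x)"
    using primitive_on_continuous_Icc[OF assms(2)] gi ab by (intro set_integrable_continuous_mult) auto
  define G where "G x = indicator {a..b} x * g x" for x
  define H where "H x = indicator {a..b} x * h x" for x
  have G: "integrable lborel G" and H: "integrable lborel H"
    using gi(1) hi(1) ab by (auto simp: set_integrable_def G_def[abs_def] H_def[abs_def])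
  have IG: "(\<integral>x. G x \<partial>lborel) = u b - u a" and IH: "(\<integral>x. H x \<partial>lborel) = v b - v a"
    using gi(2) hi(2) ab by (auto simp: set_lebesgue_integral_def G_def[abs_def] H_def[abs_def])
  have u: "u x = u a + (\<integral>s. indicator {..x} s * G s \<partial>lborel)" if "x \<in> {a..b}" for x
  proof -
    have "u x - u a = (LBINT y:{a..x}. g y)"
      using that ab by (intro primitive_onD(2)[OF assms(1), symmetric]) auto
    also have "\<dots> = (\<integral>s. indicator {..x} s * G s \<partial>lborel)"
      unfolding set_lebesgue_integral_def G_def
      by (rule Bochner_Integration.integral_cong) (use that in \<open>auto simp: indicator_def\<close>)
    finally show ?thesis by simp
  qed
  have v: "v x = v a + (\<integral>s. indicator {..x} s * H s \<partial>lborel)" if "x \<in> {a..b}" for x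
  proof -
    have "v x - v a = (LBINT y:{a..x}. h y)"
      using that ab by (intro primitive_onD(2)[OF assms(2), symmetric]) auto
    also have "\<dots> = (\<integral>s. indicator {..x} s * H s \<partial>lborel)"
      unfolding set_lebesgue_integral_def H_def
      by (rule Bochner_Integration.integral_cong) (use that in \<open>auto simp: indicator_def\<close>)
    finally show ?thesis by simp
  qed
  have "(LBINT x:{a..b}. u x * h x + v x * g x) = (\<integral>x. (u a * H x + v a * G x) +
      (H x * (\<integral>s. indicator {..x} s * G s \<partial>lborel) + G x * (\<integral>s. indicator {..x} s * H s \<partial>lborel)) \<partial>lborel)"
    unfolding set_lebesgue_integral_def
  proof (rule Bochner_Integration.integral_cong[OF refl])
    fix x
    show "indicat_real {a..b} x *\<^sub>R (u x * h x + v x * g x) = (u a * H x + v a * G x) +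
      (H x * (\<integral>s. indicator {..x} s * G s \<partial>lborel) + G x * (\<integral>s. indicator {..x} s * H s \<partial>lborel))"
    proof (cases "x \<in> {a..b}")
      case True
      show ?thesis unfolding u[OF True] v[OF True] using True
        by (simp add: G_def[of x] H_def[of x] algebra_simps)
    qed (simp add: G_def[of x] H_def[of x])
  qed
  also have "\<dots> = u a * (v b - v a) + v a * (u b - u a) + (u b - u a) * (v b - v a)"
    using G H integral_parts_by_Fubini(1)[OF G H] integral_parts_by_Fubini(1)[OF H G]
      integral_parts_by_Fubini(2)[OF G H]
    by (simp add: IG IH)
  also have "\<dots> = u b * v b - u a * v a" by algebra
  finally have "(LBINT x:{a..b}. u x * h x + v x * g x) = u b * v b - u a * v a" .
  with set_integral_add(1)[OF uh vg] show "set_integrable lborel {a..b} (\<lambda>x. u x * h x + v x * g x) \<and>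
      (LBINT x:{a..b}. u x * h x + v x * g x) = u b * v b - u a * v a" by (rule conjI)
qed

text \<open>On a bounded window the positive and the negative part of \<open>h\<close> define finite measures that agree on
  all half-lines, hence are equal; then so are their densities.\<close>

lemma AE_zero_if_interval_integrals_zero:
  fixes h :: "real \<Rightarrow> real"
  assumes loc: "\<And>a b. set_integrable lborel {a..b} h"
    and zero: "\<And>a b. a < b \<Longrightarrow> (LBINT x:{a..b}. h x) = 0"
  shows "AE x in lborel. h x = 0"
proof -
  have "AE x in lborel. indicator {- real n..real n} x * h x = 0" for n :: nat
  proof -
    define k where "k x = indicator {- real n..real n} x * h x" for x
    have k: "integrable lborel k" using loc by (simp add: k_def[abs_def] set_integrable_def)
    then have [measurable]: "k \<in> borel_measurable borel" by (auto dest: borel_measurable_integrable)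
    have kz: "(\<integral>x. indicator {y<..} x * k x \<partial>lborel) = 0" for y
    proof -
      let ?a = "max y (- real n)"
      have "(\<integral>x. indicator {y<..} x * k x \<partial>lborel) = (LBINT x:{?a..real n}. h x)"
        unfolding set_lebesgue_integral_def
      proof (rule integral_cong_AE)
        show "AE x in lborel. indicator {y<..} x * k x = indicat_real {?a..real n} x *\<^sub>R h x"
          using AE_lborel_singleton[of y] by eventually_elim (auto simp: k_def indicator_def)
        show "(\<lambda>x. indicat_real {?a..real n} x *\<^sub>R h x) \<in> borel_measurable lborel"
          using loc[of ?a "real n"] unfolding set_integrable_def by (rule borel_measurable_integrable)
      qed simp
      also have "\<dots> = 0"
      proof (cases "?a < real n")
        case False
        then consider "?a = real n" | "?a > real n" by linarith
        then show ?thesis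
        proof cases
          case 1
          have "(LBINT x:{real n}. h x) = 0"
            unfolding set_lebesgue_integral_def
            by (rule integral_eq_zero_AE) (use AE_lborel_singleton[of "real n"] in \<open>eventually_elim, simp\<close>)
          with 1 show ?thesis by simp
        qed (simp add: set_lebesgue_integral_def)
      qed (rule zero)
      finally show ?thesis .
    qed
    define M where "M = density lborel (\<lambda>x. ennreal (k x))"
    define N where "N = density lborel (\<lambda>x. ennreal (- k x))"
    have emM: "emeasure M {y<..} = ennreal (\<integral>x. indicator {y<..} x * max 0 (k x) \<partial>lborel)" for y
    proof -
      have "emeasure M {y<..} = (\<integral>\<^sup>+x. ennreal (indicator {y<..} x * max 0 (k x)) \<partial>lborel)"
        unfolding M_def by (subst emeasure_density) (auto intro!: nn_integral_cong simp: indicator_def)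
      also have "\<dots> = ennreal (\<integral>x. indicator {y<..} x * max 0 (k x) \<partial>lborel)"
        by (rule nn_integral_eq_integral)
          (auto intro!: Bochner_Integration.integrable_bound[OF k] simp: indicator_def max_def)
      finally show ?thesis .
    qed
    have emN: "emeasure N {y<..} = ennreal (\<integral>x. indicator {y<..} x * max 0 (- k x) \<partial>lborel)" for y
    proof -
      have "emeasure N {y<..} = (\<integral>\<^sup>+x. ennreal (indicator {y<..} x * max 0 (- k x)) \<partial>lborel)"
        unfolding N_def by (subst emeasure_density) (auto intro!: nn_integral_cong simp: indicator_def)
      also have "\<dots> = ennreal (\<integral>x. indicator {y<..} x * max 0 (- k x) \<partial>lborel)"
        by (rule nn_integral_eq_integral)
          (auto intro!: Bochner_Integration.integrable_bound[OF k] simp: indicator_def max_def)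
      finally show ?thesis .
    qed
    have "M = N"
    proof (rule measure_eqI_lessThan)
      fix y
      have "(\<integral>x. indicator {y<..} x * max 0 (k x) \<partial>lborel) - (\<integral>x. indicator {y<..} x * max 0 (- k x) \<partial>lborel)
          = (\<integral>x. indicator {y<..} x * max 0 (k x) - indicator {y<..} x * max 0 (- k x) \<partial>lborel)"
        by (rule Bochner_Integration.integral_diff[symmetric];
            rule Bochner_Integration.integrable_bound[OF k]; auto simp: indicator_def max_def)
      also have "\<dots> = (\<integral>x. indicator {y<..} x * k x \<partial>lborel)"
        by (rule Bochner_Integration.integral_cong) (auto simp: indicator_def)
      finally show "emeasure M {y<..} = emeasure N {y<..}" using kz[of y] by (simp add: emM emN)
      show "emeasure M {y<..} < \<infinity>" by (simp add: emM)
    qed (simp_all add: M_def N_def)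
    then have "AE x in lborel. ennreal (k x) = ennreal (- k x)"
      unfolding M_def N_def by (intro sigma_finite_measure.density_unique[OF sigma_finite_lborel]) auto
    then show ?thesis
      unfolding k_def[symmetric]
    proof eventually_elim
      fix x assume "ennreal (k x) = ennreal (- k x)"
      then show "k x = 0" by (cases "0 \<le> k x") (auto simp: ennreal_neg ennreal_eq_0_iff dest!: sym[of 0])
    qed
  qed
  then have "AE x in lborel. \<forall>n::nat. indicator {- real n..real n} x * h x = 0"
    unfolding AE_all_countable by blast
  then show ?thesis
  proof eventually_elim
    fix x assume *: "\<forall>n::nat. indicator {- real n..real n} x * h x = 0"
    obtain n where "\<bar>x\<bar> \<le> real n" using real_arch_simple by blast
    then show "h x = 0" using *[rule_format, of n] by (auto simp: indicator_def abs_le_iff)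
  qed
qed

section \<open>Weak derivatives on the line\<close>

lemma test_function_iff: "test_function \<phi> \<longleftrightarrow> smooth \<phi> \<and> compact (closure {x. \<phi> x \<noteq> 0})"
  unfolding test_function_def smooth_def by blast

lemma test_functionI:
  assumes "smooth \<phi>" "\<And>x. x \<notin> {a..b} \<Longrightarrow> \<phi> x = 0"
  shows "test_function \<phi>"
  unfolding test_function_iff
proof
  have "bounded {x. \<phi> x \<noteq> 0}"
    using bounded_closed_interval assms(2) bounded_subset[of "{a..b}" "{x. \<phi> x \<noteq> 0}"] by blast
  then show "compact (closure {x. \<phi> x \<noteq> 0})" by (simp add: compact_closure)
qed fact

lemma test_function_vanishes_outside:
  assumes "test_function \<phi>"
  obtains r where "r > 0" "\<forall>x. r \<le> \<bar>x\<bar> \<longrightarrow> \<phi> x = 0 \<and> deriv \<phi> x = 0"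
proof -
  have "bounded {x. \<phi> x \<noteq> 0}"
    using assms unfolding test_function_iff by (simp add: compact_closure)
  then obtain r where r: "r > 0" "\<And>x. \<phi> x \<noteq> 0 \<Longrightarrow> \<bar>x\<bar> \<le> r"
    unfolding bounded_pos by auto
  have "deriv \<phi> x = 0" if x: "r + 1 \<le> \<bar>x\<bar>" for x
  proof -
    have "open ((- {- r..r}) :: real set)" by (intro open_Compl closed_atLeastAtMost)
    moreover have "x \<in> - {- r..r}" using x by auto
    ultimately have "eventually (\<lambda>y. y \<in> - {- r..r}) (nhds x)"
      using eventually_nhds by blast
    then have "eventually (\<lambda>y. \<phi> y = 0) (nhds x)"
    proof eventually_elim
      case (elim y)
      then show ?case using r(2)[of y] by (cases "\<phi> y = 0") auto
    qed
    then have "((\<phi> has_field_derivative 0) (at x)) = (((\<lambda>y. 0) has_field_derivative 0) (at x))"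
      by (intro DERIV_cong_ev refl)
    then show ?thesis by (intro DERIV_imp_deriv) simp
  qed
  moreover have "\<phi> x = 0" if "r + 1 \<le> \<bar>x\<bar>" for x
    using r(2)[of x] that by fastforce
  ultimately show ?thesis using r(1) by (intro that[of "r + 1"]) auto
qed

lemma test_function_bump: "test_function (bump a b n)"
  by (rule test_functionI[OF smooth_bump, of a b]) (rule bump_outside, auto)

lemma smooth_continuous_on: "smooth f \<Longrightarrow> continuous_on S f"
  by (intro continuous_at_imp_continuous_on ballI DERIV_isCont[OF smooth_imp_DERIV])

lemma smooth_primitive_on: "smooth f \<Longrightarrow> primitive_on S f (deriv f)"
  by (intro primitive_on_DERIV smooth_imp_DERIV smooth_continuous_on smooth_deriv)

lemma locally_integrable_Icc: "locally_integrable u \<longleftrightarrow> (\<forall>a b. set_integrable lborel {a..b} u)"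
proof
  assume *: "\<forall>a b. set_integrable lborel {a..b} u"
  show "locally_integrable u"
    unfolding locally_integrable_def
  proof (intro allI impI)
    fix K :: "real set" assume K: "compact K"
    then obtain r where "\<And>x. x \<in> K \<Longrightarrow> \<bar>x\<bar> \<le> r"
      using compact_imp_bounded by (force simp: bounded_iff)
    then have "K \<subseteq> {- r..r}" by (force simp: abs_le_iff)
    with * K show "set_integrable lborel K u"
      by (intro set_integrable_subset[of lborel "{- r..r}" u K]) (auto intro: borel_compact)
  qed
qed (simp add: locally_integrable_def)

lemma locally_integrable_borel:
  assumes "locally_integrable g"
  shows "g \<in> borel_measurable borel"
proof (rule borel_measurable_LIMSEQ_metric)
  fix n :: nat
  have "set_integrable lborel {- real n..real n} g"
    using assms by (simp add: locally_integrable_Icc)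
  then show "(\<lambda>x. indicator {- real n..real n} x * g x) \<in> borel_measurable borel"
    unfolding set_integrable_def by (auto dest: borel_measurable_integrable)
next
  fix x
  obtain N :: nat where N: "\<bar>x\<bar> \<le> real N" using real_arch_simple by blast
  have "\<forall>\<^sub>F n in sequentially. indicator {- real n..real n} x * g x = g x"
    using eventually_ge_at_top[of N]
    by eventually_elim (use N in \<open>auto simp: indicator_def\<close>)
  then show "(\<lambda>n. indicator {- real n..real n} x * g x) \<longlonglongrightarrow> g x"
    by (rule tendsto_eventually)
qed

text \<open>The product \<open>u \<phi>\<close> with a test function is again an indefinite integral and vanishes at both ends of
  a large interval, so the integral of \<open>u \<phi>' + g \<phi>\<close> is zero.\<close>

lemma primitive_imp_has_weak_deriv:
  assumes "primitive_on UNIV u g"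
  shows "has_weak_deriv u g"
  unfolding has_weak_deriv_def
proof (intro conjI allI impI)
  have cu: "continuous_on S u" for S using primitive_continuous[OF assms] continuous_on_subset by blast
  show "locally_integrable u"
    unfolding locally_integrable_Icc using cu by (intro allI borel_integrable_atLeastAtMost')
  show lg: "locally_integrable g"
    unfolding locally_integrable_Icc
  proof (intro allI)
    fix a b show "set_integrable lborel {a..b} g"
      using primitive_onD(1)[OF assms, of a b] by (cases "a \<le> b") (auto simp: set_integrable_def)
  qed
  fix \<phi> assume \<phi>: "test_function \<phi>"
  then have sm: "smooth \<phi>" unfolding test_function_iff by simp
  obtain r where r: "r > 0" "\<forall>x. r \<le> \<bar>x\<bar> \<longrightarrow> \<phi> x = 0 \<and> deriv \<phi> x = 0"
    by (rule test_function_vanishes_outside[OF \<phi>])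
  have out: "\<phi> x = 0" "deriv \<phi> x = 0" if "x \<notin> {- r..r}" for x using that r(2) by auto
  have "set_integrable lborel {- r..r} (\<lambda>x. u x * deriv \<phi> x)"
    by (intro borel_integrable_atLeastAtMost' continuous_on_mult cu smooth_continuous_on smooth_deriv sm)
  moreover have "set_integrable lborel {- r..r} (\<lambda>x. \<phi> x * g x)"
    using lg by (intro set_integrable_continuous_mult smooth_continuous_on sm) (simp add: locally_integrable_Icc)
  ultimately have "(LBINT x:{- r..r}. u x * deriv \<phi> x) + (LBINT x:{- r..r}. \<phi> x * g x)
      = (LBINT x:{- r..r}. u x * deriv \<phi> x + \<phi> x * g x)" by simp
  also have "\<dots> = 0"
    using primitive_onD(2)[OF primitive_on_mult[OF assms smooth_primitive_on[OF sm]], of "- r" r] r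
    by simp
  also have "(LBINT x:{- r..r}. u x * deriv \<phi> x) = (\<integral>x. u x * deriv \<phi> x \<partial>lborel)"
    unfolding set_lebesgue_integral_def
    by (rule Bochner_Integration.integral_cong) (use out in \<open>auto simp: indicator_def\<close>)
  also have "(LBINT x:{- r..r}. \<phi> x * g x) = (\<integral>x. g x * \<phi> x \<partial>lborel)"
    unfolding set_lebesgue_integral_def
    by (rule Bochner_Integration.integral_cong) (use out in \<open>auto simp: indicator_def\<close>)
  finally show "(\<integral>x. u x * deriv \<phi> x \<partial>lborel) = - (\<integral>x. g x * \<phi> x \<partial>lborel)" by simp
qed

lemma bump_integral_tendsto:
  assumes "locally_integrable h"
  shows "(\<lambda>n. \<integral>x. h x * bump a b n x \<partial>lborel) \<longlonglongrightarrow> (LBINT x:{a..b}. h x)"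
    and "integrable lborel (\<lambda>x. h x * bump a b n x)"
proof -
  have hb[measurable]: "h \<in> borel_measurable borel" by (rule locally_integrable_borel[OF assms])
  have bm[measurable]: "bump a b n \<in> borel_measurable borel" for n
    by (intro borel_measurable_continuous_onI smooth_continuous_on smooth_bump)
  have I: "integrable lborel (\<lambda>x. indicator {a..b} x *\<^sub>R h x)"
    using assms unfolding locally_integrable_Icc set_integrable_def by blast
  have bd: "norm (h x * bump a b n x) \<le> norm (indicator {a..b} x *\<^sub>R h x)" for n x
  proof (cases "x \<in> {a<..<b}")
    case True
    then show ?thesis using bump_bounds[of a b n x]
      by (auto simp: indicator_def abs_mult intro!: mult_left_le)
  qed (simp add: bump_outside)
  show "integrable lborel (\<lambda>x. h x * bump a b n x)"
    by (rule Bochner_Integration.integrable_bound[OF I]) (use bd in auto)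
  show "(\<lambda>n. \<integral>x. h x * bump a b n x \<partial>lborel) \<longlonglongrightarrow> (LBINT x:{a..b}. h x)"
    unfolding set_lebesgue_integral_def
  proof (rule integral_dominated_convergence[where w = "\<lambda>x. norm (indicator {a..b} x *\<^sub>R h x)"])
    show "AE x in lborel. (\<lambda>n. h x * bump a b n x) \<longlonglongrightarrow> indicat_real {a..b} x *\<^sub>R h x"
      using AE_lborel_singleton[of a] AE_lborel_singleton[of b]
    proof eventually_elim
      case (elim x)
      have "(\<lambda>n. h x * bump a b n x) \<longlonglongrightarrow> h x * indicator {a<..<b} x"
        by (intro tendsto_intros bump_tendsto)
      with elim show ?case by (auto simp: indicator_def split: if_splits)
    qed
  qed (use I bd in auto)
qed

lemma AE_zero_if_orthogonal_to_test_functions: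
  assumes h: "locally_integrable h"
    and z: "\<And>\<phi>. test_function \<phi> \<Longrightarrow> (\<integral>x. h x * \<phi> x \<partial>lborel) = 0"
  shows "AE x in lborel. h x = 0"
proof (rule AE_zero_if_interval_integrals_zero)
  show "set_integrable lborel {a..b} h" for a b using h by (simp add: locally_integrable_Icc)
  fix a b
  have "(\<lambda>n. \<integral>x. h x * bump a b n x \<partial>lborel) \<longlonglongrightarrow> (LBINT x:{a..b}. h x)"
    by (rule bump_integral_tendsto[OF h])
  then show "(LBINT x:{a..b}. h x) = 0"
    unfolding z[OF test_function_bump] using LIMSEQ_unique tendsto_const by blast
qed

lemma locally_integrable_diff:
  "locally_integrable u \<Longrightarrow> locally_integrable v \<Longrightarrow> locally_integrable (\<lambda>x. u x - v x)"
  by (simp add: locally_integrable_def)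

lemma integrable_mult_compact_support:
  assumes "locally_integrable h" "continuous_on UNIV \<phi>" "\<And>x. x \<notin> {a..b} \<Longrightarrow> \<phi> x = 0"
  shows "integrable lborel (\<lambda>x. h x * \<phi> x)"
proof -
  have "set_integrable lborel {a..b} (\<lambda>x. \<phi> x * h x)"
    using assms(1) continuous_on_subset[OF assms(2)]
    by (intro set_integrable_continuous_mult) (simp_all add: locally_integrable_Icc)
  also have "(\<lambda>x. indicator {a..b} x *\<^sub>R (\<phi> x * h x)) = (\<lambda>x. h x * \<phi> x)"
    using assms(3) by (auto simp: indicator_def fun_eq_iff)
  then have "set_integrable lborel {a..b} (\<lambda>x. \<phi> x * h x) = integrable lborel (\<lambda>x. h x * \<phi> x)"
    unfolding set_integrable_def by simp
  finally show ?thesis .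
qed

lemma integrable_mult_test_function:
  assumes "locally_integrable h" "test_function \<phi>"
  shows "integrable lborel (\<lambda>x. h x * \<phi> x)" "integrable lborel (\<lambda>x. h x * deriv \<phi> x)"
proof -
  obtain r where r: "r > 0" "\<forall>x. r \<le> \<bar>x\<bar> \<longrightarrow> \<phi> x = 0 \<and> deriv \<phi> x = 0"
    by (rule test_function_vanishes_outside[OF assms(2)])
  have sm: "smooth \<phi>" using assms(2) by (simp add: test_function_iff)
  show "integrable lborel (\<lambda>x. h x * \<phi> x)"
    by (rule integrable_mult_compact_support[OF assms(1) smooth_continuous_on[OF sm], of "- r" r])
      (use r in auto)
  show "integrable lborel (\<lambda>x. h x * deriv \<phi> x)"
    by (rule integrable_mult_compact_support[OF assms(1) smooth_continuous_on[OF smooth_deriv[OF sm]], of "- r" r])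
      (use r in auto)
qed

text \<open>This makes the choice inherent in \<^const>\<open>weak_deriv\<close> harmless.\<close>

lemma has_weak_deriv_AE_unique:
  assumes "has_weak_deriv u g" "has_weak_deriv u h"
  shows "AE x in lborel. g x = h x"
proof -
  have loc: "locally_integrable g" "locally_integrable h"
    using assms unfolding has_weak_deriv_def by auto
  have "AE x in lborel. g x - h x = 0"
  proof (rule AE_zero_if_orthogonal_to_test_functions[OF locally_integrable_diff[OF loc]])
    fix \<phi> assume \<phi>: "test_function \<phi>"
    have "(\<integral>x. (g x - h x) * \<phi> x \<partial>lborel) = (\<integral>x. g x * \<phi> x \<partial>lborel) - (\<integral>x. h x * \<phi> x \<partial>lborel)"
      using integrable_mult_test_function(1)[OF loc(1) \<phi>] integrable_mult_test_function(1)[OF loc(2) \<phi>]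
      by (simp add: left_diff_distrib)
    also have "\<dots> = 0" using assms \<phi> unfolding has_weak_deriv_def by simp
    finally show "(\<integral>x. (g x - h x) * \<phi> x \<partial>lborel) = 0" .
  qed
  then show ?thesis by simp
qed

text \<open>A compactly supported smooth function is the derivative of a test function as soon as its integral
  is zero: that is exactly the condition for the antiderivative to vanish to the right of the
  support, too.\<close>

lemma test_function_of_mean_zero:
  assumes sm: "smooth \<psi>" and out: "\<And>x. x \<notin> {a..b} \<Longrightarrow> \<psi> x = 0" and mean: "(\<integral>x. \<psi> x \<partial>lborel) = 0"
  obtains \<Psi> where "test_function \<Psi>" "deriv \<Psi> = \<psi>"
proof -
  have "\<exists>F. \<forall>x::real. (F has_vector_derivative \<psi> x) (at x)"
    using einterval_antiderivative[of "-\<infinity>" "\<infinity>" \<psi>] smooth_continuous_on[OF sm, of UNIV]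
    by (auto simp: continuous_on_eq_continuous_at)
  then obtain F where F: "\<And>x. (F has_field_derivative \<psi> x) (at x)"
    unfolding has_real_derivative_iff_has_vector_derivative by blast
  define \<Psi> where "\<Psi> x = F x - F (min a b)" for x
  have D: "(\<Psi> has_field_derivative \<psi> x) (at x)" for x
    unfolding \<Psi>_def by (auto intro!: derivative_eq_intros F)
  have p: "primitive_on UNIV \<Psi> \<psi>"
    by (rule primitive_on_DERIV[OF D smooth_continuous_on[OF sm]])
  have z: "\<Psi> x = 0" if x: "x \<notin> {min a b..max a b}" for x
  proof (cases "x < min a b")
    case True
    have "\<Psi> (min a b) - \<Psi> x = (LBINT y:{x..min a b}. \<psi> y)"
      using True by (intro primitive_onD(2)[OF p, symmetric]) auto
    also have "\<dots> = (LBINT y:{x..min a b}. 0)"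
      unfolding set_lebesgue_integral_def
    proof (rule integral_cong_AE)
      show "AE y in lborel. indicat_real {x..min a b} y *\<^sub>R \<psi> y = indicat_real {x..min a b} y *\<^sub>R 0"
        using AE_lborel_singleton[of a] AE_lborel_singleton[of b]
        by eventually_elim (use out in \<open>auto simp: indicator_def\<close>)
    qed (use borel_measurable_continuous_onI[OF smooth_continuous_on[OF sm]] in auto)
    finally show ?thesis by (simp add: \<Psi>_def)
  next
    case False
    then have "x > max a b" using x by auto
    have "\<Psi> x - \<Psi> (min a b) = (LBINT y:{min a b..x}. \<psi> y)"
      using False by (intro primitive_onD(2)[OF p, symmetric]) auto
    also have "\<dots> = (\<integral>y. \<psi> y \<partial>lborel)"
      unfolding set_lebesgue_integral_def
      by (rule Bochner_Integration.integral_cong)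
        (use out \<open>x > max a b\<close> in \<open>force simp: indicator_def\<close>)+
    finally show ?thesis using mean by (simp add: \<Psi>_def)
  qed
  show ?thesis
  proof (rule that)
    show "test_function \<Psi>"
      by (rule test_functionI[OF smooth_of_deriv[OF D sm]]) (use z in blast)
    show "deriv \<Psi> = \<psi>" using D by (auto intro!: DERIV_imp_deriv)
  qed
qed

text \<open>The lemma of du Bois-Reymond. The combination of the bumps of \<open>[a, b]\<close> and of \<open>[0, 1]\<close> with total
  integral zero is the derivative of a test function, so \<open>h\<close> is orthogonal to it. As the bumps
  tend to indicators, the integral of \<open>h\<close> over \<open>[a, b]\<close> is \<open>(b - a)\<close> times its integral over \<open>[0, 1]\<close>.\<close>

lemma AE_constant_if_weak_deriv_zero:
  assumes h: "locally_integrable h"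
    and z: "\<And>\<phi>. test_function \<phi> \<Longrightarrow> (\<integral>x. h x * deriv \<phi> x \<partial>lborel) = 0"
  obtains c where "AE x in lborel. h x = c"
proof -
  define c where "c = (LBINT x:{0..1}. h x)"
  have one: "locally_integrable (\<lambda>x::real. 1::real)"
    unfolding locally_integrable_Icc by (intro allI borel_integrable_atLeastAtMost' continuous_intros)
  note tl = bump_integral_tendsto
  have I: "(LBINT x:{a..b}. h x) = (b - a) * c" if ab: "a < b" for a b
  proof -
    define J where "J a b n = (\<integral>x. 1 * bump a b n x \<partial>lborel)" for a b n
    have J: "J a b \<longlonglongrightarrow> b - a" if "a < b" for a b
      using tl(1)[OF one, of a b] that unfolding J_def by (simp add: set_lebesgue_integral_def)
    have "J 0 1 n * (\<integral>x. h x * bump a b n x \<partial>lborel) = J a b n * (\<integral>x. h x * bump 0 1 n x \<partial>lborel)" for n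
    proof -
      define \<psi> where "\<psi> x = J 0 1 n * bump a b n x - J a b n * bump 0 1 n x" for x
      have "smooth \<psi>" unfolding \<psi>_def[abs_def] by (intro smooth_diff_scaled smooth_bump)
      moreover have "\<psi> x = 0" if "x \<notin> {min a 0..max b 1}" for x
      proof -
        have "x \<notin> {a<..<b}" and "x \<notin> {0<..<1}" using that by auto
        from this[THEN bump_outside] show ?thesis by (simp add: \<psi>_def)
      qed
      moreover have "(\<integral>x. \<psi> x \<partial>lborel) = 0"
        using tl(2)[OF one, of a b n] tl(2)[OF one, of 0 1 n] by (simp add: \<psi>_def J_def)
      ultimately obtain \<Psi> where \<Psi>: "test_function \<Psi>" "deriv \<Psi> = \<psi>"
        by (rule test_function_of_mean_zero)
      have "0 = (\<integral>x. h x * \<psi> x \<partial>lborel)" using z[OF \<Psi>(1)] \<Psi>(2) by simp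
      also have "\<dots> = (\<integral>x. J 0 1 n * (h x * bump a b n x) - J a b n * (h x * bump 0 1 n x) \<partial>lborel)"
        by (rule Bochner_Integration.integral_cong) (auto simp: \<psi>_def algebra_simps)
      also have "\<dots> = J 0 1 n * (\<integral>x. h x * bump a b n x \<partial>lborel) - J a b n * (\<integral>x. h x * bump 0 1 n x \<partial>lborel)"
        using tl(2)[OF h, of a b n] tl(2)[OF h, of 0 1 n] by simp
      finally show ?thesis by simp
    qed
    moreover have "(\<lambda>n. J 0 1 n * (\<integral>x. h x * bump a b n x \<partial>lborel)) \<longlonglongrightarrow> (1 - 0) * (LBINT x:{a..b}. h x)"
      by (intro tendsto_mult J tl(1) h) simp
    moreover have "(\<lambda>n. J a b n * (\<integral>x. h x * bump 0 1 n x \<partial>lborel)) \<longlonglongrightarrow> (b - a) * c"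
      unfolding c_def by (intro tendsto_mult J tl(1) h ab)
    ultimately show ?thesis using LIMSEQ_unique by fastforce
  qed
  have "AE x in lborel. h x - c = 0"
  proof (rule AE_zero_if_interval_integrals_zero)
    have cc: "set_integrable lborel {a..b} (\<lambda>x. c)" for a b :: real
      by (intro borel_integrable_atLeastAtMost' continuous_intros)
    have hh: "set_integrable lborel {a..b} h" for a b using h by (simp add: locally_integrable_Icc)
    show "set_integrable lborel {a..b} (\<lambda>x. h x - c)" for a b using cc hh by simp
    fix a b :: real assume "a < b"
    then show "(LBINT x:{a..b}. h x - c) = 0"
      using cc[of a b] hh[of a b] I[of a b] by (simp add: set_integral_const)
  qed
  then show ?thesis by (intro that[of c]) simp
qed

lemma locally_integrable_has_primitive:
  assumes "locally_integrable g"
  obtains U where "primitive_on UNIV U g"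
proof -
  have gi: "set_integrable lborel {a..b} g" for a b using assms by (simp add: locally_integrable_Icc)
  define U where "U x = (if 0 \<le> x then integral {0..x} g else - integral {x..0} g)" for x
  have "primitive_on UNIV U g"
    unfolding primitive_on_def
  proof (intro allI impI conjI gi)
    fix a b :: real assume ab: "a \<le> b \<and> {a..b} \<subseteq> UNIV"
    have io: "g integrable_on {x..y}" for x y by (rule set_borel_integral_eq_integral(1)[OF gi])
    have "(LBINT x:{a..b}. g x) = integral {a..b} g" by (rule set_borel_integral_eq_integral(2)[OF gi])
    also have "\<dots> = U b - U a"
    proof -
      consider "0 \<le> a" | "a < 0" "0 \<le> b" | "b < 0" by linarith
      then show ?thesis
      proof cases
        case 1
        then show ?thesis using Henstock_Kurzweil_Integration.integral_combine[of 0 a b g] ab io by (simp add: U_def)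
      next
        case 2
        then show ?thesis using Henstock_Kurzweil_Integration.integral_combine[of a 0 b g] ab io by (simp add: U_def)
      next
        case 3
        then show ?thesis using Henstock_Kurzweil_Integration.integral_combine[of a b 0 g] ab io by (simp add: U_def)
      qed
    qed
    finally show "(LBINT x:{a..b}. g x) = U b - U a" .
  qed
  then show ?thesis by (rule that)
qed

text \<open>Sobolev functions on the line have an absolutely continuous representative: \<open>u\<close> and an indefinite
  integral of \<open>g\<close> differ by a function with weak derivative zero.\<close>

lemma has_weak_deriv_imp_AE_primitive:
  assumes "has_weak_deriv u g"
  obtains U where "primitive_on UNIV U g" "AE x in lborel. u x = U x"
proof -
  have loc: "locally_integrable u" "locally_integrable g"
    using assms unfolding has_weak_deriv_def by auto
  obtain V where V: "primitive_on UNIV V g" using locally_integrable_has_primitive[OF loc(2)] .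
  have wV: "has_weak_deriv V g" by (rule primitive_imp_has_weak_deriv[OF V])
  then have locV: "locally_integrable V" unfolding has_weak_deriv_def by auto
  obtain c where c: "AE x in lborel. u x - V x = c"
  proof (rule AE_constant_if_weak_deriv_zero[OF locally_integrable_diff[OF loc(1) locV]])
    fix \<phi> assume \<phi>: "test_function \<phi>"
    have "(\<integral>x. (u x - V x) * deriv \<phi> x \<partial>lborel) = (\<integral>x. u x * deriv \<phi> x \<partial>lborel) - (\<integral>x. V x * deriv \<phi> x \<partial>lborel)"
      using integrable_mult_test_function(2)[OF loc(1) \<phi>] integrable_mult_test_function(2)[OF locV \<phi>]
      by (simp add: left_diff_distrib)
    also have "\<dots> = 0" using assms wV \<phi> unfolding has_weak_deriv_def by simp
    finally show "(\<integral>x. (u x - V x) * deriv \<phi> x \<partial>lborel) = 0" .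
  qed
  show ?thesis
  proof (rule that[of "\<lambda>x. V x + c"])
    show "primitive_on UNIV (\<lambda>x. V x + c) g" using V unfolding primitive_on_def by simp
    show "AE x in lborel. u x = V x + c" using c by eventually_elim simp
  qed
qed

section \<open>The Gaussian measure\<close>

abbreviation \<phi> :: "real \<Rightarrow> real" where "\<phi> \<equiv> std_normal_density"

lemma phi_pos: "0 < \<phi> x" by (simp add: normal_density_pos)

lemma phi_DERIV: "(\<phi> has_field_derivative - x * \<phi> x) (at x)"
  unfolding std_normal_density_def[abs_def]
  by (auto intro!: derivative_eq_intros simp: field_simps power2_eq_square)

lemma phi_continuous: "continuous_on S \<phi>"
  by (intro continuous_at_imp_continuous_on ballI DERIV_isCont[OF phi_DERIV])

lemma phi_integrable: "integrable lborel \<phi>" and phi_mass: "(\<integral>x. \<phi> x \<partial>lborel) = 1"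
  by simp_all

lemma phi_uminus: "\<phi> (- x) = \<phi> x"
  by (simp add: std_normal_density_def)

lemma sqrt_2pi_bounds: "2 \<le> sqrt (2 * pi)" "sqrt (2 * pi) \<le> 3"
  using pi_gt3 pi_less_4 by (auto intro!: real_le_rsqrt real_le_lsqrt)

lemma phi_bounds: "exp (- x\<^sup>2 / 2) / 3 \<le> \<phi> x" "\<phi> x \<le> exp (- x\<^sup>2 / 2) / 2"
  unfolding std_normal_density_def using sqrt_2pi_bounds
  by (auto simp: field_simps intro!: mult_left_mono)

text \<open>Shift the half-line to the origin and use
  \<open>\<phi>(t + x) = sqrt(2 pi) \<phi>(t) \<phi>(x) exp(-t x) \<le> 3 \<phi>(t) \<phi>(x)\<close>.\<close>

lemma gauss_tail_upper:
  assumes "0 \<le> t"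
  shows "(\<integral>x. indicator {t..} x * \<phi> x \<partial>lborel) \<le> 3 * \<phi> t"
proof -
  have I: "integrable lborel (\<lambda>x. indicator {0..} x * \<phi> (t + x))"
    using integrable_mult_indicator[OF _ lborel_integrable_real_affine[OF integrable_normal_density, where c = 1 and t = t], of "{0..}"]
    by simp
  have "(\<integral>x. indicator {t..} x * \<phi> x \<partial>lborel) = (\<integral>x. indicator {0..} x * \<phi> (t + x) \<partial>lborel)"
    by (subst lborel_integral_real_affine[where c = 1 and t = t])
      (auto intro!: Bochner_Integration.integral_cong simp: indicator_def)
  also have "\<dots> \<le> (\<integral>x. (3 * \<phi> t) * \<phi> x \<partial>lborel)"
  proof (rule integral_mono[OF I])
    fix x
    show "indicator {0..} x * \<phi> (t + x) \<le> (3 * \<phi> t) * \<phi> x"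
    proof (cases "0 \<le> x")
      case True
      have "- (t + x)\<^sup>2 / 2 = - t\<^sup>2 / 2 + - x\<^sup>2 / 2 + - (t * x)"
        by (simp add: power2_eq_square field_simps)
      then have "exp (- (t + x)\<^sup>2 / 2) = exp (- t\<^sup>2 / 2) * exp (- x\<^sup>2 / 2) * exp (- (t * x))"
        by (simp only: exp_add)
      then have "\<phi> (t + x) = sqrt (2 * pi) * \<phi> t * \<phi> x * exp (- (t * x))"
        by (simp add: std_normal_density_def)
      also have "\<dots> \<le> 3 * \<phi> t * \<phi> x * 1"
        using sqrt_2pi_bounds True assms phi_pos[of t] phi_pos[of x]
        by (intro mult_mono) auto
      finally show ?thesis using True by simp
    qed simp
  qed simp
  finally show ?thesis by simp
qed

lemma gauss_tail_lower:
  assumes "t \<le> 0"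
  shows "(\<integral>x. indicator {..t} x * \<phi> x \<partial>lborel) \<le> 3 * \<phi> t"
proof -
  have "(\<integral>x. indicator {..t} x * \<phi> x \<partial>lborel) = (\<integral>x. indicator {- t..} x * \<phi> x \<partial>lborel)"
    by (subst lborel_integral_real_affine[where c = "-1" and t = 0])
      (auto intro!: Bochner_Integration.integral_cong simp: indicator_def phi_uminus)
  also have "\<dots> \<le> 3 * \<phi> t"
    using gauss_tail_upper[of "- t"] assms by (simp add: phi_uminus)
  finally show ?thesis .
qed

definition distribution_function :: "(real \<Rightarrow> real) \<Rightarrow> real \<Rightarrow> real" where
  "distribution_function \<rho> x = (\<integral>s. indicator {..x} s * \<rho> s \<partial>lborel)"

lemma integrable_indicator_mult:
  fixes \<rho> :: "real \<Rightarrow> real"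
  assumes "integrable lborel \<rho>" "A \<in> sets borel"
  shows "integrable lborel (\<lambda>s. indicator A s * \<rho> s)"
  using integrable_mult_indicator[of A lborel \<rho>] assms by simp

lemma distribution_function_diff:
  assumes "integrable lborel \<rho>" "a \<le> b"
  shows "distribution_function \<rho> b - distribution_function \<rho> a = (LBINT x:{a..b}. \<rho> x)"
proof -
  have "distribution_function \<rho> b - distribution_function \<rho> a
      = (\<integral>s. indicator {..b} s * \<rho> s - indicator {..a} s * \<rho> s \<partial>lborel)"
    unfolding distribution_function_def
    by (rule Bochner_Integration.integral_diff[symmetric]; intro integrable_indicator_mult assms; simp)
  also have "\<dots> = (LBINT x:{a..b}. \<rho> x)"
    unfolding set_lebesgue_integral_def
  proof (rule integral_cong_AE)
    show "AE x in lborel. indicator {..b} x * \<rho> x - indicator {..a} x * \<rho> x = indicat_real {a..b} x *\<^sub>R \<rho> x"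
      using AE_lborel_singleton[of a] by eventually_elim (use assms(2) in \<open>auto simp: indicator_def\<close>)
  qed (use borel_measurable_integrable[OF assms(1)] in auto)
  finally show ?thesis .
qed

lemma distribution_function_DERIV:
  assumes "integrable lborel \<rho>" "continuous_on UNIV \<rho>"
  shows "(distribution_function \<rho> has_field_derivative \<rho> x) (at x)"
proof -
  have "\<exists>F. \<forall>x::real. (F has_vector_derivative \<rho> x) (at x)"
    using einterval_antiderivative[of "-\<infinity>" "\<infinity>" \<rho>] assms(2)
    by (auto simp: continuous_on_eq_continuous_at)
  then obtain G where G: "\<And>x. (G has_field_derivative \<rho> x) (at x)"
    unfolding has_real_derivative_iff_has_vector_derivative by blast
  note pG = primitive_on_DERIV[OF G assms(2)]
  have eq: "distribution_function \<rho> b - distribution_function \<rho> a = G b - G a" if "a \<le> b" for a b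
    using distribution_function_diff[OF assms(1) that] primitive_onD(2)[OF pG that] by simp
  have "distribution_function \<rho> = (\<lambda>y. G y + (distribution_function \<rho> 0 - G 0))"
  proof
    fix y show "distribution_function \<rho> y = G y + (distribution_function \<rho> 0 - G 0)"
      using eq[of 0 y] eq[of y 0] by (cases "0 \<le> y") auto
  qed
  moreover have "((\<lambda>y. G y + (distribution_function \<rho> 0 - G 0)) has_field_derivative \<rho> x) (at x)"
    by (auto intro!: derivative_eq_intros G)
  ultimately show ?thesis by simp
qed

lemma distribution_function_complement:
  assumes "integrable lborel \<rho>"
  shows "(\<integral>s. \<rho> s \<partial>lborel) - distribution_function \<rho> x = (\<integral>s. indicator {x..} s * \<rho> s \<partial>lborel)"
proof -
  have "(\<integral>s. \<rho> s \<partial>lborel) - distribution_function \<rho> x = (\<integral>s. \<rho> s - indicator {..x} s * \<rho> s \<partial>lborel)"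
    unfolding distribution_function_def
    by (rule Bochner_Integration.integral_diff[symmetric]; intro integrable_indicator_mult assms; simp)
  also have "\<dots> = (\<integral>s. indicator {x..} s * \<rho> s \<partial>lborel)"
  proof (rule integral_cong_AE)
    show "AE s in lborel. \<rho> s - indicator {..x} s * \<rho> s = indicator {x..} s * \<rho> s"
      using AE_lborel_singleton[of x] by eventually_elim (auto simp: indicator_def)
  qed (use borel_measurable_integrable[OF assms(1)] in auto)
  finally show ?thesis .
qed

lemma distribution_function_at_top:
  assumes "integrable lborel \<rho>"
  shows "((\<lambda>n. distribution_function \<rho> (real n)) \<longlongrightarrow> (\<integral>s. \<rho> s \<partial>lborel)) sequentially"
    and "((\<lambda>n. distribution_function \<rho> (- real n)) \<longlongrightarrow> 0) sequentially"
proof -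
  have [measurable]: "\<rho> \<in> borel_measurable borel" using borel_measurable_integrable[OF assms] by simp
  show "((\<lambda>n. distribution_function \<rho> (real n)) \<longlongrightarrow> (\<integral>s. \<rho> s \<partial>lborel)) sequentially"
    unfolding distribution_function_def
  proof (rule integral_dominated_convergence[where w = "\<lambda>x. norm (\<rho> x)"])
    show "AE x in lborel. (\<lambda>n. indicator {..real n} x * \<rho> x) \<longlonglongrightarrow> \<rho> x"
    proof (rule AE_I2)
      fix x
      obtain N :: nat where "x \<le> real N" using real_arch_simple by blast
      then have "\<forall>\<^sub>F n in sequentially. indicator {..real n} x * \<rho> x = \<rho> x"
        using eventually_ge_at_top[of N] by (elim eventually_mono) (auto simp: indicator_def)
      then show "(\<lambda>n. indicator {..real n} x * \<rho> x) \<longlonglongrightarrow> \<rho> x" by (rule tendsto_eventually)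
    qed
  qed (use assms in \<open>auto simp: indicator_def\<close>)
  have "((\<lambda>n. distribution_function \<rho> (- real n)) \<longlongrightarrow> (\<integral>s. 0 \<partial>(lborel :: real measure))) sequentially"
    unfolding distribution_function_def
  proof (rule integral_dominated_convergence[where w = "\<lambda>x. norm (\<rho> x)"])
    show "AE x in lborel. (\<lambda>n. indicator {..- real n} x * \<rho> x) \<longlonglongrightarrow> 0"
    proof (rule AE_I2)
      fix x
      obtain N :: nat where "- x < real N" using reals_Archimedean2 by blast
      then have "\<forall>\<^sub>F n in sequentially. indicator {..- real n} x * \<rho> x = 0"
        using eventually_ge_at_top[of N] by (elim eventually_mono) (auto simp: indicator_def)
      then show "(\<lambda>n. indicator {..- real n} x * \<rho> x) \<longlonglongrightarrow> 0" by (rule tendsto_eventually)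
    qed
  qed (use assms in \<open>auto simp: indicator_def\<close>)
  then show "((\<lambda>n. distribution_function \<rho> (- real n)) \<longlongrightarrow> 0) sequentially" by simp
qed

lemma distribution_function_attains:
  assumes "integrable lborel \<rho>" "continuous_on UNIV \<rho>" "(\<integral>s. \<rho> s \<partial>lborel) = 1" "0 < y" "y < 1"
  obtains x where "distribution_function \<rho> x = y"
proof -
  note L = distribution_function_at_top[OF assms(1)]
  have "\<forall>\<^sub>F n in sequentially. distribution_function \<rho> (real n) > y \<and> distribution_function \<rho> (- real n) < y"
    using order_tendstoD(1)[OF L(1), of y] order_tendstoD(2)[OF L(2), of y] assms(3-)
    by (simp add: eventually_conj)
  then obtain n where n: "distribution_function \<rho> (real n) > y" "distribution_function \<rho> (- real n) < y"
    using eventually_happens'[OF sequentially_bot] by blast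
  have "\<exists>x. - real n \<le> x \<and> x \<le> real n \<and> distribution_function \<rho> x = y"
    using n by (intro IVT') (auto intro!: continuous_at_imp_continuous_on DERIV_isCont[OF distribution_function_DERIV[OF assms(1,2)]])
  then show ?thesis using that by blast
qed

definition \<Phi> :: "real \<Rightarrow> real" where "\<Phi> = distribution_function \<phi>"

lemma Phi_DERIV: "(\<Phi> has_field_derivative \<phi> t) (at t)"
  unfolding \<Phi>_def by (rule distribution_function_DERIV[OF phi_integrable phi_continuous])

lemma Phi_strict_mono: "s < t \<Longrightarrow> \<Phi> s < \<Phi> t"
  by (rule DERIV_pos_imp_increasing) (use Phi_DERIV phi_pos in blast)+

lemma Phi_less_iff: "\<Phi> s < \<Phi> t \<longleftrightarrow> s < t"
  using Phi_strict_mono[of s t] Phi_strict_mono[of t s] by (cases s t rule: linorder_cases) auto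

lemma Phi_le_iff: "\<Phi> s \<le> \<Phi> t \<longleftrightarrow> s \<le> t"
  using Phi_less_iff[of t s] by (simp add: not_less[symmetric])

lemma inj_Phi: "inj \<Phi>"
  by (rule injI) (metis Phi_le_iff order_antisym order_refl)

lemma Phi_ge_0: "0 \<le> \<Phi> t" and Phi_le_1: "\<Phi> t \<le> 1"
proof -
  have "0 \<le> distribution_function \<phi> t" unfolding distribution_function_def by simp
  moreover have "0 \<le> 1 - distribution_function \<phi> t"
    using distribution_function_complement[OF phi_integrable, of t] by simp
  ultimately show "0 \<le> \<Phi> t" "\<Phi> t \<le> 1" by (simp_all add: \<Phi>_def)
qed

lemma Phi_gt_0: "0 < \<Phi> t" and Phi_lt_1: "\<Phi> t < 1"
  using Phi_strict_mono[of "t - 1" t] Phi_ge_0[of "t - 1"] Phi_strict_mono[of t "t + 1"] Phi_le_1[of "t + 1"]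
  by auto

lemma Phi_tails: "0 \<le> t \<Longrightarrow> 1 - \<Phi> t \<le> 3 * \<phi> t" "t \<le> 0 \<Longrightarrow> \<Phi> t \<le> 3 * \<phi> t"
  using distribution_function_complement[OF phi_integrable, of t] gauss_tail_upper[of t] gauss_tail_lower[of t]
  by (simp_all add: \<Phi>_def phi_mass distribution_function_def[of _ t] cong del: if_weak_cong)

lemma Phi_attains: assumes "0 < y" "y < 1" obtains t where "\<Phi> t = y"
  using distribution_function_attains[OF phi_integrable phi_continuous phi_mass assms] unfolding \<Phi>_def by blast

lemma Phi_at_top: "(\<lambda>n. \<Phi> (real n)) \<longlonglongrightarrow> 1" "(\<lambda>n. \<Phi> (- real n)) \<longlonglongrightarrow> 0"
  using distribution_function_at_top[OF phi_integrable] by (simp_all add: \<Phi>_def)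

lemma inv_Phi_DERIV:
  assumes "0 < y" "y < 1"
  shows "(inv \<Phi> has_field_derivative inverse (\<phi> (inv \<Phi> y))) (at y)"
proof -
  have surj: "\<Phi> (inv \<Phi> z) = z" if "0 < z" "z < 1" for z
    using Phi_attains[OF that] by (metis f_inv_into_f rangeI)
  have "isCont (inv \<Phi>) (\<Phi> (inv \<Phi> y))"
    by (rule isCont_inverse_function[where d = 1])
      (auto simp: inv_f_f[OF inj_Phi] intro: DERIV_isCont[OF Phi_DERIV])
  then have "isCont (inv \<Phi>) y" by (simp add: surj assms)
  then show ?thesis
    by (intro DERIV_inverse_function[where f = \<Phi> and a = 0 and b = 1] Phi_DERIV)
      (use assms surj phi_pos[of "inv \<Phi> y"] in auto)
qed

text \<open>The \<open>L\<^sup>1\<close> Poincare inequality of the Gaussian measure. Bound \<open>|f(x) - f(0)|\<close> by the integral of \<open>|f'|\<close> between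
  \<open>0\<close> and \<open>x\<close> and exchange the integrals: the weight that \<open>|f'(s)|\<close> acquires is a Gaussian tail beyond
  \<open>s\<close>, which is at most \<open>3 \<phi>(s)\<close>. Replacing \<open>f(0)\<close> by the mean \<open>1\<close> costs a factor \<open>2\<close>.\<close>

lemma gauss_L1_poincare:
  assumes prim: "primitive_on UNIV f f'"
    and f'm: "f' \<in> borel_measurable borel"
    and fint: "integrable lborel (\<lambda>x. f x * \<phi> x)"
    and mass: "(\<integral>x. f x * \<phi> x \<partial>lborel) = 1"
    and f'int: "integrable lborel (\<lambda>x. f' x * \<phi> x)"
  shows "(\<integral>x. \<bar>f x - 1\<bar> * \<phi> x \<partial>lborel) \<le> 6 * (\<integral>x. \<bar>f' x\<bar> * \<phi> x \<partial>lborel)"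
proof -
  note [measurable] = f'm
  have [measurable]: "f \<in> borel_measurable borel"
    by (intro borel_measurable_continuous_onI primitive_continuous[OF prim])
  \<comment> \<open>\<open>B x s\<close>: the point \<open>s\<close> lies between \<open>0\<close> and \<open>x\<close>\<close>
  define B where "B x s \<longleftrightarrow> (0 \<le> s \<and> s \<le> x) \<or> (x \<le> s \<and> s \<le> 0)" for x s :: real
  have [measurable]: "Measurable.pred (borel \<Otimes>\<^sub>M borel) (\<lambda>z. B (fst z) (snd z))"
    unfolding B_def by measurable
  have [measurable]: "Measurable.pred borel (B x)" "Measurable.pred borel (\<lambda>x. B x s)" for x s
    unfolding B_def by measurable
  have abs_prim: "ennreal \<bar>f b - f a\<bar> \<le> (\<integral>\<^sup>+s. ennreal (indicator {a..b} s * \<bar>f' s\<bar>) \<partial>lborel)" if "a \<le> b" for a b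
  proof -
    have si: "set_integrable lborel {a..b} f'" and eq: "f b - f a = (LBINT s:{a..b}. f' s)"
      using primitive_onD[OF prim that] by auto
    have "\<bar>f b - f a\<bar> \<le> (\<integral>s. indicator {a..b} s * \<bar>f' s\<bar> \<partial>lborel)"
      unfolding eq set_lebesgue_integral_def
      by (rule order_trans[OF integral_abs_bound]) (auto simp: abs_mult)
    moreover have "integrable lborel (\<lambda>s. indicator {a..b} s * \<bar>f' s\<bar>)"
      using set_integrable_abs[OF si] by (simp add: set_integrable_def)
    ultimately show ?thesis
      by (subst nn_integral_eq_integral) (auto intro: ennreal_leI)
  qed
  have step1: "ennreal (\<bar>f x - f 0\<bar>) \<le> (\<integral>\<^sup>+s. ennreal (of_bool (B x s) * \<bar>f' s\<bar>) \<partial>lborel)" for x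
  proof (cases "0 \<le> x")
    case True
    have "(\<integral>\<^sup>+s. ennreal (indicator {0..x} s * \<bar>f' s\<bar>) \<partial>lborel) \<le> (\<integral>\<^sup>+s. ennreal (of_bool (B x s) * \<bar>f' s\<bar>) \<partial>lborel)"
      by (intro nn_integral_mono) (auto simp: B_def indicator_def)
    with abs_prim[OF True] show ?thesis by (rule order_trans)
  next
    case False
    have "(\<integral>\<^sup>+s. ennreal (indicator {x..0} s * \<bar>f' s\<bar>) \<partial>lborel) \<le> (\<integral>\<^sup>+s. ennreal (of_bool (B x s) * \<bar>f' s\<bar>) \<partial>lborel)"
      by (intro nn_integral_mono) (auto simp: B_def indicator_def)
    with abs_prim[of x 0] False show ?thesis by (auto simp: abs_minus_commute intro: order_trans)
  qed
  have step2: "(\<integral>\<^sup>+x. ennreal (of_bool (B x s) * \<phi> x) \<partial>lborel) \<le> ennreal (3 * \<phi> s)" for s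
  proof -
    consider "s > 0" | "s < 0" | "s = 0" by linarith
    then show ?thesis
    proof cases
      case 1
      then have "(\<integral>\<^sup>+x. ennreal (of_bool (B x s) * \<phi> x) \<partial>lborel) = (\<integral>\<^sup>+x. ennreal (indicator {s..} x * \<phi> x) \<partial>lborel)"
        by (intro nn_integral_cong) (auto simp: B_def indicator_def)
      also have "\<dots> = ennreal (\<integral>x. indicator {s..} x * \<phi> x \<partial>lborel)"
        by (intro nn_integral_eq_integral integrable_indicator_mult) auto
      finally show ?thesis using gauss_tail_upper[of s] 1 by (simp add: ennreal_leI)
    next
      case 2
      then have "(\<integral>\<^sup>+x. ennreal (of_bool (B x s) * \<phi> x) \<partial>lborel) = (\<integral>\<^sup>+x. ennreal (indicator {..s} x * \<phi> x) \<partial>lborel)"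
        by (intro nn_integral_cong) (auto simp: B_def indicator_def)
      also have "\<dots> = ennreal (\<integral>x. indicator {..s} x * \<phi> x \<partial>lborel)"
        by (intro nn_integral_eq_integral integrable_indicator_mult) auto
      finally show ?thesis using gauss_tail_lower[of s] 2 by (simp add: ennreal_leI)
    next
      case 3
      then have "(\<integral>\<^sup>+x. ennreal (of_bool (B x s) * \<phi> x) \<partial>lborel) \<le> (\<integral>\<^sup>+x. ennreal (\<phi> x) \<partial>lborel)"
        by (intro nn_integral_mono) auto
      also have "\<dots> = ennreal 1" by (subst nn_integral_eq_integral) auto
      also have "\<dots> \<le> ennreal (3 * \<phi> s)" using phi_bounds(1)[of 0] 3 by (intro ennreal_leI) simp
      finally show ?thesis .
    qed
  qed
  have I': "integrable lborel (\<lambda>x. \<bar>f' x\<bar> * \<phi> x)"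
    using integrable_abs[OF f'int] by (simp add: abs_mult)
  define J where "J = (\<integral>x. \<bar>f' x\<bar> * \<phi> x \<partial>lborel)"
  have "(\<integral>\<^sup>+x. ennreal (\<bar>f x - f 0\<bar> * \<phi> x) \<partial>lborel)
      \<le> (\<integral>\<^sup>+x. (\<integral>\<^sup>+s. ennreal (of_bool (B x s) * \<bar>f' s\<bar>) \<partial>lborel) * ennreal (\<phi> x) \<partial>lborel)"
    using step1 by (intro nn_integral_mono) (auto simp: ennreal_mult intro!: mult_right_mono)
  also have "\<dots> = (\<integral>\<^sup>+x. (\<integral>\<^sup>+s. ennreal (of_bool (B x s) * \<bar>f' s\<bar> * \<phi> x) \<partial>lborel) \<partial>lborel)"
    by (intro nn_integral_cong) (simp add: nn_integral_multc[symmetric] ennreal_mult)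
  also have "\<dots> = (\<integral>\<^sup>+s. (\<integral>\<^sup>+x. ennreal (of_bool (B x s) * \<bar>f' s\<bar> * \<phi> x) \<partial>lborel) \<partial>lborel)"
  proof (rule lborel_pair.Fubini'[symmetric])
    have "(\<lambda>z. ennreal (of_bool (B (fst z) (snd z)) * \<bar>f' (snd z)\<bar> * \<phi> (fst z))) \<in> borel_measurable (borel \<Otimes>\<^sub>M borel)"
      by measurable
    then show "(\<lambda>(x, s). ennreal (of_bool (B x s) * \<bar>f' s\<bar> * \<phi> x)) \<in> borel_measurable (lborel \<Otimes>\<^sub>M lborel)"
      by (simp add: case_prod_beta cong: measurable_cong_sets sets_pair_measure_cong)
  qed
  also have "\<dots> = (\<integral>\<^sup>+s. ennreal \<bar>f' s\<bar> * (\<integral>\<^sup>+x. ennreal (of_bool (B x s) * \<phi> x) \<partial>lborel) \<partial>lborel)"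
  proof (intro nn_integral_cong)
    fix s
    have "(\<integral>\<^sup>+x. ennreal (of_bool (B x s) * \<bar>f' s\<bar> * \<phi> x) \<partial>lborel)
        = (\<integral>\<^sup>+x. ennreal \<bar>f' s\<bar> * ennreal (of_bool (B x s) * \<phi> x) \<partial>lborel)"
      by (intro nn_integral_cong) (simp add: ennreal_mult[symmetric] ac_simps)
    then show "(\<integral>\<^sup>+x. ennreal (of_bool (B x s) * \<bar>f' s\<bar> * \<phi> x) \<partial>lborel)
        = ennreal \<bar>f' s\<bar> * (\<integral>\<^sup>+x. ennreal (of_bool (B x s) * \<phi> x) \<partial>lborel)"
      by (simp add: nn_integral_cmult)
  qed
  also have "\<dots> \<le> (\<integral>\<^sup>+s. ennreal \<bar>f' s\<bar> * ennreal (3 * \<phi> s) \<partial>lborel)"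
    by (intro nn_integral_mono mult_left_mono step2) simp
  also have "\<dots> = (\<integral>\<^sup>+s. ennreal (3 * (\<bar>f' s\<bar> * \<phi> s)) \<partial>lborel)"
    by (intro nn_integral_cong) (simp add: ennreal_mult[symmetric] ac_simps)
  also have "\<dots> = ennreal (3 * J)"
    using I' by (subst nn_integral_eq_integral) (auto simp: J_def)
  finally have key: "(\<integral>\<^sup>+x. ennreal (\<bar>f x - f 0\<bar> * \<phi> x) \<partial>lborel) \<le> ennreal (3 * J)" .
  have i0: "integrable lborel (\<lambda>x. f x * \<phi> x - f 0 * \<phi> x)"
    using fint by simp
  have i0': "integrable lborel (\<lambda>x. \<bar>f x - f 0\<bar> * \<phi> x)"
    using integrable_abs[OF i0] by (simp add: abs_mult flip: left_diff_distrib)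
  have k0: "(\<integral>x. \<bar>f x - f 0\<bar> * \<phi> x \<partial>lborel) \<le> 3 * J"
    using key by (subst (asm) nn_integral_eq_integral[OF i0']) (auto simp: J_def)
  have "1 - f 0 = (\<integral>x. f x * \<phi> x - f 0 * \<phi> x \<partial>lborel)"
    using fint mass by simp
  then have "\<bar>1 - f 0\<bar> \<le> (\<integral>x. \<bar>f x - f 0\<bar> * \<phi> x \<partial>lborel)"
    using integral_abs_bound[of lborel "\<lambda>x. f x * \<phi> x - f 0 * \<phi> x"] by (simp add: abs_mult flip: left_diff_distrib)
  with k0 have k1: "\<bar>1 - f 0\<bar> \<le> 3 * J" by simp
  have i1: "integrable lborel (\<lambda>x. \<bar>f x - 1\<bar> * \<phi> x)"
  proof -
    have "integrable lborel (\<lambda>x. \<bar>f x * \<phi> x - \<phi> x\<bar>)" using fint by simp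
    also have "(\<lambda>x. \<bar>f x * \<phi> x - \<phi> x\<bar>) = (\<lambda>x. \<bar>f x - 1\<bar> * \<phi> x)"
      using abs_mult[of "f x - 1" "\<phi> x" for x] by (simp add: left_diff_distrib)
    finally show ?thesis .
  qed
  have "(\<integral>x. \<bar>f x - 1\<bar> * \<phi> x \<partial>lborel) \<le> (\<integral>x. \<bar>f x - f 0\<bar> * \<phi> x + \<bar>1 - f 0\<bar> * \<phi> x \<partial>lborel)"
  proof (rule integral_mono[OF i1])
    fix x
    have "\<bar>f x - 1\<bar> \<le> \<bar>f x - f 0\<bar> + \<bar>1 - f 0\<bar>" by simp
    then have "\<bar>f x - 1\<bar> * \<phi> x \<le> (\<bar>f x - f 0\<bar> + \<bar>1 - f 0\<bar>) * \<phi> x"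
      by (rule mult_right_mono) simp
    then show "\<bar>f x - 1\<bar> * \<phi> x \<le> \<bar>f x - f 0\<bar> * \<phi> x + \<bar>1 - f 0\<bar> * \<phi> x"
      by (simp add: distrib_right)
  qed (use i0' in simp)
  also have "\<dots> = (\<integral>x. \<bar>f x - f 0\<bar> * \<phi> x \<partial>lborel) + \<bar>1 - f 0\<bar>"
    using i0' by simp
  finally show ?thesis using k0 k1 unfolding J_def by simp
qed

section \<open>Transport to the Gaussian and the log-Sobolev deficit\<close>

lemma integral_cauchy_schwarz:
  fixes a b :: "'a \<Rightarrow> real"
  assumes [measurable]: "a \<in> borel_measurable N" "b \<in> borel_measurable N"
    and ia: "integrable N (\<lambda>x. (a x)\<^sup>2)" and ib: "integrable N (\<lambda>x. (b x)\<^sup>2)"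
  shows "integrable N (\<lambda>x. a x * b x)"
    and "(\<integral>x. \<bar>a x * b x\<bar> \<partial>N) \<le> sqrt (\<integral>x. (a x)\<^sup>2 \<partial>N) * sqrt (\<integral>x. (b x)\<^sup>2 \<partial>N)"
proof -
  show i: "integrable N (\<lambda>x. a x * b x)"
  proof (rule Bochner_Integration.integrable_bound[of N "\<lambda>x. (a x)\<^sup>2 + (b x)\<^sup>2"])
    show "AE x in N. norm (a x * b x) \<le> norm ((a x)\<^sup>2 + (b x)\<^sup>2)"
    proof (rule AE_I2)
      fix x
      have "2 * (\<bar>a x\<bar> * \<bar>b x\<bar>) \<le> \<bar>a x\<bar>\<^sup>2 + \<bar>b x\<bar>\<^sup>2"
        using sum_squares_bound[of "\<bar>a x\<bar>" "\<bar>b x\<bar>"] by simp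
      then show "norm (a x * b x) \<le> norm ((a x)\<^sup>2 + (b x)\<^sup>2)"
        by (auto simp: abs_mult intro: order_trans[rotated])
    qed
  qed (use ia ib in auto)
  have "(\<integral>\<^sup>+x. ennreal \<bar>a x\<bar> * ennreal \<bar>b x\<bar> \<partial>N)\<^sup>2 \<le> (\<integral>\<^sup>+x. ennreal \<bar>a x\<bar> ^ 2 \<partial>N) * (\<integral>\<^sup>+x. ennreal \<bar>b x\<bar> ^ 2 \<partial>N)"
    by (rule Cauchy_Schwarz_nn_integral) auto
  also have "(\<integral>\<^sup>+x. ennreal \<bar>a x\<bar> * ennreal \<bar>b x\<bar> \<partial>N) = ennreal (\<integral>x. \<bar>a x * b x\<bar> \<partial>N)"
    using integrable_abs[OF i] by (subst nn_integral_eq_integral[symmetric]) (auto simp: abs_mult ennreal_mult)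
  also have "(\<integral>\<^sup>+x. ennreal \<bar>a x\<bar> ^ 2 \<partial>N) = ennreal (\<integral>x. (a x)\<^sup>2 \<partial>N)"
    using ia by (subst nn_integral_eq_integral[symmetric]) (auto simp: ennreal_power)
  also have "(\<integral>\<^sup>+x. ennreal \<bar>b x\<bar> ^ 2 \<partial>N) = ennreal (\<integral>x. (b x)\<^sup>2 \<partial>N)"
    using ib by (subst nn_integral_eq_integral[symmetric]) (auto simp: ennreal_power)
  finally have "(\<integral>x. \<bar>a x * b x\<bar> \<partial>N)\<^sup>2 \<le> (\<integral>x. (a x)\<^sup>2 \<partial>N) * (\<integral>x. (b x)\<^sup>2 \<partial>N)"
    by (simp add: ennreal_power ennreal_mult[symmetric])
  then show "(\<integral>x. \<bar>a x * b x\<bar> \<partial>N) \<le> sqrt (\<integral>x. (a x)\<^sup>2 \<partial>N) * sqrt (\<integral>x. (b x)\<^sup>2 \<partial>N)"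
    unfolding real_sqrt_mult[symmetric] by (rule real_le_rsqrt)
qed

lemma set_integral_cauchy_schwarz:
  fixes a b :: "real \<Rightarrow> real"
  assumes [measurable]: "a \<in> borel_measurable borel" "b \<in> borel_measurable borel" "A \<in> sets borel"
    and ia: "set_integrable lborel A (\<lambda>x. (a x)\<^sup>2)" and ib: "set_integrable lborel A (\<lambda>x. (b x)\<^sup>2)"
  shows "(LBINT x:A. \<bar>a x * b x\<bar>) \<le> sqrt (LBINT x:A. (a x)\<^sup>2) * sqrt (LBINT x:A. (b x)\<^sup>2)"
    and "set_integrable lborel A (\<lambda>x. a x * b x)"
proof -
  have sq: "(indicator A x * c x)\<^sup>2 = indicator A x *\<^sub>R (c x)\<^sup>2" for c :: "real \<Rightarrow> real" and x
    by (auto simp: indicator_def)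
  have pr: "(indicator A x * a x) * (indicator A x * b x) = indicator A x *\<^sub>R (a x * b x)" for x
    by (auto simp: indicator_def)
  have ab: "\<bar>indicator A x *\<^sub>R (a x * b x)\<bar> = indicator A x *\<^sub>R \<bar>a x * b x\<bar>" for x
    by (auto simp: indicator_def)
  note CS = integral_cauchy_schwarz[of "\<lambda>x. indicator A x * a x" lborel "\<lambda>x. indicator A x * b x",
      unfolded sq pr ab, folded set_integrable_def set_lebesgue_integral_def]
  show "(LBINT x:A. \<bar>a x * b x\<bar>) \<le> sqrt (LBINT x:A. (a x)\<^sup>2) * sqrt (LBINT x:A. (b x)\<^sup>2)"
    by (rule CS(2)) (use ia ib in auto)
  show "set_integrable lborel A (\<lambda>x. a x * b x)"
    by (rule CS(1)) (use ia ib in auto)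
qed

lemma set_integral_le_integral:
  fixes h :: "real \<Rightarrow> real"
  assumes "integrable lborel h" "\<And>x. 0 \<le> h x" "A \<in> sets borel"
  shows "(LBINT x:A. h x) \<le> (\<integral>x. h x \<partial>lborel)"
  unfolding set_lebesgue_integral_def
  by (rule integral_mono) (use assms integrable_mult_indicator[of A lborel h] in \<open>auto simp: indicator_def\<close>)

lemma integrable_imp_set_integrable:
  "integrable lborel h \<Longrightarrow> A \<in> sets borel \<Longrightarrow> set_integrable lborel A (h :: real \<Rightarrow> real)"
  unfolding set_integrable_def using integrable_mult_indicator[of A lborel h] by simp

lemma abs_set_integral_le:
  fixes h :: "real \<Rightarrow> real"
  shows "\<bar>LBINT x:A. h x\<bar> \<le> (LBINT x:A. \<bar>h x\<bar>)"
  unfolding set_lebesgue_integral_def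
  by (rule order_trans[OF integral_abs_bound]) (simp add: abs_mult)

lemma square_times_phi_tendsto: "(\<lambda>n. (real n)\<^sup>2 * \<phi> (real n)) \<longlonglongrightarrow> 0"
proof (rule tendsto_sandwich[OF _ _ tendsto_const])
  have "((\<lambda>y::real. y ^ 1 / exp y) \<longlongrightarrow> 0) at_top" by (rule tendsto_power_div_exp_0)
  moreover have "filterlim (\<lambda>n. (1 / 2) * (real n)\<^sup>2) at_top sequentially"
    by (intro filterlim_tendsto_pos_mult_at_top[OF tendsto_const] filterlim_pow_at_top filterlim_real_sequentially) simp_all
  then have "filterlim (\<lambda>n. (real n)\<^sup>2 / 2) at_top sequentially" by simp
  ultimately have "(\<lambda>n. ((real n)\<^sup>2 / 2) ^ 1 / exp ((real n)\<^sup>2 / 2)) \<longlonglongrightarrow> 0"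
    by (rule filterlim_compose)
  then show "(\<lambda>n. ((real n)\<^sup>2 / 2) / exp ((real n)\<^sup>2 / 2)) \<longlonglongrightarrow> 0" by simp
  show "\<forall>\<^sub>F n in sequentially. (real n)\<^sup>2 * \<phi> (real n) \<le> ((real n)\<^sup>2 / 2) / exp ((real n)\<^sup>2 / 2)"
  proof (rule always_eventually, rule allI)
    fix n
    have "(real n)\<^sup>2 * \<phi> (real n) \<le> (real n)\<^sup>2 * (exp (- (real n)\<^sup>2 / 2) / 2)"
      by (intro mult_left_mono phi_bounds) simp
    then show "(real n)\<^sup>2 * \<phi> (real n) \<le> ((real n)\<^sup>2 / 2) / exp ((real n)\<^sup>2 / 2)"
      by (simp add: exp_minus field_simps)
  qed
qed simp

text \<open>The setting of the transport argument: a probability density \<open>p = v\<^sup>2\<close> on the line with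
  \<open>p' = v w\<close>, where \<open>v\<close> and \<open>w\<close> are square integrable, with mean zero and second moment at most \<open>M\<close>.
  Morally \<open>w = 2 v'\<close>; writing \<open>p'\<close> as a product keeps zeros of \<open>p\<close> from causing divisions, as
  \<open>w\<^sup>2\<close> plays the role of \<open>(p')\<^sup>2 / p\<close>.\<close>

locale finite_information =
  fixes v w :: "real \<Rightarrow> real" and M :: real
  assumes prim: "primitive_on UNIV (\<lambda>x. (v x)\<^sup>2) (\<lambda>x. v x * w x)"
    and v_borel [measurable]: "v \<in> borel_measurable borel"
    and w_borel [measurable]: "w \<in> borel_measurable borel"
    and v_sq_integrable: "integrable lborel (\<lambda>x. (v x)\<^sup>2)" and mass: "(\<integral>x. (v x)\<^sup>2 \<partial>lborel) = 1"
    and w_sq_integrable: "integrable lborel (\<lambda>x. (w x)\<^sup>2)"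
    and moment_integrable: "integrable lborel (\<lambda>x. x\<^sup>2 * (v x)\<^sup>2)" and moment: "(\<integral>x. x\<^sup>2 * (v x)\<^sup>2 \<partial>lborel) \<le> M"
    and mean: "(\<integral>x. x * (v x)\<^sup>2 \<partial>lborel) = 0"
begin

text \<open>\<open>F\<close> is the distribution function of \<open>p\<close>, and \<open>T\<close> is the monotone map transporting \<open>p dx\<close> to the Gaussian
  measure, so \<open>\<Phi> \<circ> T = F\<close>; outside the interval \<open>0 < F < 1\<close>, where \<open>p\<close> vanishes, it gets the
  default value \<open>0\<close>. \<open>X\<close> is a right inverse of \<open>T\<close>. Since \<open>v e = p' + x p = f' \<phi>\<close> for the relative density
  \<open>f = p / \<phi>\<close>, the integral of \<open>e\<^sup>2\<close> is the Gaussian Fisher information of \<open>f\<close>; that of \<open>ent\<close> is its relative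
  entropy.\<close>

definition "p x = (v x)\<^sup>2"
definition "F = distribution_function p"
definition "e x = w x + x * v x"
definition "T x = (if 0 < F x \<and> F x < 1 then inv \<Phi> (F x) else 0)"
definition "X t = (SOME x. F x = \<Phi> t)"
definition "ent x = p x * ln (p x / \<phi> x)"
definition "deficit = 1 / 2 * (\<integral>x. (e x)\<^sup>2 \<partial>lborel) - (\<integral>x. ent x \<partial>lborel)"
definition "K = sqrt (\<integral>x. (w x)\<^sup>2 \<partial>lborel)"

lemma prim_p: "primitive_on UNIV p (\<lambda>x. v x * w x)"
  using prim by (simp add: p_def[abs_def])

lemma p_nonneg [simp]: "0 \<le> p x" by (simp add: p_def)

lemma p_continuous: "continuous_on S p"
  using primitive_continuous[OF prim_p] continuous_on_subset by blast

lemma p_borel [measurable]: "p \<in> borel_measurable borel"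
  by (intro borel_measurable_continuous_onI p_continuous)

lemma p_integrable: "integrable lborel p" and p_mass: "(\<integral>x. p x \<partial>lborel) = 1"
  and x2p_integrable: "integrable lborel (\<lambda>x. x\<^sup>2 * p x)" and x2p_le: "(\<integral>x. x\<^sup>2 * p x \<partial>lborel) \<le> M"
  and xp_mean: "(\<integral>x. x * p x \<partial>lborel) = 0"
  using v_sq_integrable mass moment_integrable moment mean by (simp_all add: p_def[abs_def])

lemma xp_integrable: "integrable lborel (\<lambda>x. x * p x)"
proof -
  have "integrable lborel (\<lambda>x. v x * (x * v x))"
    by (rule integral_cauchy_schwarz) (use v_sq_integrable moment_integrable in \<open>auto simp: power_mult_distrib\<close>)
  then show ?thesis by (simp add: p_def power2_eq_square ac_simps)
qed

lemma e2_integrable: "integrable lborel (\<lambda>x. (e x)\<^sup>2)"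
proof -
  have "integrable lborel (\<lambda>x. w x * (x * v x))"
    by (rule integral_cauchy_schwarz) (use w_sq_integrable moment_integrable in \<open>auto simp: power_mult_distrib\<close>)
  then have "integrable lborel (\<lambda>x. (w x)\<^sup>2 + 2 * (w x * (x * v x)) + x\<^sup>2 * (v x)\<^sup>2)"
    using w_sq_integrable moment_integrable by simp
  then show ?thesis by (simp add: e_def power2_sum power_mult_distrib mult.assoc add.commute add.left_commute)
qed

lemma e_borel [measurable]: "e \<in> borel_measurable borel"
  unfolding e_def[abs_def] by measurable

lemma ve_integrable: "integrable lborel (\<lambda>x. v x * e x)"
  by (rule integral_cauchy_schwarz) (use v_sq_integrable e2_integrable in auto)

lemma F_DERIV: "(F has_field_derivative p x) (at x)"
  unfolding F_def by (rule distribution_function_DERIV[OF p_integrable p_continuous])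

lemma F_continuous: "continuous_on S F"
  by (intro continuous_at_imp_continuous_on ballI DERIV_isCont[OF F_DERIV])

lemma F_mono: "a \<le> b \<Longrightarrow> F a \<le> F b"
  by (rule DERIV_nonneg_imp_nondecreasing) (use F_DERIV p_nonneg in blast)+

lemma F_diff: "a \<le> b \<Longrightarrow> (LBINT x:{a..b}. p x) = F b - F a"
  unfolding F_def using distribution_function_diff[OF p_integrable] by simp

lemma F_complement: "1 - F x = (\<integral>s. indicator {x..} s * p s \<partial>lborel)"
  unfolding F_def using distribution_function_complement[OF p_integrable, of x] p_mass by simp

lemma F_ge_0: "0 \<le> F x" and F_le_1: "F x \<le> 1"
proof -
  show "0 \<le> F x" unfolding F_def distribution_function_def by (rule Bochner_Integration.integral_nonneg) simp
  have "0 \<le> (\<integral>s. indicator {x..} s * p s \<partial>lborel)" by (rule Bochner_Integration.integral_nonneg) simp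
  then show "F x \<le> 1" using F_complement[of x] by linarith
qed

text \<open>Cauchy-Schwarz for \<open>p' = v w\<close>.\<close>

lemma p_oscillation:
  assumes "a \<le> b"
  shows "\<bar>p b - p a\<bar> \<le> K * sqrt (F b - F a)"
proof -
  have sv: "set_integrable lborel {a..b} (\<lambda>x. (v x)\<^sup>2)" and sw: "set_integrable lborel {a..b} (\<lambda>x. (w x)\<^sup>2)"
    using v_sq_integrable w_sq_integrable by (auto intro: integrable_imp_set_integrable)
  have "\<bar>p b - p a\<bar> = \<bar>LBINT x:{a..b}. v x * w x\<bar>"
    using primitive_onD(2)[OF prim_p assms] by simp
  also have "\<dots> \<le> sqrt (LBINT x:{a..b}. (v x)\<^sup>2) * sqrt (LBINT x:{a..b}. (w x)\<^sup>2)"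
    by (rule order_trans[OF abs_set_integral_le set_integral_cauchy_schwarz(1)]) (use sv sw in auto)
  also have "\<dots> \<le> sqrt (F b - F a) * K"
    unfolding K_def F_diff[OF assms, symmetric] p_def
    by (intro mult_left_mono real_sqrt_le_mono set_integral_le_integral w_sq_integrable)
      (auto simp: set_lebesgue_integral_def intro!: Bochner_Integration.integral_nonneg)
  finally show ?thesis by (simp add: mult.commute)
qed

lemma K_nonneg: "0 \<le> K" by (simp add: K_def)

text \<open>If \<open>p(x)\<close> exceeded \<open>K sqrt(F(x))\<close> by some \<open>d > 0\<close>, the oscillation estimate would keep \<open>p\<close> above \<open>d\<close> on the
  whole half-line to the left of \<open>x\<close>, against its integrability. This bound and its mirror image provide
  all decay at infinity that integrations by parts require.\<close>

lemma p_le_left: "p x \<le> K * sqrt (F x)"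
proof (rule ccontr)
  assume "\<not> p x \<le> K * sqrt (F x)"
  then have d: "0 < p x - K * sqrt (F x)" (is "0 < ?d") by simp
  have low: "?d \<le> p y" if "y \<le> x" for y
  proof -
    have "\<bar>p x - p y\<bar> \<le> K * sqrt (F x - F y)" by (rule p_oscillation[OF that])
    also have "\<dots> \<le> K * sqrt (F x)" using F_ge_0[of y] K_nonneg by (intro mult_left_mono) auto
    finally show ?thesis by simp
  qed
  obtain n :: nat where n: "1 < real n * ?d" using reals_Archimedean3[OF d] by blast
  have "real n * ?d = (LBINT y:{x - real n..x}. ?d)" by (subst set_integral_const) auto
  also have "\<dots> \<le> (LBINT y:{x - real n..x}. p y)"
    by (intro set_integral_mono borel_integrable_atLeastAtMost' continuous_intros p_continuous low) simp
  also have "\<dots> \<le> 1" using F_diff[of "x - real n" x] F_ge_0[of "x - real n"] F_le_1[of x] by simp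
  finally show False using n by simp
qed

lemma p_le_right: "p x \<le> K * sqrt (1 - F x)"
proof (rule ccontr)
  assume "\<not> p x \<le> K * sqrt (1 - F x)"
  then have d: "0 < p x - K * sqrt (1 - F x)" (is "0 < ?d") by simp
  have low: "?d \<le> p y" if "x \<le> y" for y
  proof -
    have "\<bar>p y - p x\<bar> \<le> K * sqrt (F y - F x)" by (rule p_oscillation[OF that])
    also have "\<dots> \<le> K * sqrt (1 - F x)" using F_le_1[of y] K_nonneg by (intro mult_left_mono) auto
    finally show ?thesis by simp
  qed
  obtain n :: nat where n: "1 < real n * ?d" using reals_Archimedean3[OF d] by blast
  have "real n * ?d = (LBINT y:{x..x + real n}. ?d)" by (subst set_integral_const) auto
  also have "\<dots> \<le> (LBINT y:{x..x + real n}. p y)"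
    by (intro set_integral_mono borel_integrable_atLeastAtMost' continuous_intros p_continuous low) simp
  also have "\<dots> \<le> 1" using F_diff[of x "x + real n"] F_ge_0[of x] F_le_1[of "x + real n"] by simp
  finally show False using n by simp
qed

lemma p_le_K: "p x \<le> K"
proof -
  have "K * sqrt (F x) \<le> K * 1" using F_le_1[of x] K_nonneg by (intro mult_left_mono) auto
  with p_le_left[of x] show ?thesis by simp
qed

lemma p_pos_imp: assumes "p x \<noteq> 0" shows "0 < F x" "F x < 1"
proof -
  have "p x > 0" using assms p_nonneg[of x] by linarith
  then have "F x \<noteq> 0" "F x \<noteq> 1" using p_le_left[of x] p_le_right[of x] by auto
  then show "0 < F x" "F x < 1" using F_ge_0[of x] F_le_1[of x] by auto
qed

lemma F_X: "F (X t) = \<Phi> t"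
proof -
  obtain x where "F x = \<Phi> t"
    using distribution_function_attains[OF p_integrable p_continuous p_mass Phi_gt_0[of t] Phi_lt_1[of t]]
    unfolding F_def by blast
  then show ?thesis unfolding X_def by (rule someI)
qed

lemma X_less: "\<Phi> t < F x \<Longrightarrow> X t < x"
  using F_mono[of x "X t"] F_X[of t] by (cases "X t < x") auto

lemma X_greater: "F x < \<Phi> t \<Longrightarrow> x < X t"
  using F_mono[of "X t" x] F_X[of t] by (cases "x < X t") auto

lemma X_strict_mono: "s < t \<Longrightarrow> X s < X t"
  by (rule X_less) (simp add: F_X Phi_strict_mono)

lemma X_mono: "s \<le> t \<Longrightarrow> X s \<le> X t"
  using X_strict_mono[of s t] by (cases "s = t") auto

abbreviation "I \<equiv> {x. 0 < F x \<and> F x < 1}"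

lemma Phi_T: assumes "x \<in> I" shows "\<Phi> (T x) = F x"
proof -
  obtain t where t: "\<Phi> t = F x" by (rule Phi_attains[of "F x"]) (use assms in auto)
  then have "inv \<Phi> (F x) = t" using inv_f_f[OF inj_Phi, of t] by simp
  with t assms show ?thesis by (simp add: T_def)
qed

lemma between_X:
  assumes "x \<in> {X s..X t}"
  shows "x \<in> I" "s \<le> T x" "T x \<le> t"
proof -
  have *: "\<Phi> s \<le> F x" "F x \<le> \<Phi> t"
    using F_mono[of "X s" x] F_mono[of x "X t"] F_X assms by auto
  then show I: "x \<in> I" using Phi_gt_0[of s] Phi_lt_1[of t] by auto
  from * show "s \<le> T x" "T x \<le> t" unfolding Phi_T[OF I, symmetric] Phi_le_iff by auto
qed

lemma X_subset: "{X s..X t} \<subseteq> I"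
  using between_X(1)[of _ s t] by blast

lemma T_X: "T (X t) = t"
  using between_X(2,3)[of "X t" t t] by auto

lemma open_I: "open I"
proof -
  have "I = F -` {0<..<1}" by auto
  also have "open \<dots>" by (rule open_vimage[OF open_greaterThanLessThan F_continuous])
  finally show ?thesis .
qed

lemma T_DERIV:
  assumes "x \<in> I"
  shows "(T has_field_derivative p x / \<phi> (T x)) (at x)"
proof -
  have "((\<lambda>y. inv \<Phi> (F y)) has_field_derivative inverse (\<phi> (inv \<Phi> (F x))) * p x) (at x)"
    using assms by (intro DERIV_chain2[OF inv_Phi_DERIV F_DERIV]) auto
  moreover have "eventually (\<lambda>y. inv \<Phi> (F y) = T y) (nhds x)"
    using eventually_nhds_in_open[OF open_I assms] by eventually_elim (simp add: T_def)
  ultimately show ?thesis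
    using DERIV_cong_ev[of x x "\<lambda>y. inv \<Phi> (F y)" T] assms by (simp add: T_def field_simps)
qed

lemma T_continuous: "S \<subseteq> I \<Longrightarrow> continuous_on S T"
  by (intro continuous_at_imp_continuous_on ballI DERIV_isCont[OF T_DERIV]) auto

lemma T_borel [measurable]: "T \<in> borel_measurable borel"
proof -
  have "(\<lambda>x. indicator I x *\<^sub>R T x) \<in> borel_measurable borel"
    by (rule borel_measurable_continuous_on_indicator[OF _ T_continuous]) (use open_I in auto)
  also have "(\<lambda>x. indicator I x *\<^sub>R T x) = T" by (auto simp: T_def indicator_def)
  finally show ?thesis .
qed

definition "\<tau> x = p x / \<phi> (T x)"

lemma tau_continuous: "S \<subseteq> I \<Longrightarrow> continuous_on S \<tau>"
  unfolding \<tau>_def[abs_def]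
  by (intro continuous_intros p_continuous continuous_on_compose2[OF phi_continuous T_continuous])
    (use phi_pos in \<open>auto simp: less_imp_neq[symmetric]\<close>)

lemma prim_T: "primitive_on I T \<tau>"
  by (rule primitive_on_DERIV) (use T_DERIV tau_continuous in \<open>auto simp: \<tau>_def\<close>)

lemma prim_I: "primitive_on I p (\<lambda>x. v x * w x)"
  by (rule primitive_on_subset[OF prim_p]) simp

lemma prim_phi_T: "primitive_on I (\<lambda>x. \<phi> (T x)) (\<lambda>x. - (T x * p x))"
proof (rule primitive_on_DERIV)
  fix x assume x: "x \<in> I"
  show "((\<lambda>x. \<phi> (T x)) has_field_derivative - (T x * p x)) (at x)"
    using DERIV_chain2[OF phi_DERIV T_DERIV[OF x]] phi_pos[of "T x"] by simp
qed (intro continuous_intros T_continuous p_continuous order_refl)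

text \<open>The difference \<open>q\<close> measures how far \<open>T\<close> is from a translation, as \<open>T' - 1 = q / \<phi>(T)\<close>. Because
  \<open>(\<phi>(T))' = - T \<phi>(T) T' = - T p\<close>, its derivative is \<open>p' + T p = v (w + T v)\<close>, the very expression
  that the deficit controls.\<close>

definition "q x = p x - \<phi> (T x)"

lemma prim_q: "primitive_on I q (\<lambda>x. v x * (w x + T x * v x))"
  using primitive_on_diff[OF prim_I prim_phi_T]
  by (simp add: q_def[abs_def] p_def power2_eq_square algebra_simps)

text \<open>The boundary term produced by integrating \<open>p' (x - T)\<close> by parts.\<close>

definition "B x = p x * (x - T x)"

lemma prim_B: "primitive_on I B (\<lambda>x. p x * (1 - \<tau> x) + (x - T x) * (v x * w x))"
proof -
  have "primitive_on I (\<lambda>x. x) (\<lambda>x. 1)"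
    by (rule primitive_on_DERIV) (auto intro: derivative_eq_intros)
  from primitive_on_mult[OF prim_I primitive_on_diff[OF this prim_T]]
  show ?thesis by (simp add: B_def[abs_def])
qed

text \<open>The heart of the transport proof of the log-Sobolev inequality. With \<open>p = T' \<phi>(T)\<close> and \<open>\<tau> = T'\<close> one
  has \<open>ln (p / \<phi>) = ln \<tau> + (x\<^sup>2 - T\<^sup>2) / 2\<close>, and completing the square shows that the right-hand side exceeds
  the left-hand side by exactly \<open>p (\<tau> - 1 - ln \<tau>)\<close>. The bracket is the derivative of \<open>B\<close>.\<close>

lemma pointwise_transport_bound:
  "1 / 2 * (w x + T x * v x)\<^sup>2 \<le>
     1 / 2 * (e x)\<^sup>2 - ent x - (p x * (1 - \<tau> x) + (x - T x) * (v x * w x))"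
proof (cases "p x = 0")
  case True
  then have "v x = 0" by (simp add: p_def)
  then show ?thesis using True by (simp add: e_def ent_def)
next
  case False
  then have pp: "p x > 0" using p_nonneg[of x] by linarith
  have tp: "\<tau> x > 0" unfolding \<tau>_def using pp phi_pos by simp
  have "- (T x)\<^sup>2 / 2 - - x\<^sup>2 / 2 = (x\<^sup>2 - (T x)\<^sup>2) / 2" by (simp add: field_simps)
  then have "\<phi> (T x) / \<phi> x = exp ((x\<^sup>2 - (T x)\<^sup>2) / 2)"
    unfolding std_normal_density_def by (simp flip: exp_diff)
  moreover have "p x / \<phi> x = \<tau> x * (\<phi> (T x) / \<phi> x)"
    using phi_pos[of "T x"] unfolding \<tau>_def by simp
  ultimately have "p x / \<phi> x = \<tau> x * exp ((x\<^sup>2 - (T x)\<^sup>2) / 2)" by simp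
  then have "ln (p x / \<phi> x) = ln (\<tau> x) + (x\<^sup>2 - (T x)\<^sup>2) / 2"
    using tp by (simp add: ln_mult)
  also have "\<dots> \<le> \<tau> x - 1 + (x\<^sup>2 - (T x)\<^sup>2) / 2"
    using ln_le_minus_one[OF tp] by simp
  finally have "ent x \<le> p x * (\<tau> x - 1 + (x\<^sup>2 - (T x)\<^sup>2) / 2)"
    unfolding ent_def by (intro mult_left_mono) auto
  then show ?thesis
    by (simp add: e_def p_def power2_eq_square field_simps)
qed

text \<open>From above \<open>ln p \<le> p \<le> K\<close> leaves a multiple of \<open>p (1 + x\<^sup>2)\<close>; from below \<open>p ln (p / \<phi>) \<ge> p - \<phi>\<close>.\<close>

lemma ent_integrable: "integrable lborel ent"
proof (rule Bochner_Integration.integrable_bound)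
  show "integrable lborel (\<lambda>x. \<phi> x + (K + 3) * p x + x\<^sup>2 * p x)"
    using p_integrable x2p_integrable by simp
  show "ent \<in> borel_measurable lborel"
    unfolding ent_def[abs_def] by measurable
  show "AE x in lborel. norm (ent x) \<le> norm (\<phi> x + (K + 3) * p x + x\<^sup>2 * p x)"
  proof (rule AE_I2)
    fix x
    have nn: "0 \<le> \<phi> x" "0 \<le> (K + 3) * p x" "0 \<le> x\<^sup>2 * p x" using K_nonneg by auto
    have "\<bar>ent x\<bar> \<le> \<phi> x + (K + 3) * p x + x\<^sup>2 * p x"
    proof (cases "p x = 0")
      case False
      then have pp: "p x > 0" using p_nonneg[of x] by linarith
      have "ln (p x) \<le> K" using ln_le_minus_one[OF pp] p_le_K[of x] by simp
      moreover have "- ln (\<phi> x) = ln (sqrt (2 * pi)) + x\<^sup>2 / 2"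
        by (simp add: std_normal_density_def ln_mult ln_div)
      moreover have "ln (sqrt (2 * pi)) \<le> 3"
        using ln_le_minus_one[of "sqrt (2 * pi)"] sqrt_2pi_bounds by simp
      moreover have "ln (p x / \<phi> x) = ln (p x) - ln (\<phi> x)"
        using pp phi_pos[of x] by (simp add: ln_div)
      ultimately have "ln (p x / \<phi> x) \<le> (K + 3) + x\<^sup>2"
        using zero_le_power2[of x] by linarith
      then have 1: "ent x \<le> p x * ((K + 3) + x\<^sup>2)"
        unfolding ent_def by (intro mult_left_mono) auto
      have "ln (\<phi> x / p x) \<le> \<phi> x / p x - 1"
        using pp phi_pos[of x] by (intro ln_le_minus_one) simp
      then have "p x * ln (\<phi> x / p x) \<le> p x * (\<phi> x / p x - 1)"
        by (intro mult_left_mono) auto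
      also have "\<dots> = \<phi> x - p x" using pp by (simp add: field_simps)
      finally have "- ent x \<le> \<phi> x - p x"
        unfolding ent_def using pp phi_pos[of x] by (simp add: ln_div algebra_simps)
      moreover have "ent x \<le> (K + 3) * p x + x\<^sup>2 * p x" using 1 by (simp add: algebra_simps)
      ultimately show ?thesis using nn pp by linarith
    qed (use nn in \<open>simp add: ent_def\<close>)
    with nn show "norm (ent x) \<le> norm (\<phi> x + (K + 3) * p x + x\<^sup>2 * p x)" by simp
  qed
qed

lemma eventually_inside:
  assumes "x \<in> I"
  shows "\<forall>\<^sub>F n in sequentially. X (- real n) < x \<and> x < X (real n)"
proof -
  have "\<forall>\<^sub>F n in sequentially. F x < \<Phi> (real n)"
    using order_tendstoD(1)[OF Phi_at_top(1)] assms by blast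
  moreover have "\<forall>\<^sub>F n in sequentially. \<Phi> (- real n) < F x"
    using order_tendstoD(2)[OF Phi_at_top(2)] assms by blast
  ultimately show ?thesis by eventually_elim (simp add: X_less X_greater)
qed

lemma exhaustion_pointwise:
  assumes "p x \<noteq> 0"
  shows "\<forall>\<^sub>F n in sequentially. X (- real n) < x \<and> x < X (real n)"
  using eventually_inside p_pos_imp[OF assms] by simp

text \<open>The intervals \<open>[X(-n), X(n)]\<close> exhaust the set where \<open>p\<close> is positive, though not necessarily the line.\<close>

lemma exhaustion:
  assumes h: "integrable lborel h" and z: "\<And>x. p x = 0 \<Longrightarrow> h x = (0::real)"
  shows "(\<lambda>n. LBINT x:{X (- real n)..X (real n)}. h x) \<longlonglongrightarrow> (\<integral>x. h x \<partial>lborel)"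
  unfolding set_lebesgue_integral_def
proof (rule integral_dominated_convergence[where w = "\<lambda>x. norm (h x)"])
  show "AE x in lborel. (\<lambda>n. indicat_real {X (- real n)..X (real n)} x *\<^sub>R h x) \<longlonglongrightarrow> h x"
  proof (rule AE_I2)
    fix x
    show "(\<lambda>n. indicat_real {X (- real n)..X (real n)} x *\<^sub>R h x) \<longlonglongrightarrow> h x"
    proof (cases "p x = 0")
      case False
      have "\<forall>\<^sub>F n in sequentially. indicat_real {X (- real n)..X (real n)} x *\<^sub>R h x = h x"
        using exhaustion_pointwise[OF False] by eventually_elim auto
      then show ?thesis by (rule tendsto_eventually)
    qed (simp add: z)
  qed
qed (use h borel_measurable_integrable[OF h] in \<open>auto simp: indicator_def\<close>)

lemma tail_vanishes:
  assumes h: "integrable lborel h" and z: "\<And>x. p x = 0 \<Longrightarrow> h x = (0::real)"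
  shows "(\<lambda>n. \<integral>x. indicator {X (real n)..} x * h x \<partial>lborel) \<longlonglongrightarrow> 0"
    and "(\<lambda>n. \<integral>x. indicator {..X (- real n)} x * h x \<partial>lborel) \<longlonglongrightarrow> 0"
proof -
  have "(\<lambda>n. \<integral>x. indicator {X (real n)..} x * h x \<partial>lborel) \<longlonglongrightarrow> (\<integral>x. 0 \<partial>(lborel :: real measure))"
  proof (rule integral_dominated_convergence[where w = "\<lambda>x. norm (h x)"])
    show "AE x in lborel. (\<lambda>n. indicator {X (real n)..} x * h x) \<longlonglongrightarrow> 0"
    proof (rule AE_I2)
      fix x
      show "(\<lambda>n. indicator {X (real n)..} x * h x) \<longlonglongrightarrow> 0"
      proof (cases "p x = 0")
        case False
        have "\<forall>\<^sub>F n in sequentially. indicator {X (real n)..} x * h x = 0"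
          using exhaustion_pointwise[OF False] by eventually_elim auto
        then show ?thesis by (rule tendsto_eventually)
      qed (simp add: z)
    qed
  qed (use h borel_measurable_integrable[OF h] in \<open>auto simp: indicator_def\<close>)
  then show "(\<lambda>n. \<integral>x. indicator {X (real n)..} x * h x \<partial>lborel) \<longlonglongrightarrow> 0" by simp
  have "(\<lambda>n. \<integral>x. indicator {..X (- real n)} x * h x \<partial>lborel) \<longlonglongrightarrow> (\<integral>x. 0 \<partial>(lborel :: real measure))"
  proof (rule integral_dominated_convergence[where w = "\<lambda>x. norm (h x)"])
    show "AE x in lborel. (\<lambda>n. indicator {..X (- real n)} x * h x) \<longlonglongrightarrow> 0"
    proof (rule AE_I2)
      fix x
      show "(\<lambda>n. indicator {..X (- real n)} x * h x) \<longlonglongrightarrow> 0"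
      proof (cases "p x = 0")
        case False
        have "\<forall>\<^sub>F n in sequentially. indicator {..X (- real n)} x * h x = 0"
          using exhaustion_pointwise[OF False] by eventually_elim auto
        then show ?thesis by (rule tendsto_eventually)
      qed (simp add: z)
    qed
  qed (use h borel_measurable_integrable[OF h] in \<open>auto simp: indicator_def\<close>)
  then show "(\<lambda>n. \<integral>x. indicator {..X (- real n)} x * h x \<partial>lborel) \<longlonglongrightarrow> 0" by simp
qed

lemma F_left: "F z = (\<integral>s. indicator {..z} s * p s \<partial>lborel)"
  by (simp add: F_def distribution_function_def)

lemma ind_p_integrable:
  assumes [measurable]: "A \<in> sets borel"
  shows "integrable lborel (\<lambda>s. indicator A s * p s)" "integrable lborel (\<lambda>s. indicator A s * (s\<^sup>2 * p s))"
  using p_integrable x2p_integrable by (auto intro!: integrable_indicator_mult)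

text \<open>Chebyshev's inequality in the form \<open>z\<^sup>2 1(x \<ge> z) \<le> x\<^sup>2 1(x \<ge> z)\<close>, which holds for \<open>z \<ge> 0\<close>. A
  negative \<open>z\<close> lies between \<open>X 0\<close> and \<open>0\<close>, and then \<open>z\<^sup>2\<close> is bounded by \<open>(X 0)\<^sup>2\<close>.\<close>

lemma endpoint_moment_right:
  assumes "X 0 \<le> z"
  shows "z\<^sup>2 * (1 - F z) \<le> (X 0)\<^sup>2 * (1 - F z) + (\<integral>x. indicator {z..} x * (x\<^sup>2 * p x) \<partial>lborel)"
proof -
  have "(\<integral>s. z\<^sup>2 * (indicator {z..} s * p s) \<partial>lborel)
      \<le> (\<integral>s. (X 0)\<^sup>2 * (indicator {z..} s * p s) + indicator {z..} s * (s\<^sup>2 * p s) \<partial>lborel)"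
  proof (rule integral_mono)
    fix s
    show "z\<^sup>2 * (indicator {z..} s * p s) \<le> (X 0)\<^sup>2 * (indicator {z..} s * p s) + indicator {z..} s * (s\<^sup>2 * p s)"
    proof (cases "z \<le> s")
      case True
      have "z\<^sup>2 \<le> (X 0)\<^sup>2 + s\<^sup>2"
      proof (cases "0 \<le> z")
        case False
        then have "z\<^sup>2 \<le> (X 0)\<^sup>2" using assms by (simp add: abs_le_square_iff[symmetric])
        then show ?thesis by (simp add: add_increasing2)
      qed (use True in \<open>simp add: add_increasing power_mono\<close>)
      then have "z\<^sup>2 * p s \<le> ((X 0)\<^sup>2 + s\<^sup>2) * p s" by (intro mult_right_mono) auto
      then show ?thesis using True by (simp add: distrib_right)
    qed simp
  qed (use ind_p_integrable[of "{z..}"] in auto)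
  then show ?thesis
    using ind_p_integrable[of "{z..}"] by (simp add: F_complement)
qed

lemma endpoint_moment_left:
  assumes "z \<le> X 0"
  shows "z\<^sup>2 * F z \<le> (X 0)\<^sup>2 * F z + (\<integral>x. indicator {..z} x * (x\<^sup>2 * p x) \<partial>lborel)"
proof -
  have "(\<integral>s. z\<^sup>2 * (indicator {..z} s * p s) \<partial>lborel)
      \<le> (\<integral>s. (X 0)\<^sup>2 * (indicator {..z} s * p s) + indicator {..z} s * (s\<^sup>2 * p s) \<partial>lborel)"
  proof (rule integral_mono)
    fix s
    show "z\<^sup>2 * (indicator {..z} s * p s) \<le> (X 0)\<^sup>2 * (indicator {..z} s * p s) + indicator {..z} s * (s\<^sup>2 * p s)"
    proof (cases "s \<le> z")
      case True
      have "z\<^sup>2 \<le> (X 0)\<^sup>2 + s\<^sup>2"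
      proof (cases "z \<le> 0")
        case False
        then have "z\<^sup>2 \<le> (X 0)\<^sup>2" using assms by (simp add: power_mono)
        then show ?thesis by (simp add: add_increasing2)
      next
        case True
        then have "z\<^sup>2 \<le> s\<^sup>2" using \<open>s \<le> z\<close> by (simp add: abs_le_square_iff[symmetric])
        then show ?thesis by (simp add: add_increasing)
      qed
      then have "z\<^sup>2 * p s \<le> ((X 0)\<^sup>2 + s\<^sup>2) * p s" by (intro mult_right_mono) auto
      then show ?thesis using True by (simp add: distrib_right)
    qed simp
  qed (use ind_p_integrable[of "{..z}"] in auto)
  then show ?thesis
    using ind_p_integrable[of "{..z}"] by (simp add: F_left)
qed

lemma p_X_tendsto: "(\<lambda>n. p (X (real n))) \<longlonglongrightarrow> 0" "(\<lambda>n. p (X (- real n))) \<longlonglongrightarrow> 0"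
proof -
  show "(\<lambda>n. p (X (real n))) \<longlonglongrightarrow> 0"
  proof (rule tendsto_sandwich[OF _ _ tendsto_const])
    have "(\<lambda>n. K * sqrt (1 - \<Phi> (real n))) \<longlonglongrightarrow> K * sqrt (1 - 1)"
      by (intro tendsto_intros Phi_at_top)
    then show "(\<lambda>n. K * sqrt (1 - \<Phi> (real n))) \<longlonglongrightarrow> 0" by simp
    show "\<forall>\<^sub>F n in sequentially. p (X (real n)) \<le> K * sqrt (1 - \<Phi> (real n))"
      using p_le_right[of "X (real n)" for n] by (simp add: F_X)
  qed simp
  show "(\<lambda>n. p (X (- real n))) \<longlonglongrightarrow> 0"
  proof (rule tendsto_sandwich[OF _ _ tendsto_const])
    have "(\<lambda>n. K * sqrt (\<Phi> (- real n))) \<longlonglongrightarrow> K * sqrt 0"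
      by (intro tendsto_intros Phi_at_top)
    then show "(\<lambda>n. K * sqrt (\<Phi> (- real n))) \<longlonglongrightarrow> 0" by simp
    show "\<forall>\<^sub>F n in sequentially. p (X (- real n)) \<le> K * sqrt (\<Phi> (- real n))"
      using p_le_left[of "X (- real n)" for n] by (simp add: F_X)
  qed simp
qed

text \<open>At \<open>z = X n\<close> one has \<open>p(z) \<le> K sqrt(1 - F(z))\<close>. Multiplied by \<open>|z|\<close> this tends to zero by the second
  moment of \<open>p\<close>, multiplied by \<open>T(z) = n\<close> by the Gaussian tail.\<close>

lemma B_tendsto_right: "(\<lambda>n. B (X (real n))) \<longlonglongrightarrow> 0"
proof (rule Lim_null_comparison)
  define r where "r n = (\<integral>x. indicator {X (real n)..} x * (x\<^sup>2 * p x) \<partial>lborel)" for n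
  have r: "r \<longlonglongrightarrow> 0" unfolding r_def[abs_def] by (rule tail_vanishes(1)[OF x2p_integrable]) simp
  have "(\<lambda>n. K * sqrt ((X 0)\<^sup>2 * (1 - \<Phi> (real n)) + r n) + K * sqrt (3 * ((real n)\<^sup>2 * \<phi> (real n))))
      \<longlonglongrightarrow> K * sqrt ((X 0)\<^sup>2 * (1 - 1) + 0) + K * sqrt (3 * 0)"
    by (intro tendsto_intros Phi_at_top r square_times_phi_tendsto)
  then show "(\<lambda>n. K * sqrt ((X 0)\<^sup>2 * (1 - \<Phi> (real n)) + r n) + K * sqrt (3 * ((real n)\<^sup>2 * \<phi> (real n)))) \<longlonglongrightarrow> 0"
    by simp
  show "\<forall>\<^sub>F n in sequentially. norm (B (X (real n))) \<le>
      K * sqrt ((X 0)\<^sup>2 * (1 - \<Phi> (real n)) + r n) + K * sqrt (3 * ((real n)\<^sup>2 * \<phi> (real n)))"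
  proof (rule always_eventually, rule allI)
    fix n
    let ?z = "X (real n)"
    have pz: "p ?z \<le> K * sqrt (1 - \<Phi> (real n))" using p_le_right[of ?z] by (simp add: F_X)
    have sc: "p ?z * \<bar>c\<bar> \<le> K * sqrt (c\<^sup>2 * (1 - \<Phi> (real n)))" for c
      using mult_right_mono[OF pz, of "\<bar>c\<bar>"] by (simp add: real_sqrt_mult ac_simps)
    have "X 0 \<le> ?z" by (rule X_mono) simp
    from endpoint_moment_right[OF this] have "?z\<^sup>2 * (1 - \<Phi> (real n)) \<le> (X 0)\<^sup>2 * (1 - \<Phi> (real n)) + r n"
      by (simp add: F_X r_def)
    then have "p ?z * \<bar>?z\<bar> \<le> K * sqrt ((X 0)\<^sup>2 * (1 - \<Phi> (real n)) + r n)"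
      by (intro order_trans[OF sc] mult_left_mono K_nonneg real_sqrt_le_mono)
    moreover have "(real n)\<^sup>2 * (1 - \<Phi> (real n)) \<le> 3 * ((real n)\<^sup>2 * \<phi> (real n))"
      using mult_left_mono[OF Phi_tails(1)[of "real n"], of "(real n)\<^sup>2"] by simp
    then have "p ?z * \<bar>real n\<bar> \<le> K * sqrt (3 * ((real n)\<^sup>2 * \<phi> (real n)))"
      by (intro order_trans[OF sc] mult_left_mono K_nonneg real_sqrt_le_mono)
    moreover have "norm (B ?z) \<le> p ?z * \<bar>?z\<bar> + p ?z * \<bar>real n\<bar>"
      unfolding B_def T_X distrib_left[symmetric] by (simp add: abs_mult del: abs_of_nat) (intro mult_left_mono; simp)
    ultimately show "norm (B ?z) \<le> K * sqrt ((X 0)\<^sup>2 * (1 - \<Phi> (real n)) + r n) + K * sqrt (3 * ((real n)\<^sup>2 * \<phi> (real n)))"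
      by linarith
  qed
qed

lemma B_tendsto_left: "(\<lambda>n. B (X (- real n))) \<longlonglongrightarrow> 0"
proof (rule Lim_null_comparison)
  define r where "r n = (\<integral>x. indicator {..X (- real n)} x * (x\<^sup>2 * p x) \<partial>lborel)" for n
  have r: "r \<longlonglongrightarrow> 0" unfolding r_def[abs_def] by (rule tail_vanishes(2)[OF x2p_integrable]) simp
  have "(\<lambda>n. K * sqrt ((X 0)\<^sup>2 * \<Phi> (- real n) + r n) + K * sqrt (3 * ((real n)\<^sup>2 * \<phi> (real n))))
      \<longlonglongrightarrow> K * sqrt ((X 0)\<^sup>2 * 0 + 0) + K * sqrt (3 * 0)"
    by (intro tendsto_intros Phi_at_top r square_times_phi_tendsto)
  then show "(\<lambda>n. K * sqrt ((X 0)\<^sup>2 * \<Phi> (- real n) + r n) + K * sqrt (3 * ((real n)\<^sup>2 * \<phi> (real n)))) \<longlonglongrightarrow> 0"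
    by simp
  show "\<forall>\<^sub>F n in sequentially. norm (B (X (- real n))) \<le>
      K * sqrt ((X 0)\<^sup>2 * \<Phi> (- real n) + r n) + K * sqrt (3 * ((real n)\<^sup>2 * \<phi> (real n)))"
  proof (rule always_eventually, rule allI)
    fix n
    let ?z = "X (- real n)"
    have pz: "p ?z \<le> K * sqrt (\<Phi> (- real n))" using p_le_left[of ?z] by (simp add: F_X)
    have sc: "p ?z * \<bar>c\<bar> \<le> K * sqrt (c\<^sup>2 * \<Phi> (- real n))" for c
      using mult_right_mono[OF pz, of "\<bar>c\<bar>"] by (simp add: real_sqrt_mult ac_simps)
    have "?z \<le> X 0" by (rule X_mono) simp
    from endpoint_moment_left[OF this] have "?z\<^sup>2 * \<Phi> (- real n) \<le> (X 0)\<^sup>2 * \<Phi> (- real n) + r n"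
      by (simp add: F_X r_def)
    then have "p ?z * \<bar>?z\<bar> \<le> K * sqrt ((X 0)\<^sup>2 * \<Phi> (- real n) + r n)"
      by (intro order_trans[OF sc] mult_left_mono K_nonneg real_sqrt_le_mono)
    moreover have "(real n)\<^sup>2 * \<Phi> (- real n) \<le> 3 * ((real n)\<^sup>2 * \<phi> (real n))"
      using mult_left_mono[OF Phi_tails(2)[of "- real n"], of "(real n)\<^sup>2"] by (simp add: phi_uminus)
    then have "p ?z * \<bar>real n\<bar> \<le> K * sqrt (3 * ((real n)\<^sup>2 * \<phi> (real n)))"
      by (intro order_trans[OF sc] mult_left_mono K_nonneg real_sqrt_le_mono)
    moreover have "norm (B ?z) \<le> p ?z * \<bar>?z\<bar> + p ?z * \<bar>real n\<bar>"
      unfolding B_def T_X distrib_left[symmetric] by (simp add: abs_mult del: abs_of_nat) (intro mult_left_mono; simp)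
    ultimately show "norm (B ?z) \<le> K * sqrt ((X 0)\<^sup>2 * \<Phi> (- real n) + r n) + K * sqrt (3 * ((real n)\<^sup>2 * \<phi> (real n)))"
      by linarith
  qed
qed

lemma wTv2_integrable: "set_integrable lborel {X s..X t} (\<lambda>x. (w x + T x * v x)\<^sup>2)"
proof -
  have Tc: "continuous_on {X s..X t} T" by (rule T_continuous[OF X_subset])
  have "set_integrable lborel {X s..X t} (\<lambda>x. w x * v x)"
    by (rule set_integral_cauchy_schwarz(2)) (use w_sq_integrable v_sq_integrable in \<open>auto intro: integrable_imp_set_integrable\<close>)
  then have "set_integrable lborel {X s..X t} (\<lambda>x. T x * (w x * v x))"
    by (rule set_integrable_continuous_mult[OF Tc])
  moreover have "set_integrable lborel {X s..X t} (\<lambda>x. (T x)\<^sup>2 * (v x)\<^sup>2)"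
    using v_sq_integrable by (intro set_integrable_continuous_mult continuous_intros Tc integrable_imp_set_integrable) auto
  moreover have "set_integrable lborel {X s..X t} (\<lambda>x. (w x)\<^sup>2)"
    using w_sq_integrable by (rule integrable_imp_set_integrable) auto
  ultimately have "set_integrable lborel {X s..X t} (\<lambda>x. (w x)\<^sup>2 + (2 * (T x * (w x * v x)) + (T x)\<^sup>2 * (v x)\<^sup>2))"
    by (intro set_integral_add(1) set_integrable_mult_right) auto
  then show ?thesis by (simp add: power2_sum power_mult_distrib algebra_simps)
qed

lemma transport_bound:
  assumes "s \<le> t"
  shows "1 / 2 * (LBINT x:{X s..X t}. (w x + T x * v x)\<^sup>2)
    \<le> 1 / 2 * (\<integral>x. (e x)\<^sup>2 \<partial>lborel) - (LBINT x:{X s..X t}. ent x) - (B (X t) - B (X s))"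
proof -
  let ?A = "{X s..X t}"
  let ?b = "\<lambda>x. p x * (1 - \<tau> x) + (x - T x) * (v x * w x)"
  have st: "X s \<le> X t" by (rule X_mono[OF assms])
  note b = primitive_onD[OF prim_B st X_subset]
  have ei: "set_integrable lborel ?A (\<lambda>x. 1 / 2 * (e x)\<^sup>2)"
    using e2_integrable by (intro set_integrable_mult_right integrable_imp_set_integrable) auto
  have ni: "set_integrable lborel ?A ent"
    using ent_integrable by (intro integrable_imp_set_integrable) auto
  have "1 / 2 * (LBINT x:?A. (w x + T x * v x)\<^sup>2) = (LBINT x:?A. 1 / 2 * (w x + T x * v x)\<^sup>2)"
    by simp
  also have "\<dots> \<le> (LBINT x:?A. 1 / 2 * (e x)\<^sup>2 - ent x - ?b x)"
    by (intro set_integral_mono set_integral_diff(1) ei ni b(1) pointwise_transport_bound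
        set_integrable_mult_right wTv2_integrable)
  also have "\<dots> = (LBINT x:?A. 1 / 2 * (e x)\<^sup>2) - (LBINT x:?A. ent x) - (B (X t) - B (X s))"
    using ei ni b by (simp only: set_integral_diff)
  also have "(LBINT x:?A. 1 / 2 * (e x)\<^sup>2) \<le> 1 / 2 * (\<integral>x. (e x)\<^sup>2 \<partial>lborel)"
    using set_integral_le_integral[OF e2_integrable, of ?A] by simp
  finally show ?thesis by simp
qed

text \<open>The log-Sobolev inequality with a remainder: the terms at the endpoints \<open>X(-n)\<close> and \<open>X(n)\<close> vanish in the
  limit, and what is left on the right is the deficit.\<close>

lemma transport_deficit:
  assumes "s \<le> t"
  shows "(LBINT x:{X s..X t}. (w x + T x * v x)\<^sup>2) \<le> 2 * deficit"
proof -
  have "(\<lambda>n. 1 / 2 * (\<integral>x. (e x)\<^sup>2 \<partial>lborel) - (LBINT x:{X (- real n)..X (real n)}. ent x)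
        - (B (X (real n)) - B (X (- real n))))
      \<longlonglongrightarrow> 1 / 2 * (\<integral>x. (e x)\<^sup>2 \<partial>lborel) - (\<integral>x. ent x \<partial>lborel) - (0 - 0)"
    by (intro tendsto_diff tendsto_const exhaustion ent_integrable B_tendsto_left B_tendsto_right)
      (simp add: ent_def)
  note lim = this
  obtain N :: nat where N: "\<bar>s\<bar> + \<bar>t\<bar> \<le> real N" using real_arch_simple by blast
  have "1 / 2 * (LBINT x:{X s..X t}. (w x + T x * v x)\<^sup>2) \<le>
      1 / 2 * (\<integral>x. (e x)\<^sup>2 \<partial>lborel) - (LBINT x:{X (- real n)..X (real n)}. ent x)
        - (B (X (real n)) - B (X (- real n)))" if "n \<ge> N" for n
  proof -
    have "X (- real n) \<le> X s" "X t \<le> X (real n)" using N that by (auto intro!: X_mono)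
    then have sub: "{X s..X t} \<subseteq> {X (- real n)..X (real n)}" by auto
    have "(LBINT x:{X s..X t}. (w x + T x * v x)\<^sup>2) \<le> (LBINT x:{X (- real n)..X (real n)}. (w x + T x * v x)\<^sup>2)"
      unfolding set_lebesgue_integral_def
      by (rule integral_mono)
        (use wTv2_integrable sub in \<open>auto simp: set_integrable_def indicator_def\<close>)
    with transport_bound[of "- real n" "real n"] show ?thesis by simp
  qed
  then have "1 / 2 * (LBINT x:{X s..X t}. (w x + T x * v x)\<^sup>2) \<le> 1 / 2 * (\<integral>x. (e x)\<^sup>2 \<partial>lborel) - (\<integral>x. ent x \<partial>lborel) - (0 - 0)"
    by (intro tendsto_lowerbound[OF lim] eventually_sequentiallyI[of N]) simp_all
  then show ?thesis by (simp add: deficit_def)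
qed

end

section \<open>From small deficit to small transport cost\<close>

text \<open>A smooth odd function bounded by \<open>exp(t\<^sup>2/4)\<close> whose derivative dominates a multiple of \<open>exp(t\<^sup>2/4)\<close>. It
  integrates errors of size \<open>exp(T\<^sup>2/4) T'\<close> without loss: the obvious candidate \<open>t exp(t\<^sup>2/4)\<close> would lose a
  logarithm of the deficit.\<close>

definition envelope :: "real \<Rightarrow> real" where "envelope t = t * exp (t\<^sup>2 / 4) / (1 + t\<^sup>2)"
definition envelope' :: "real \<Rightarrow> real" where
  "envelope' t = exp (t\<^sup>2 / 4) * ((1 - t\<^sup>2) / (1 + t\<^sup>2)\<^sup>2 + t\<^sup>2 / (2 * (1 + t\<^sup>2)))"

lemma envelope_DERIV: "(envelope has_field_derivative envelope' t) (at t)"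
proof -
  have nz: "1 + t\<^sup>2 \<noteq> 0" by (metis add_pos_nonneg less_numeral_extra(3) zero_le_power2 zero_less_one)
  have "(envelope has_field_derivative
      ((1 * exp (t\<^sup>2 / 4) + (exp (t\<^sup>2 / 4) * (2 * t / 4)) * t) * (1 + t\<^sup>2) - t * exp (t\<^sup>2 / 4) * (2 * t)) / ((1 + t\<^sup>2) * (1 + t\<^sup>2))) (at t)"
    unfolding envelope_def[abs_def]
    by (rule derivative_eq_intros refl nz | simp)+
  also have "((1 * exp (t\<^sup>2 / 4) + (exp (t\<^sup>2 / 4) * (2 * t / 4)) * t) * (1 + t\<^sup>2) - t * exp (t\<^sup>2 / 4) * (2 * t)) / ((1 + t\<^sup>2) * (1 + t\<^sup>2)) = envelope' t"
  proof -
    define E where "E = exp (t\<^sup>2 / 4)"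
    define y where "y = t\<^sup>2"
    have y: "1 + y \<noteq> 0" using nz by (simp add: y_def)
    have tt: "t * t = y" by (simp add: y_def power2_eq_square)
    have "(1 * E + (E * (2 * t / 4)) * t) * (1 + y) - t * E * (2 * t) = E * ((1 - y) + y * (1 + y) / 2)"
      unfolding tt[symmetric] by (simp add: field_simps)
    then have "((1 * E + (E * (2 * t / 4)) * t) * (1 + y) - t * E * (2 * t)) / ((1 + y) * (1 + y))
        = E * ((1 - y) + y * (1 + y) / 2) / ((1 + y) * (1 + y))"
      by (simp only:)
    also have "\<dots> = E * ((1 - y) / (1 + y)\<^sup>2 + y / (2 * (1 + y)))"
      using y by (simp add: power2_eq_square divide_simps) (simp add: algebra_simps)
    finally have "((1 * E + (E * (2 * t / 4)) * t) * (1 + y) - t * E * (2 * t)) / ((1 + y) * (1 + y))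
        = E * ((1 - y) / (1 + y)\<^sup>2 + y / (2 * (1 + y)))" .
    then show ?thesis unfolding envelope'_def E_def y_def .
  qed
  finally show ?thesis .
qed

text \<open>With \<open>y = t\<^sup>2\<close> this reduces to positivity of the quadratic \<open>3 y\<^sup>2 - 9 y + 8\<close>.\<close>

lemma envelope'_lower: "exp (t\<^sup>2 / 4) \<le> 5 * envelope' t"
proof -
  define y where "y = t\<^sup>2"
  have y: "0 \<le> y" by (simp add: y_def)
  have "0 \<le> 3 * (y - 3 / 2)\<^sup>2 + 5 / 4" by simp
  then have "2 * (1 + y)\<^sup>2 \<le> 10 * (1 - y) + 5 * y * (1 + y)"
    by (simp add: power2_eq_square algebra_simps)
  then have "1 \<le> (10 * (1 - y) + 5 * y * (1 + y)) / (2 * (1 + y)\<^sup>2)"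
    using y by (simp add: field_simps)
  also have "\<dots> = 5 * ((1 - y) / (1 + y)\<^sup>2 + y / (2 * (1 + y)))"
    using y by (simp add: power2_eq_square divide_simps) (simp add: algebra_simps)
  finally have "exp (t\<^sup>2 / 4) * 1 \<le> exp (t\<^sup>2 / 4) * (5 * ((1 - y) / (1 + y)\<^sup>2 + y / (2 * (1 + y))))"
    by (intro mult_left_mono) auto
  then show ?thesis by (simp add: envelope'_def y_def)
qed

lemma envelope_bound: "\<bar>envelope t\<bar> \<le> exp (t\<^sup>2 / 4) / 2"
proof -
  have "2 * \<bar>t\<bar> \<le> 1 + t\<^sup>2" using sum_squares_bound[of 1 "\<bar>t\<bar>"] by simp
  then have "exp (t\<^sup>2 / 4) * (2 * \<bar>t\<bar>) \<le> exp (t\<^sup>2 / 4) * (1 + t\<^sup>2)" by (intro mult_left_mono) auto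
  moreover have "0 < 1 + t\<^sup>2" by (simp add: add_pos_nonneg)
  ultimately show ?thesis
    unfolding envelope_def abs_divide abs_mult by (simp add: field_simps)
qed

context finite_information
begin

lemma M_nonneg: "0 \<le> M"
proof -
  have "0 \<le> (\<integral>x. x\<^sup>2 * p x \<partial>lborel)" by (rule Bochner_Integration.integral_nonneg) simp
  with x2p_le show ?thesis by linarith
qed

lemma deficit_nonneg: "0 \<le> deficit"
proof -
  have "0 \<le> (LBINT x:{X 0..X 0}. (w x + T x * v x)\<^sup>2)"
    by (auto simp: set_lebesgue_integral_def intro!: Bochner_Integration.integral_nonneg)
  with transport_deficit[of 0 0] show ?thesis by simp
qed

lemma vwT_L1:
  assumes "s \<le> t" "a \<le> b" "{a..b} \<subseteq> {X s..X t}"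
  shows "(LBINT x:{a..b}. \<bar>v x * (w x + T x * v x)\<bar>) \<le> sqrt (F b - F a) * sqrt (2 * deficit)"
    and "set_integrable lborel {a..b} (\<lambda>x. v x * (w x + T x * v x))"
proof -
  let ?g = "\<lambda>x. w x + T x * v x"
  have i1: "set_integrable lborel {a..b} (\<lambda>x. (v x)\<^sup>2)" using v_sq_integrable by (rule integrable_imp_set_integrable) auto
  have i2: "set_integrable lborel {a..b} (\<lambda>x. (?g x)\<^sup>2)"
    by (rule set_integrable_subset[OF wTv2_integrable _ assms(3)]) auto
  show "set_integrable lborel {a..b} (\<lambda>x. v x * ?g x)"
    by (rule set_integral_cauchy_schwarz(2)) (use i1 i2 in auto)
  have "(LBINT x:{a..b}. (?g x)\<^sup>2) \<le> (LBINT x:{X s..X t}. (?g x)\<^sup>2)"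
    unfolding set_lebesgue_integral_def
    by (rule integral_mono)
      (use wTv2_integrable[of s t] i2 assms(3) in \<open>auto simp: set_integrable_def indicator_def\<close>)
  also have "\<dots> \<le> 2 * deficit" by (rule transport_deficit[OF assms(1)])
  finally have g: "(LBINT x:{a..b}. (?g x)\<^sup>2) \<le> 2 * deficit" .
  have "(LBINT x:{a..b}. \<bar>v x * ?g x\<bar>) \<le> sqrt (LBINT x:{a..b}. (v x)\<^sup>2) * sqrt (LBINT x:{a..b}. (?g x)\<^sup>2)"
    by (rule set_integral_cauchy_schwarz(1)) (use i1 i2 in auto)
  also have "\<dots> \<le> sqrt (F b - F a) * sqrt (2 * deficit)"
    unfolding F_diff[OF assms(2), symmetric] p_def
    by (intro mult_left_mono real_sqrt_le_mono g)
      (auto simp: set_lebesgue_integral_def intro!: Bochner_Integration.integral_nonneg)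
  finally show "(LBINT x:{a..b}. \<bar>v x * ?g x\<bar>) \<le> sqrt (F b - F a) * sqrt (2 * deficit)" .
qed

lemma q_oscillation:
  assumes "s \<le> t" "a \<le> b" "{a..b} \<subseteq> {X s..X t}"
  shows "\<bar>q b - q a\<bar> \<le> sqrt (F b - F a) * sqrt (2 * deficit)"
proof -
  have "{a..b} \<subseteq> I" using assms(3) X_subset by blast
  from primitive_onD(2)[OF prim_q assms(2) this]
  have "\<bar>q b - q a\<bar> = \<bar>LBINT x:{a..b}. v x * (w x + T x * v x)\<bar>" by simp
  also have "\<dots> \<le> (LBINT x:{a..b}. \<bar>v x * (w x + T x * v x)\<bar>)" by (rule abs_set_integral_le)
  also have "\<dots> \<le> sqrt (F b - F a) * sqrt (2 * deficit)" by (rule vwT_L1[OF assms])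
  finally show ?thesis .
qed

lemma phi_tendsto: "(\<lambda>n. \<phi> (real n)) \<longlonglongrightarrow> 0"
proof (rule tendsto_sandwich[OF _ _ tendsto_const])
  show "(\<lambda>n. (real n)\<^sup>2 * \<phi> (real n)) \<longlonglongrightarrow> 0" by (rule square_times_phi_tendsto)
  show "\<forall>\<^sub>F n in sequentially. \<phi> (real n) \<le> (real n)\<^sup>2 * \<phi> (real n)"
    using eventually_ge_at_top[of 1]
  proof eventually_elim
    case (elim n)
    then have "1 \<le> (real n)\<^sup>2" by (simp add: one_le_power)
    then have "1 * \<phi> (real n) \<le> (real n)\<^sup>2 * \<phi> (real n)" by (rule mult_right_mono) simp
    then show ?case by simp
  qed
qed simp

lemma q_X_tendsto: "(\<lambda>n. q (X (real n))) \<longlonglongrightarrow> 0" "(\<lambda>n. q (X (- real n))) \<longlonglongrightarrow> 0"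
proof -
  show "(\<lambda>n. q (X (real n))) \<longlonglongrightarrow> 0"
    using tendsto_diff[OF p_X_tendsto(1) phi_tendsto] by (simp add: q_def T_X)
  show "(\<lambda>n. q (X (- real n))) \<longlonglongrightarrow> 0"
    using tendsto_diff[OF p_X_tendsto(2) phi_tendsto] by (simp add: q_def T_X phi_uminus)
qed

text \<open>By Cauchy-Schwarz \<open>q\<close> varies by at most \<open>sqrt(1 - F(x)) sqrt(2 deficit)\<close> to the right of \<open>x\<close>, and it
  tends to zero at the right end of the support.\<close>

lemma q_bound_right:
  assumes "x \<in> I"
  shows "\<bar>q x\<bar> \<le> sqrt (1 - F x) * sqrt (2 * deficit)"
proof -
  have "(\<lambda>n. \<bar>q (X (real n))\<bar> + sqrt (1 - F x) * sqrt (2 * deficit)) \<longlonglongrightarrow> \<bar>0\<bar> + sqrt (1 - F x) * sqrt (2 * deficit)"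
    by (intro tendsto_intros q_X_tendsto)
  moreover have "\<forall>\<^sub>F n in sequentially. \<bar>q x\<bar> \<le> \<bar>q (X (real n))\<bar> + sqrt (1 - F x) * sqrt (2 * deficit)"
    using eventually_inside[OF assms]
  proof eventually_elim
    case (elim n)
    then have "\<bar>q (X (real n)) - q x\<bar> \<le> sqrt (F (X (real n)) - F x) * sqrt (2 * deficit)"
      by (intro q_oscillation[of "- real n" "real n"]) auto
    also have "\<dots> \<le> sqrt (1 - F x) * sqrt (2 * deficit)"
      using F_le_1[of "X (real n)"] deficit_nonneg by (intro mult_right_mono real_sqrt_le_mono) auto
    finally show ?case by linarith
  qed
  ultimately have "\<bar>q x\<bar> \<le> \<bar>0\<bar> + sqrt (1 - F x) * sqrt (2 * deficit)"
    by (rule tendsto_lowerbound) simp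
  then show ?thesis by simp
qed

lemma q_bound_left:
  assumes "x \<in> I"
  shows "\<bar>q x\<bar> \<le> sqrt (F x) * sqrt (2 * deficit)"
proof -
  have "(\<lambda>n. \<bar>q (X (- real n))\<bar> + sqrt (F x) * sqrt (2 * deficit)) \<longlonglongrightarrow> \<bar>0\<bar> + sqrt (F x) * sqrt (2 * deficit)"
    by (intro tendsto_intros q_X_tendsto)
  moreover have "\<forall>\<^sub>F n in sequentially. \<bar>q x\<bar> \<le> \<bar>q (X (- real n))\<bar> + sqrt (F x) * sqrt (2 * deficit)"
    using eventually_inside[OF assms]
  proof eventually_elim
    case (elim n)
    then have "\<bar>q x - q (X (- real n))\<bar> \<le> sqrt (F x - F (X (- real n))) * sqrt (2 * deficit)"
      by (intro q_oscillation[of "- real n" "real n"]) auto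
    also have "\<dots> \<le> sqrt (F x) * sqrt (2 * deficit)"
      using F_ge_0[of "X (- real n)"] deficit_nonneg by (intro mult_right_mono real_sqrt_le_mono) auto
    finally show ?case by linarith
  qed
  ultimately have "\<bar>q x\<bar> \<le> \<bar>0\<bar> + sqrt (F x) * sqrt (2 * deficit)"
    by (rule tendsto_lowerbound) simp
  then show ?thesis by simp
qed

text \<open>On the side of \<open>T(x)\<close> away from the origin the mass \<open>F\<close> or \<open>1 - F\<close> is a Gaussian tail at \<open>T(x)\<close>. It is this extra
  factor \<open>\<phi>(T)\<close> which makes \<open>(T' - 1)\<^sup>2 = q\<^sup>2 / \<phi>(T)\<^sup>2\<close> of order \<open>deficit / \<phi>(T)\<close> only.\<close>

lemma q_square_bound:
  assumes "x \<in> I"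
  shows "(q x)\<^sup>2 \<le> 6 * deficit * \<phi> (T x)"
proof -
  have sq: "(q x)\<^sup>2 \<le> c * (2 * deficit)" if "\<bar>q x\<bar> \<le> sqrt c * sqrt (2 * deficit)" "0 \<le> c" for c
  proof -
    have "\<bar>q x\<bar>\<^sup>2 \<le> (sqrt c * sqrt (2 * deficit))\<^sup>2" using that(1) by (intro power_mono) auto
    then show ?thesis using that(2) deficit_nonneg by (simp add: power_mult_distrib)
  qed
  show ?thesis
  proof (cases "0 \<le> T x")
    case True
    have "(q x)\<^sup>2 \<le> (1 - F x) * (2 * deficit)" using q_bound_right[OF assms] F_le_1 by (intro sq) auto
    also have "\<dots> \<le> (3 * \<phi> (T x)) * (2 * deficit)"
      using Phi_tails(1)[OF True] Phi_T[OF assms] deficit_nonneg by (intro mult_right_mono) auto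
    finally show ?thesis by (simp add: algebra_simps)
  next
    case False
    have "(q x)\<^sup>2 \<le> F x * (2 * deficit)" using q_bound_left[OF assms] F_ge_0 by (intro sq) auto
    also have "\<dots> \<le> (3 * \<phi> (T x)) * (2 * deficit)"
      using Phi_tails(2)[of "T x"] False Phi_T[OF assms] deficit_nonneg by (intro mult_right_mono) auto
    finally show ?thesis by (simp add: algebra_simps)
  qed
qed

lemma T_first_moment: "s \<le> t \<Longrightarrow> (LBINT x:{X s..X t}. T x * p x) = \<phi> s - \<phi> t"
  and T_first_moment_integrable: "s \<le> t \<Longrightarrow> set_integrable lborel {X s..X t} (\<lambda>x. T x * p x)"
proof -
  assume "s \<le> t"
  note P = primitive_onD[OF prim_phi_T X_mono[OF this] X_subset]
  have "set_integrable lborel {X s..X t} (\<lambda>x. (-1) * - (T x * p x))"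
    by (rule set_integrable_mult_right) (rule P(1))
  then show i: "set_integrable lborel {X s..X t} (\<lambda>x. T x * p x)" by simp
  show "(LBINT x:{X s..X t}. T x * p x) = \<phi> s - \<phi> t"
    using P(2) set_integral_uminus[OF i] by (simp add: T_X)
qed

lemma abs_x_moment:
  assumes [measurable]: "A \<in> sets borel"
  shows "(LBINT x:A. \<bar>x\<bar> * p x) \<le> sqrt M * sqrt (LBINT x:A. p x)"
proof -
  have i1: "set_integrable lborel A (\<lambda>x. (x * v x)\<^sup>2)" and i2: "set_integrable lborel A (\<lambda>x. (v x)\<^sup>2)"
    using moment_integrable v_sq_integrable by (auto intro!: integrable_imp_set_integrable simp: power_mult_distrib)
  have "(LBINT x:A. \<bar>x\<bar> * p x) = (LBINT x:A. \<bar>(x * v x) * v x\<bar>)"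
    by (simp add: p_def power2_eq_square abs_mult mult.assoc)
  also have "\<dots> \<le> sqrt (LBINT x:A. (x * v x)\<^sup>2) * sqrt (LBINT x:A. (v x)\<^sup>2)"
    by (rule set_integral_cauchy_schwarz(1)) (use i1 i2 in auto)
  also have "\<dots> \<le> sqrt M * sqrt (LBINT x:A. (v x)\<^sup>2)"
  proof (intro mult_right_mono real_sqrt_le_mono)
    have "(LBINT x:A. (x * v x)\<^sup>2) \<le> (\<integral>x. (x * v x)\<^sup>2 \<partial>lborel)"
      by (rule set_integral_le_integral) (use moment_integrable in \<open>auto simp: power_mult_distrib\<close>)
    also have "\<dots> \<le> M" using moment by (simp add: power_mult_distrib)
    finally show "(LBINT x:A. (x * v x)\<^sup>2) \<le> M" .
  qed (auto simp: set_lebesgue_integral_def intro!: Bochner_Integration.integral_nonneg)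
  finally show ?thesis by (simp add: p_def)
qed

text \<open>The scale \<open>h\<close> stands for the fourth root of the deficit, and the core \<open>G = {|T| \<le> R}\<close> is chosen with
  \<open>exp(- R\<^sup>2/4) = h\<close>. This balances the two errors: inside the core \<open>T - x\<close> deviates from a constant by
  \<open>O(h\<^sup>2 exp(R\<^sup>2/4)) = O(h)\<close>, while the mass outside is \<open>O(exp(- R\<^sup>2/2)) = O(h\<^sup>2)\<close>, of which first moments see the
  square root. Taking \<open>h\<^sup>4\<close> as an upper bound of the deficit, rather than its value, covers a vanishing
  deficit.\<close>

context
  fixes R h :: real
  assumes h: "h = exp (- R\<^sup>2 / 4)" and R: "0 \<le> R" and h_small: "h \<le> 1 / 9" and small_deficit: "deficit \<le> h ^ 4"
begin

abbreviation "G \<equiv> {X (- R)..X R}"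

lemma h_pos: "0 < h" by (simp add: h)

lemma exp_T_bound:
  assumes "x \<in> G"
  shows "exp ((T x)\<^sup>2 / 4) \<le> 1 / h"
proof -
  have "\<bar>T x\<bar> \<le> R" using between_X[OF assms] by auto
  then have "(T x)\<^sup>2 \<le> R\<^sup>2" using abs_le_square_iff[of "T x" R] R by simp
  then have "exp ((T x)\<^sup>2 / 4) \<le> exp (R\<^sup>2 / 4)" by simp
  also have "exp (R\<^sup>2 / 4) = 1 / h"
  proof -
    have "exp (R\<^sup>2 / 4) * h = 1" unfolding h by (simp flip: exp_add)
    then show ?thesis using h_pos by (simp add: eq_divide_eq)
  qed
  finally show ?thesis .
qed

lemma phi_R: "\<phi> R \<le> h\<^sup>2 / 2"
proof -
  have "h\<^sup>2 = exp (- R\<^sup>2 / 2)" by (simp add: h power2_eq_square flip: exp_add)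
  then show ?thesis using phi_bounds(2)[of R] by simp
qed

text \<open>Dividing the bound on \<open>q\<close> by \<open>\<phi>(T)\<close> gives \<open>|\<tau> - 1| \<le> (17/4) h\<^sup>2 exp(T\<^sup>2/4)\<close>. On the core this is at most
  \<open>17/36\<close>, so \<open>\<tau>\<close> is bounded below and may be inserted as a factor on the right, which turns
  that side into the derivative of a multiple of \<open>envelope \<circ> T\<close>.\<close>

lemma tau_near_1:
  assumes x: "x \<in> G"
  shows "\<bar>\<tau> x - 1\<bar> \<le> 50 * h\<^sup>2 * (envelope' (T x) * \<tau> x)"
proof -
  have xI: "x \<in> I" by (rule between_X(1)[OF x])
  define E where "E = exp ((T x)\<^sup>2 / 4)"
  have E: "0 < E" "E \<le> 1 / h" using exp_T_bound[OF x] by (auto simp: E_def)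
  have E2: "E\<^sup>2 = exp ((T x)\<^sup>2 / 2)" by (simp add: E_def power2_eq_square flip: exp_add)
  have ph: "1 / \<phi> (T x) \<le> 3 * E\<^sup>2"
  proof -
    have "1 = 3 * E\<^sup>2 * (exp (- (T x)\<^sup>2 / 2) / 3)" by (simp add: E2 flip: exp_add)
    also have "\<dots> \<le> 3 * E\<^sup>2 * \<phi> (T x)" by (intro mult_left_mono phi_bounds) simp
    finally show ?thesis using phi_pos[of "T x"] by (simp add: field_simps)
  qed
  have eq: "\<tau> x - 1 = q x / \<phi> (T x)"
    using phi_pos[of "T x"] by (simp add: \<tau>_def q_def diff_divide_distrib)
  have "(\<tau> x - 1)\<^sup>2 = (q x)\<^sup>2 / (\<phi> (T x))\<^sup>2" unfolding eq by (simp add: power_divide)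
  also have "\<dots> \<le> (6 * deficit * \<phi> (T x)) / (\<phi> (T x))\<^sup>2"
    by (intro divide_right_mono q_square_bound[OF xI]) simp
  also have "\<dots> = 6 * deficit * (1 / \<phi> (T x))"
    using phi_pos[of "T x"] by (simp add: power2_eq_square)
  also have "\<dots> \<le> 6 * h ^ 4 * (3 * E\<^sup>2)"
    using small_deficit deficit_nonneg ph phi_pos[of "T x"] by (intro mult_mono) auto
  also have "\<dots> \<le> 289 / 16 * (h ^ 4 * E\<^sup>2)" by simp
  also have "\<dots> = (17 / 4 * h\<^sup>2 * E)\<^sup>2" by (simp add: power2_eq_square power4_eq_xxxx)
  finally have 1: "\<bar>\<tau> x - 1\<bar> \<le> 17 / 4 * h\<^sup>2 * E"
    using E by (simp add: abs_le_square_iff[symmetric])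
  also have "\<dots> \<le> 17 / 4 * h\<^sup>2 * (1 / h)" using E by (intro mult_left_mono) auto
  also have "\<dots> \<le> 17 / 36" using h_pos h_small by (simp add: power2_eq_square)
  finally have t: "\<tau> x \<ge> 19 / 36" by linarith
  have "17 / 4 * h\<^sup>2 * E * 1 \<le> 17 / 4 * h\<^sup>2 * E * (40 / 17 * \<tau> x)"
    using t E by (intro mult_left_mono) auto
  with 1 have "\<bar>\<tau> x - 1\<bar> \<le> 10 * h\<^sup>2 * (E * \<tau> x)" by (simp add: algebra_simps)
  also have "\<dots> \<le> 10 * h\<^sup>2 * ((5 * envelope' (T x)) * \<tau> x)"
    using envelope'_lower[of "T x"] t by (intro mult_left_mono mult_right_mono) (auto simp: E_def)
  finally show ?thesis by (simp add: algebra_simps)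
qed

lemma G_props: "X (- R) \<le> X 0" "X 0 \<le> X R" "X (- R) \<le> X R"
  using R by (auto intro!: X_mono)

text \<open>Both \<open>c envelope(T) + (T - x)\<close> and \<open>c envelope(T) - (T - x)\<close> are nondecreasing on the core, and at \<open>X 0\<close> the
  envelope vanishes while \<open>T - x = - X 0\<close>.\<close>

lemma displacement_on_G:
  assumes x: "x \<in> G"
  shows "\<bar>T x - x + X 0\<bar> \<le> 25 * h"
proof -
  define c where "c = 50 * h\<^sup>2"
  have kd: "((\<lambda>y. envelope (T y)) has_field_derivative envelope' (T y) * \<tau> y) (at y)" if "y \<in> G" for y
    using DERIV_chain2[OF envelope_DERIV T_DERIV[OF between_X(1)[OF that]]] by (simp add: \<tau>_def)
  have d1: "((\<lambda>y. c * envelope (T y) + (T y - y)) has_field_derivative c * (envelope' (T y) * \<tau> y) + (\<tau> y - 1)) (at y)"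
    and d2: "((\<lambda>y. c * envelope (T y) - (T y - y)) has_field_derivative c * (envelope' (T y) * \<tau> y) - (\<tau> y - 1)) (at y)"
    if "y \<in> G" for y
    using T_DERIV[OF between_X(1)[OF that]]
    by (auto intro!: derivative_eq_intros kd that simp: \<tau>_def)
  have mono: "c * envelope (T a) + (T a - a) \<le> c * envelope (T b) + (T b - b)" "c * envelope (T a) - (T a - a) \<le> c * envelope (T b) - (T b - b)"
    if "a \<le> b" "a \<in> G" "b \<in> G" for a b
  proof -
    have G: "y \<in> G" if "a \<le> y" "y \<le> b" for y using that \<open>a \<in> G\<close> \<open>b \<in> G\<close> by auto
    have n: "0 \<le> c * (envelope' (T y) * \<tau> y) + (\<tau> y - 1)" "0 \<le> c * (envelope' (T y) * \<tau> y) - (\<tau> y - 1)" if "y \<in> G" for y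
      using tau_near_1[OF that] unfolding c_def by linarith+
    show "c * envelope (T a) + (T a - a) \<le> c * envelope (T b) + (T b - b)"
      by (rule DERIV_nonneg_imp_nondecreasing[OF \<open>a \<le> b\<close>]) (use d1 n G in blast)
    show "c * envelope (T a) - (T a - a) \<le> c * envelope (T b) - (T b - b)"
      by (rule DERIV_nonneg_imp_nondecreasing[OF \<open>a \<le> b\<close>]) (use d2 n G in blast)
  qed
  have X0: "X 0 \<in> G" using G_props by auto
  have k0: "envelope (T (X 0)) = 0" by (simp add: T_X envelope_def)
  have "\<bar>T x - x + X 0\<bar> \<le> c * \<bar>envelope (T x)\<bar>"
  proof (cases "X 0 \<le> x")
    case True
    from mono[OF True X0 x] have "\<bar>T x - x + X 0\<bar> \<le> c * envelope (T x)" by (simp add: k0) (simp add: T_X)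
    also have "\<dots> \<le> c * \<bar>envelope (T x)\<bar>" by (intro mult_left_mono) (auto simp: c_def)
    finally show ?thesis .
  next
    case False
    from mono[of x "X 0"] False X0 x have "\<bar>T x - x + X 0\<bar> \<le> c * - envelope (T x)" by (simp add: k0) (simp add: T_X)
    also have "\<dots> \<le> c * \<bar>envelope (T x)\<bar>" by (intro mult_left_mono) (auto simp: c_def)
    finally show ?thesis .
  qed
  also have "\<dots> \<le> c * ((1 / h) / 2)"
    using envelope_bound[of "T x"] exp_T_bound[OF x] by (intro mult_left_mono) (auto simp: c_def)
  also have "\<dots> = 25 * h" using h_pos by (simp add: c_def power2_eq_square)
  finally show ?thesis .
qed

definition "core_mass = (LBINT x:G. p x)"

lemma p_set_integrable: "A \<in> sets borel \<Longrightarrow> set_integrable lborel A p"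
  using p_integrable by (rule integrable_imp_set_integrable)

lemma core_mass_bounds: "1 - 3 * h\<^sup>2 \<le> core_mass" "core_mass \<le> 1" "1 / 2 \<le> core_mass"
proof -
  have eq: "core_mass = \<Phi> R - \<Phi> (- R)"
    unfolding core_mass_def using F_diff[OF G_props(3)] by (simp add: F_X)
  show "1 - 3 * h\<^sup>2 \<le> core_mass"
    using Phi_tails(1)[OF R] Phi_tails(2)[of "- R"] R phi_R unfolding eq phi_uminus by simp
  moreover have "h\<^sup>2 \<le> (1 / 9)\<^sup>2" using h_pos h_small by (intro power_mono) auto
  ultimately show "1 / 2 \<le> core_mass" by (simp add: power2_eq_square)
  show "core_mass \<le> 1" using Phi_le_1[of R] Phi_ge_0[of "- R"] unfolding eq by simp
qed

lemma complement_integral: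
  assumes "integrable lborel f"
  shows "(LBINT x:- G. f x) = (\<integral>x. f x \<partial>lborel) - (LBINT x:G. f x :: real)"
proof -
  have "(\<integral>x. f x \<partial>lborel) = (LBINT x:G \<union> - G. f x)" by (simp add: set_lebesgue_integral_def)
  also have "\<dots> = (LBINT x:G. f x) + (LBINT x:- G. f x)"
    by (rule set_integral_Un) (use assms in \<open>auto intro!: integrable_imp_set_integrable\<close>)
  finally show ?thesis by simp
qed

text \<open>Here the second moment enters: it bounds the first moment carried by the small mass outside the core.\<close>

lemma abs_x_outside: "(LBINT x:- G. \<bar>x\<bar> * p x) \<le> 2 * sqrt M * h"
proof -
  have "(LBINT x:- G. \<bar>x\<bar> * p x) \<le> sqrt M * sqrt (LBINT x:- G. p x)"
    by (rule abs_x_moment) simp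
  also have "(LBINT x:- G. p x) = 1 - core_mass"
    using complement_integral[OF p_integrable] by (simp add: core_mass_def p_mass)
  also have "sqrt M * sqrt (1 - core_mass) \<le> sqrt M * sqrt ((2 * h)\<^sup>2)"
  proof (intro mult_left_mono real_sqrt_le_mono)
    have "1 - core_mass \<le> 4 * h\<^sup>2" using core_mass_bounds(1) zero_le_power2[of h] by linarith
    then show "1 - core_mass \<le> (2 * h)\<^sup>2" by (simp add: power_mult_distrib)
  qed (use M_nonneg in simp)
  also have "sqrt ((2 * h)\<^sup>2) = 2 * h" using h_pos by (subst real_sqrt_abs) simp
  finally show ?thesis by (simp add: ac_simps)
qed

lemma abs_xp_integrable: "integrable lborel (\<lambda>x. \<bar>x\<bar> * p x)"
  using integrable_abs[OF xp_integrable] by (simp add: abs_mult)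

lemma x_inside: "\<bar>LBINT x:G. x * p x\<bar> \<le> 2 * sqrt M * h"
proof -
  have "\<bar>LBINT x:G. x * p x\<bar> = \<bar>LBINT x:- G. x * p x\<bar>"
    using complement_integral[OF xp_integrable] by (simp add: xp_mean)
  also have "\<dots> \<le> (LBINT x:- G. \<bar>x * p x\<bar>)" by (rule abs_set_integral_le)
  also have "\<dots> = (LBINT x:- G. \<bar>x\<bar> * p x)" by (simp add: abs_mult)
  finally show ?thesis using abs_x_outside by simp
qed

lemma integrals_inside:
  shows "set_integrable lborel G (\<lambda>x. T x * p x)" "(LBINT x:G. T x * p x) = 0"
    and "set_integrable lborel G (\<lambda>x. x * p x)"
  using T_first_moment[of "- R" R] T_first_moment_integrable[of "- R" R] R xp_integrable
  by (auto simp: phi_uminus intro: integrable_imp_set_integrable)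

text \<open>The constant \<open>X 0\<close> is found by integrating \<open>T - x + X 0\<close> over the core: the integral of \<open>T p\<close> vanishes by
  symmetry of \<open>\<phi>\<close>, and since \<open>p\<close> is centered that of \<open>x p\<close> equals, up to sign, its integral outside.\<close>

lemma X0_bound: "\<bar>X 0\<bar> \<le> 50 * h + 4 * sqrt M * h"
proof -
  have i: "set_integrable lborel G (\<lambda>x. T x * p x - x * p x + X 0 * p x)"
    using integrals_inside p_set_integrable[of G] by (intro set_integral_add set_integral_diff set_integrable_mult_right) auto
  have "(LBINT x:G. T x * p x - x * p x + X 0 * p x) = 0 - (LBINT x:G. x * p x) + X 0 * core_mass"
    using integrals_inside p_set_integrable[of G]
    by (subst set_integral_add(2); (subst set_integral_diff(2))?) (auto simp: core_mass_def)
  then have "\<bar>X 0 * core_mass\<bar> \<le> \<bar>LBINT x:G. T x * p x - x * p x + X 0 * p x\<bar> + 2 * sqrt M * h"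
    using x_inside by linarith
  also have "\<bar>LBINT x:G. T x * p x - x * p x + X 0 * p x\<bar> \<le> (LBINT x:G. \<bar>T x * p x - x * p x + X 0 * p x\<bar>)"
    by (rule abs_set_integral_le)
  also have "\<dots> \<le> (LBINT x:G. (25 * h) * p x)"
  proof (rule set_integral_mono[OF set_integrable_abs[OF i]])
    fix x assume "x \<in> G"
    have "\<bar>T x * p x - x * p x + X 0 * p x\<bar> = \<bar>T x - x + X 0\<bar> * p x"
      by (simp add: abs_mult flip: left_diff_distrib distrib_right)
    also have "\<dots> \<le> (25 * h) * p x" by (intro mult_right_mono displacement_on_G[OF \<open>x \<in> G\<close>]) simp
    finally show "\<bar>T x * p x - x * p x + X 0 * p x\<bar> \<le> (25 * h) * p x" .
  qed (intro set_integrable_mult_right p_set_integrable; simp)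
  also have "\<dots> = 25 * h * core_mass" by (simp add: core_mass_def)
  also have "\<dots> \<le> 25 * h * 1" using h_pos core_mass_bounds by (intro mult_left_mono) auto
  finally have "\<bar>X 0\<bar> * core_mass \<le> 25 * h + 2 * sqrt M * h" using core_mass_bounds by (simp add: abs_mult)
  moreover have "\<bar>X 0\<bar> * (1 / 2) \<le> \<bar>X 0\<bar> * core_mass" using core_mass_bounds by (intro mult_left_mono) auto
  ultimately show ?thesis by simp
qed

lemma transport_inside: "(LBINT x:G. \<bar>x - T x\<bar> * p x) \<le> 75 * h + 4 * sqrt M * h"
proof -
  have i: "set_integrable lborel G (\<lambda>x. \<bar>x - T x\<bar> * p x)"
    by (intro set_integrable_continuous_mult p_set_integrable continuous_intros T_continuous X_subset) simp
  have "(LBINT x:G. \<bar>x - T x\<bar> * p x) \<le> (LBINT x:G. (75 * h + 4 * sqrt M * h) * p x)"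
  proof (rule set_integral_mono[OF i])
    fix x assume "x \<in> G"
    then have "\<bar>x - T x\<bar> \<le> 75 * h + 4 * sqrt M * h"
      using displacement_on_G[of x] X0_bound by linarith
    then show "\<bar>x - T x\<bar> * p x \<le> (75 * h + 4 * sqrt M * h) * p x" by (rule mult_right_mono) simp
  qed (intro set_integrable_mult_right p_set_integrable; simp)
  also have "\<dots> = (75 * h + 4 * sqrt M * h) * core_mass" by (simp add: core_mass_def)
  also have "\<dots> \<le> (75 * h + 4 * sqrt M * h) * 1"
    using h_pos core_mass_bounds M_nonneg by (intro mult_left_mono) auto
  finally show ?thesis by simp
qed

text \<open>Outside the core \<open>|x - T| \<le> |x| + |T|\<close>, and the integral of \<open>T p\<close> over \<open>[X R, X r]\<close> is \<open>\<phi>(R) - \<phi>(r)\<close>.\<close>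

lemma transport_total:
  assumes n: "R \<le> r"
  shows "(LBINT x:{X (- r)..X r}. \<bar>x - T x\<bar> * p x) \<le> 76 * h + 6 * sqrt M * h"
proof -
  let ?A = "{X (- r)..X r}"
  \<comment> \<open>the four majorants: the core, \<open>|x|\<close> outside of it, and \<open>T\<close> on its two sides\<close>
  let ?g1 = "\<lambda>x. indicator G x * (\<bar>x - T x\<bar> * p x)"
  let ?g2 = "\<lambda>x. indicator (- G) x * (\<bar>x\<bar> * p x)"
  let ?g3 = "\<lambda>x. indicator {X R..X r} x * (T x * p x)"
  let ?g4 = "\<lambda>x. indicator {X (- r)..X (- R)} x * (T x * p x)"
  have ia: "set_integrable lborel {X s..X t} (\<lambda>x. \<bar>x - T x\<bar> * p x)" for s t
    by (intro set_integrable_continuous_mult p_set_integrable continuous_intros T_continuous X_subset) simp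
  have i1: "integrable lborel ?g1" using ia unfolding set_integrable_def by simp
  have i2: "integrable lborel ?g2" by (intro integrable_indicator_mult abs_xp_integrable) simp
  have i3: "integrable lborel ?g3" and i4: "integrable lborel ?g4"
    using T_first_moment_integrable[of R r] T_first_moment_integrable[of "- r" "- R"] n
    unfolding set_integrable_def by auto
  have "(LBINT x:?A. \<bar>x - T x\<bar> * p x) \<le> (\<integral>x. (?g1 x + ?g2 x) + (?g3 x - ?g4 x) \<partial>lborel)"
    unfolding set_lebesgue_integral_def
  proof (rule integral_mono)
    show "integrable lborel (\<lambda>x. indicat_real ?A x *\<^sub>R (\<bar>x - T x\<bar> * p x))"
      using ia unfolding set_integrable_def by simp
    show "integrable lborel (\<lambda>x. (?g1 x + ?g2 x) + (?g3 x - ?g4 x))"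
      using i1 i2 i3 i4 by (intro Bochner_Integration.integrable_add Bochner_Integration.integrable_diff)
    fix x
    have nn3: "0 \<le> ?g3 x" and nn4: "?g4 x \<le> 0"
      using between_X(2)[of x R r] between_X(3)[of x "- r" "- R"] R
      by (auto simp: indicator_def mult_le_0_iff zero_le_mult_iff)
    have nn2: "0 \<le> ?g2 x" by (auto simp: indicator_def)
    show "indicat_real ?A x *\<^sub>R (\<bar>x - T x\<bar> * p x) \<le> (?g1 x + ?g2 x) + (?g3 x - ?g4 x)"
    proof (cases "x \<in> ?A")
      case False
      then have "x \<notin> G" using n R X_mono[of "- r" "- R"] X_mono[of R r] by auto
      then show ?thesis using False nn2 nn3 nn4 by simp
    next
      case A: True
      consider "x \<in> G" | "X R < x" | "x < X (- R)" by fastforce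
      then show ?thesis
      proof cases
        case 1
        then show ?thesis using A nn2 nn3 nn4 by simp
      next
        case 2
        then have x3: "x \<in> {X R..X r}" "x \<notin> G" using A by auto
        have "0 \<le> T x" using between_X(2)[OF x3(1)] R by simp
        then have "\<bar>x - T x\<bar> * p x \<le> (\<bar>x\<bar> + T x) * p x" by (intro mult_right_mono) auto
        then show ?thesis using A x3 nn4 by (simp add: distrib_right)
      next
        case 3
        then have x4: "x \<in> {X (- r)..X (- R)}" "x \<notin> G" using A by auto
        have "T x \<le> 0" using between_X(3)[OF x4(1)] R by simp
        then have "\<bar>x - T x\<bar> * p x \<le> (\<bar>x\<bar> - T x) * p x" by (intro mult_right_mono) auto
        then show ?thesis using A x4 nn3 by (simp add: left_diff_distrib)
      qed
    qed
  qed
  also have "\<dots> = (\<integral>x. ?g1 x \<partial>lborel) + (\<integral>x. ?g2 x \<partial>lborel) + ((\<integral>x. ?g3 x \<partial>lborel) - (\<integral>x. ?g4 x \<partial>lborel))"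
    using i1 i2 i3 i4 by (simp only: Bochner_Integration.integral_add Bochner_Integration.integral_diff
        Bochner_Integration.integrable_add Bochner_Integration.integrable_diff)
  also have "\<dots> \<le> (75 * h + 4 * sqrt M * h) + 2 * sqrt M * h + (\<phi> R - (- \<phi> R))"
  proof (intro add_mono diff_mono)
    show "(\<integral>x. ?g1 x \<partial>lborel) \<le> 75 * h + 4 * sqrt M * h"
      using transport_inside by (simp add: set_lebesgue_integral_def)
    show "(\<integral>x. ?g2 x \<partial>lborel) \<le> 2 * sqrt M * h"
      using abs_x_outside by (simp add: set_lebesgue_integral_def)
    show "(\<integral>x. ?g3 x \<partial>lborel) \<le> \<phi> R"
      using T_first_moment[OF n] by (simp add: set_lebesgue_integral_def)
    show "- \<phi> R \<le> (\<integral>x. ?g4 x \<partial>lborel)"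
      using T_first_moment[of "- r" "- R"] n by (simp add: set_lebesgue_integral_def phi_uminus)
  qed
  also have "\<phi> R - (- \<phi> R) \<le> h"
  proof -
    have "h\<^sup>2 \<le> h * 1" unfolding power2_eq_square using h_pos h_small by (intro mult_left_mono) auto
    then show ?thesis using phi_R by simp
  qed
  finally show ?thesis by (simp add: algebra_simps)
qed

text \<open>Split \<open>v e = p' + x p\<close> as \<open>(p' + T p) + (x - T) p\<close>. The first part is controlled by the deficit through
  Cauchy-Schwarz, the second is the transport cost.\<close>

lemma stein_L1_bound_truncated:
  assumes n: "R \<le> r"
  shows "(LBINT x:{X (- r)..X r}. \<bar>v x * e x\<bar>) \<le> (78 + 6 * sqrt M) * h"
proof -
  let ?A = "{X (- r)..X r}"
  have r: "- r \<le> r" "X (- r) \<le> X r" using n R by (auto intro!: X_mono)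
  have ia: "set_integrable lborel ?A (\<lambda>x. \<bar>x - T x\<bar> * p x)"
    by (intro set_integrable_continuous_mult p_set_integrable continuous_intros T_continuous X_subset) simp
  note g = vwT_L1[OF r order_refl]
  have "(LBINT x:?A. \<bar>v x * e x\<bar>) \<le> (LBINT x:?A. \<bar>v x * (w x + T x * v x)\<bar> + \<bar>x - T x\<bar> * p x)"
  proof (rule set_integral_mono)
    show "set_integrable lborel ?A (\<lambda>x. \<bar>v x * e x\<bar>)"
      using ve_integrable by (intro set_integrable_abs integrable_imp_set_integrable) auto
    show "set_integrable lborel ?A (\<lambda>x. \<bar>v x * (w x + T x * v x)\<bar> + \<bar>x - T x\<bar> * p x)"
      by (intro set_integral_add(1) set_integrable_abs g(2) ia)
    fix x
    have "v x * e x = v x * (w x + T x * v x) + (x - T x) * p x"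
      by (simp add: e_def p_def power2_eq_square algebra_simps)
    then show "\<bar>v x * e x\<bar> \<le> \<bar>v x * (w x + T x * v x)\<bar> + \<bar>x - T x\<bar> * p x"
      using abs_triangle_ineq[of "v x * (w x + T x * v x)" "(x - T x) * p x"] by (simp add: abs_mult)
  qed
  also have "\<dots> = (LBINT x:?A. \<bar>v x * (w x + T x * v x)\<bar>) + (LBINT x:?A. \<bar>x - T x\<bar> * p x)"
    by (intro set_integral_add(2) set_integrable_abs g(2) ia)
  also have "\<dots> \<le> 2 * h + (76 * h + 6 * sqrt M * h)"
  proof (intro add_mono transport_total n)
    have "sqrt (F (X r) - F (X (- r))) * sqrt (2 * deficit) \<le> 1 * sqrt ((2 * h)\<^sup>2)"
    proof (intro mult_mono real_sqrt_le_mono)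
      show "sqrt (F (X r) - F (X (- r))) \<le> 1" using F_le_1[of "X r"] F_ge_0[of "X (- r)"] by (simp add: real_sqrt_le_1_iff)
      have "h ^ 4 \<le> h ^ 2" using h_pos h_small by (intro power_decreasing) auto
      then show "2 * deficit \<le> (2 * h)\<^sup>2" using small_deficit deficit_nonneg zero_le_power2[of h] by (simp add: power_mult_distrib)
    qed (use deficit_nonneg in auto)
    also have "sqrt ((2 * h)\<^sup>2) = 2 * h" using h_pos by (subst real_sqrt_abs) simp
    finally show "(LBINT x:?A. \<bar>v x * (w x + T x * v x)\<bar>) \<le> 2 * h" using g(1) by linarith
  qed
  finally show ?thesis by (simp add: algebra_simps)
qed

end

theorem stein_L1_bound:
  assumes h: "0 < h" "h \<le> 1 / 9" "deficit \<le> h ^ 4"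
  shows "(\<integral>x. \<bar>v x * e x\<bar> \<partial>lborel) \<le> (78 + 6 * sqrt M) * h"
proof -
  define R where "R = 2 * sqrt (- ln h)"
  have "ln h \<le> 0" using h by simp
  then have R: "0 \<le> R" "h = exp (- R\<^sup>2 / 4)" using h by (auto simp: R_def power_mult_distrib)
  have "(\<lambda>n. LBINT x:{X (- real n)..X (real n)}. \<bar>v x * e x\<bar>) \<longlonglongrightarrow> (\<integral>x. \<bar>v x * e x\<bar> \<partial>lborel)"
    by (rule exhaustion) (use ve_integrable in \<open>auto simp: p_def\<close>)
  moreover obtain N :: nat where N: "R \<le> real N" using real_arch_simple by blast
  have "\<forall>\<^sub>F n in sequentially. (LBINT x:{X (- real n)..X (real n)}. \<bar>v x * e x\<bar>) \<le> (78 + 6 * sqrt M) * h"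
    using eventually_ge_at_top[of N]
    by eventually_elim (rule stein_L1_bound_truncated[OF R(2,1) h(2,3)], use N in simp)
  ultimately show ?thesis by (intro tendsto_upperbound) auto
qed

end

section \<open>The stability estimate\<close>

lemma gauss_AE_iff: "(AE x in gauss. P x) \<longleftrightarrow> (AE x in lborel. P x)"
  unfolding gauss_def by (subst AE_density) (auto simp: normal_density_pos)

lemma sets_gauss [measurable_cong, simp]: "sets gauss = sets borel"
  by (simp add: gauss_def)

lemma space_gauss [simp]: "space gauss = UNIV"
  by (simp add: gauss_def)

lemma integrable_gauss_iff:
  "h \<in> borel_measurable borel \<Longrightarrow> integrable gauss h \<longleftrightarrow> integrable lborel (\<lambda>x. h x * \<phi> x)"
  unfolding gauss_def by (subst integrable_real_density) (auto simp: mult.commute)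

lemma integral_gauss:
  "h \<in> borel_measurable borel \<Longrightarrow> (\<integral>x. h x \<partial>gauss) = (\<integral>x. h x * \<phi> x \<partial>lborel)" for h :: "real \<Rightarrow> real"
  unfolding gauss_def by (subst integral_real_density) (auto simp: mult.commute)

lemma has_weak_deriv_AE_cong:
  assumes "has_weak_deriv u g" "u' \<in> borel_measurable borel" "AE x in lborel. u' x = u x"
  shows "has_weak_deriv u' g"
  unfolding has_weak_deriv_def
proof (intro conjI allI impI)
  have loc: "locally_integrable u" "locally_integrable g" using assms(1) unfolding has_weak_deriv_def by auto
  note [measurable] = assms(2) locally_integrable_borel[OF loc(1)] locally_integrable_borel[OF loc(2)]
  show "locally_integrable g" by fact
  show "locally_integrable u'"
    unfolding locally_integrable_Icc
  proof (intro allI)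
    fix a b
    have "set_integrable lborel {a..b} u" using loc(1) by (simp add: locally_integrable_Icc)
    then have "integrable lborel (\<lambda>x. indicator {a..b} x *\<^sub>R u x)" by (simp add: set_integrable_def)
    moreover have "AE x in lborel. indicat_real {a..b} x *\<^sub>R u x = indicator {a..b} x *\<^sub>R u' x"
      using assms(3) by eventually_elim simp
    ultimately show "set_integrable lborel {a..b} u'"
      unfolding set_integrable_def by (subst integrable_cong_AE[symmetric]) auto
  qed
  fix \<psi> assume \<psi>: "test_function \<psi>"
  have [measurable]: "deriv \<psi> \<in> borel_measurable borel"
    using \<psi> unfolding test_function_iff
    by (intro borel_measurable_continuous_onI smooth_continuous_on smooth_deriv) auto
  have "(\<integral>x. u' x * deriv \<psi> x \<partial>lborel) = (\<integral>x. u x * deriv \<psi> x \<partial>lborel)"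
  proof (rule integral_cong_AE)
    show "AE x in lborel. u' x * deriv \<psi> x = u x * deriv \<psi> x"
      using assms(3) by eventually_elim simp
  qed auto
  then show "(\<integral>x. u' x * deriv \<psi> x \<partial>lborel) = - (\<integral>x. g x * \<psi> x \<partial>lborel)"
    using assms(1) \<psi> unfolding has_weak_deriv_def by simp
qed

lemma weak_deriv_AE_eq:
  assumes "has_weak_deriv u g"
  shows "AE x in lborel. weak_deriv u x = g x" "weak_deriv u \<in> borel_measurable borel"
proof -
  have *: "has_weak_deriv u (weak_deriv u)"
    unfolding weak_deriv_def by (rule someI[of "has_weak_deriv u"]) (rule assms)
  then show "AE x in lborel. weak_deriv u x = g x" using assms by (rule has_weak_deriv_AE_unique)
  from * show "weak_deriv u \<in> borel_measurable borel"
    unfolding has_weak_deriv_def by (blast intro: locally_integrable_borel)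
qed

text \<open>For small positive \<open>\<delta>\<close> take \<open>h\<close> to be its fourth root; for \<open>\<delta> = 0\<close> let \<open>h\<close> tend to zero; for large \<open>\<delta>\<close> the
  trivial bound \<open>2\<close> suffices, as \<open>18 (1/9) = 2\<close>.\<close>

lemma quarter_power_bound:
  fixes L A \<delta> :: real
  assumes \<delta>: "0 \<le> \<delta>" and L2: "L \<le> 2" and A: "0 \<le> A"
    and small: "\<And>h. 0 < h \<Longrightarrow> h \<le> 1 / 9 \<Longrightarrow> \<delta> \<le> h ^ 4 \<Longrightarrow> L \<le> A * h"
  shows "L \<le> (A + 18) * \<delta> powr (1 / 4)"
proof -
  consider "\<delta> = 0" | "0 < \<delta>" "\<delta> powr (1 / 4) \<le> 1 / 9" | "1 / 9 < \<delta> powr (1 / 4)"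
    using \<delta> by fastforce
  then show ?thesis
  proof cases
    case 1
    have "(\<lambda>n. A * (1 / 9 * inverse (real (Suc n)))) \<longlonglongrightarrow> A * (1 / 9 * 0)"
      by (intro tendsto_intros LIMSEQ_inverse_real_of_nat)
    moreover have "L \<le> A * (1 / 9 * inverse (real (Suc n)))" for n
      using 1 by (intro small) (auto simp: field_simps)
    ultimately have "L \<le> A * (1 / 9 * 0)" using LIMSEQ_le_const by blast
    then show ?thesis using 1 by simp
  next
    case 2
    have "(\<delta> powr (1 / 4)) ^ 4 = \<delta>"
      using 2 by (simp add: powr_power)
    then have "L \<le> A * \<delta> powr (1 / 4)" using 2 by (intro small) auto
    also have "\<dots> \<le> (A + 18) * \<delta> powr (1 / 4)" by (intro mult_right_mono) auto
    finally show ?thesis .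
  next
    case 3
    have "L \<le> 18 * \<delta> powr (1 / 4)" using 3 L2 by simp
    also have "\<dots> \<le> (A + 18) * \<delta> powr (1 / 4)" using A by (intro mult_right_mono) auto
    finally show ?thesis .
  qed
qed

text \<open>Replace \<open>sqrt f\<close> by its absolutely continuous representative \<open>U\<close>, so that \<open>f = U\<^sup>2\<close> almost everywhere with
  weak derivative \<open>2 U g\<close>, and apply the transport argument to \<open>p = U\<^sup>2 \<phi>\<close>.\<close>

lemma L1_le_deficit:
  fixes M :: real and f :: "real \<Rightarrow> real"
  assumes dens: "gauss_prob_density f"
    and cent: "centered (density gauss (\<lambda>x. ennreal (f x)))"
    and mom: "(\<integral>\<^sup>+ x. ennreal (\<bar>x\<bar>\<^sup>2 * f x) \<partial>gauss) \<le> ennreal M"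
    and sob: "(\<lambda>x. sqrt (f x)) \<in> sobolev_W12_gauss"
    and M: "0 \<le> M"
  shows "(\<integral>x. \<bar>f x - 1\<bar> \<partial>gauss) \<le> (6 * (78 + 6 * sqrt M) + 18) * lsi_deficit f powr (1 / 4)"
proof -
  have f_borel[measurable]: "f \<in> borel_measurable borel" and f_nn: "AE x in gauss. 0 \<le> f x"
    and ps: "prob_space (density gauss (\<lambda>x. ennreal (f x)))"
    using dens unfolding gauss_prob_density_def by auto
  obtain g where g: "has_weak_deriv (\<lambda>x. sqrt (f x)) g" and g2: "integrable gauss (\<lambda>x. (g x)\<^sup>2)"
    using sob unfolding sobolev_W12_gauss_def by auto
  obtain U where U: "primitive_on UNIV U g" and sqrt_f: "AE x in lborel. sqrt (f x) = U x"
    by (rule has_weak_deriv_imp_AE_primitive[OF g])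
  have [measurable]: "g \<in> borel_measurable borel"
    using g unfolding has_weak_deriv_def by (blast intro: locally_integrable_borel)
  have [measurable]: "U \<in> borel_measurable borel"
    by (intro borel_measurable_continuous_onI primitive_continuous[OF U])
  have fU: "AE x in lborel. f x = (U x)\<^sup>2"
    using sqrt_f f_nn[unfolded gauss_AE_iff] by eventually_elim (metis real_sqrt_pow2)

  have "(\<integral>\<^sup>+x. ennreal (f x) \<partial>gauss) = 1"
    using prob_space.emeasure_space_1[OF ps] by (simp add: emeasure_density)
  then have f_int: "integrable gauss f" and f_mass: "(\<integral>x. f x \<partial>gauss) = 1"
    using f_nn by (auto intro!: integrableI_nonneg simp: integral_eq_nn_integral)
  have U2_int: "integrable lborel (\<lambda>x. (U x)\<^sup>2 * \<phi> x)" and U2_mass: "(\<integral>x. (U x)\<^sup>2 * \<phi> x \<partial>lborel) = 1"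
  proof -
    have ae: "AE x in lborel. f x * \<phi> x = (U x)\<^sup>2 * \<phi> x" using fU by eventually_elim simp
    show "integrable lborel (\<lambda>x. (U x)\<^sup>2 * \<phi> x)"
      using f_int integrable_cong_AE[OF _ _ ae] by (simp add: integrable_gauss_iff)
    show "(\<integral>x. (U x)\<^sup>2 * \<phi> x \<partial>lborel) = 1"
      using f_mass integral_cong_AE[OF _ _ ae] by (simp add: integral_gauss)
  qed
  have mean: "(\<integral>x. x * ((U x)\<^sup>2 * \<phi> x) \<partial>lborel) = 0"
  proof -
    have "0 = (\<integral>x. x \<partial>density gauss (\<lambda>x. ennreal (f x)))"
      using cent unfolding centered_def by simp
    also have "\<dots> = (\<integral>x. f x * x \<partial>gauss)"
      using f_nn by (subst integral_real_density) auto
    also have "\<dots> = (\<integral>x. f x * x * \<phi> x \<partial>lborel)" by (rule integral_gauss) measurable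
    also have "\<dots> = (\<integral>x. x * ((U x)\<^sup>2 * \<phi> x) \<partial>lborel)"
    proof (rule integral_cong_AE)
      show "AE x in lborel. f x * x * \<phi> x = x * ((U x)\<^sup>2 * \<phi> x)" using fU by eventually_elim simp
    qed auto
    finally show ?thesis by simp
  qed
  have x2_int: "integrable lborel (\<lambda>x. x\<^sup>2 * ((U x)\<^sup>2 * \<phi> x))" and x2_le: "(\<integral>x. x\<^sup>2 * ((U x)\<^sup>2 * \<phi> x) \<partial>lborel) \<le> M"
  proof -
    have nn: "AE x in gauss. 0 \<le> \<bar>x\<bar>\<^sup>2 * f x" using f_nn by eventually_elim simp
    have i: "integrable gauss (\<lambda>x. \<bar>x\<bar>\<^sup>2 * f x)"
      using nn mom by (intro integrableI_nonneg) (auto intro: le_less_trans)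
    have le: "(\<integral>x. \<bar>x\<bar>\<^sup>2 * f x \<partial>gauss) \<le> M"
      using mom M by (subst (asm) nn_integral_eq_integral[OF i nn]) auto
    have ae: "AE x in lborel. \<bar>x\<bar>\<^sup>2 * f x * \<phi> x = x\<^sup>2 * ((U x)\<^sup>2 * \<phi> x)" using fU by eventually_elim simp
    show "integrable lborel (\<lambda>x. x\<^sup>2 * ((U x)\<^sup>2 * \<phi> x))"
      using i integrable_cong_AE[OF _ _ ae] by (simp add: integrable_gauss_iff)
    show "(\<integral>x. x\<^sup>2 * ((U x)\<^sup>2 * \<phi> x) \<partial>lborel) \<le> M"
      using le integral_cong_AE[OF _ _ ae] by (simp add: integral_gauss)
  qed
  \<comment> \<open>the quotient \<open>(f')\<^sup>2 / f\<close> ignores the zeros of \<open>f\<close>, so \<open>g\<close> is cut off there; this does not change \<open>U g\<close>\<close>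
  define g0 where "g0 x = (if U x = 0 then 0 else g x)" for x
  have Ug0: "U x * g0 x = U x * g x" for x by (simp add: g0_def)
  have [measurable]: "g0 \<in> borel_measurable borel" unfolding g0_def[abs_def] by measurable
  have g02_int: "integrable lborel (\<lambda>x. (g0 x)\<^sup>2 * \<phi> x)"
  proof (rule Bochner_Integration.integrable_bound)
    show "integrable lborel (\<lambda>x. (g x)\<^sup>2 * \<phi> x)" using g2 by (simp add: integrable_gauss_iff)
  qed (auto simp: g0_def)

  have primU2: "primitive_on UNIV (\<lambda>x. U x * U x) (\<lambda>x. U x * g x + U x * g x)"
    by (rule primitive_on_mult[OF U U])
  have "has_weak_deriv f (\<lambda>x. U x * g x + U x * g x)"
    by (rule has_weak_deriv_AE_cong[OF primitive_imp_has_weak_deriv[OF primU2]])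
      (use fU in \<open>auto simp: power2_eq_square\<close>)
  note wd = weak_deriv_AE_eq[OF this]
  note [measurable] = wd(2)
  have fisher: "fisher_information f = (\<integral>x. 4 * ((g0 x)\<^sup>2 * \<phi> x) \<partial>lborel)"
  proof -
    have "fisher_information f = (\<integral>x. \<bar>weak_deriv f x\<bar>\<^sup>2 / f x * \<phi> x \<partial>lborel)"
      unfolding fisher_information_def by (rule integral_gauss) measurable
    also have "\<dots> = (\<integral>x. 4 * ((g0 x)\<^sup>2 * \<phi> x) \<partial>lborel)"
    proof (rule integral_cong_AE)
      show "AE x in lborel. \<bar>weak_deriv f x\<bar>\<^sup>2 / f x * \<phi> x = 4 * ((g0 x)\<^sup>2 * \<phi> x)"
        using fU wd(1) by eventually_elim (auto simp: g0_def power2_eq_square field_simps)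
    qed auto
    finally show ?thesis .
  qed
  have entropy: "relative_entropy f = (\<integral>x. (U x)\<^sup>2 * \<phi> x * ln ((U x)\<^sup>2) \<partial>lborel)"
  proof -
    have "relative_entropy f = (\<integral>x. f x * ln (f x) * \<phi> x \<partial>lborel)"
      unfolding relative_entropy_def by (rule integral_gauss) measurable
    also have "\<dots> = (\<integral>x. (U x)\<^sup>2 * \<phi> x * ln ((U x)\<^sup>2) \<partial>lborel)"
    proof (rule integral_cong_AE)
      show "AE x in lborel. f x * ln (f x) * \<phi> x = (U x)\<^sup>2 * \<phi> x * ln ((U x)\<^sup>2)"
        using fU by eventually_elim simp
    qed auto
    finally show ?thesis .
  qed
  have L1: "(\<integral>x. \<bar>f x - 1\<bar> \<partial>gauss) = (\<integral>x. \<bar>U x * U x - 1\<bar> * \<phi> x \<partial>lborel)"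
  proof -
    have "(\<integral>x. \<bar>f x - 1\<bar> \<partial>gauss) = (\<integral>x. \<bar>f x - 1\<bar> * \<phi> x \<partial>lborel)"
      by (rule integral_gauss) measurable
    also have "\<dots> = (\<integral>x. \<bar>U x * U x - 1\<bar> * \<phi> x \<partial>lborel)"
    proof (rule integral_cong_AE)
      show "AE x in lborel. \<bar>f x - 1\<bar> * \<phi> x = \<bar>U x * U x - 1\<bar> * \<phi> x"
        using fU by eventually_elim (simp add: power2_eq_square)
    qed auto
    finally show ?thesis .
  qed

  define v where "v x = U x * sqrt (\<phi> x)" for x
  define w where "w x = (2 * g0 x - x * U x) * sqrt (\<phi> x)" for x
  have v_sq: "(v x)\<^sup>2 = (U x)\<^sup>2 * \<phi> x" for x by (simp add: v_def power_mult_distrib)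
  interpret finite_information v w M
  proof
    have "primitive_on UNIV \<phi> (\<lambda>x. - x * \<phi> x)"
      by (rule primitive_on_DERIV[OF phi_DERIV]) (intro continuous_intros phi_continuous)
    from primitive_on_mult[OF primU2 this]
    show "primitive_on UNIV (\<lambda>x. (v x)\<^sup>2) (\<lambda>x. v x * w x)"
    proof (rule primitive_on_cong)
      fix x
      show "U x * U x * \<phi> x = (v x)\<^sup>2" unfolding v_sq by (simp add: power2_eq_square)
      have "v x * w x = (2 * (U x * g0 x) - x * (U x * U x)) * (sqrt (\<phi> x) * sqrt (\<phi> x))"
        by (simp add: v_def w_def algebra_simps)
      then show "U x * U x * (- x * \<phi> x) + \<phi> x * (U x * g x + U x * g x) = v x * w x"
        by (simp add: Ug0 algebra_simps)
    qed
    show "v \<in> borel_measurable borel" "w \<in> borel_measurable borel"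
      unfolding v_def[abs_def] w_def[abs_def] by measurable
    show "integrable lborel (\<lambda>x. (w x)\<^sup>2)"
    proof (rule Bochner_Integration.integrable_bound)
      show "integrable lborel (\<lambda>x. 8 * ((g0 x)\<^sup>2 * \<phi> x) + 2 * (x\<^sup>2 * ((U x)\<^sup>2 * \<phi> x)))"
        using g02_int x2_int by simp
      show "AE x in lborel. norm ((w x)\<^sup>2) \<le> norm (8 * ((g0 x)\<^sup>2 * \<phi> x) + 2 * (x\<^sup>2 * ((U x)\<^sup>2 * \<phi> x)))"
      proof (rule AE_I2)
        fix x
        have "0 \<le> (2 * g0 x + x * U x)\<^sup>2" by simp
        then have "(2 * g0 x - x * U x)\<^sup>2 \<le> 8 * (g0 x)\<^sup>2 + 2 * (x\<^sup>2 * (U x)\<^sup>2)"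
          by (simp add: power2_eq_square algebra_simps)
        then have "(2 * g0 x - x * U x)\<^sup>2 * \<phi> x \<le> (8 * (g0 x)\<^sup>2 + 2 * (x\<^sup>2 * (U x)\<^sup>2)) * \<phi> x"
          by (rule mult_right_mono) simp
        then show "norm ((w x)\<^sup>2) \<le> norm (8 * ((g0 x)\<^sup>2 * \<phi> x) + 2 * (x\<^sup>2 * ((U x)\<^sup>2 * \<phi> x)))"
          by (simp add: w_def power_mult_distrib distrib_right mult.assoc)
      qed
    qed (auto simp: w_def[abs_def])
  qed (use U2_int U2_mass x2_int x2_le mean in \<open>simp_all add: v_sq\<close>)
  have e: "e x = 2 * g0 x * sqrt (\<phi> x)" for x
    by (simp add: e_def w_def v_def algebra_simps)
  have ent: "ent x = (U x)\<^sup>2 * \<phi> x * ln ((U x)\<^sup>2)" for x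
    using phi_pos[of x] by (simp add: ent_def p_def v_sq)
  have deficit: "lsi_deficit f = deficit"
    unfolding lsi_deficit_def deficit_def fisher entropy ent by (simp add: e power_mult_distrib mult.assoc)
  have ve: "v x * e x = (U x * g x + U x * g x) * \<phi> x" for x
  proof -
    have "v x * e x = (U x * g0 x + U x * g0 x) * (sqrt (\<phi> x) * sqrt (\<phi> x))"
      by (simp add: v_def e algebra_simps)
    then show ?thesis by (simp add: Ug0)
  qed
  have poincare: "(\<integral>x. \<bar>U x * U x - 1\<bar> * \<phi> x \<partial>lborel) \<le> 6 * (\<integral>x. \<bar>v x * e x\<bar> \<partial>lborel)"
    unfolding ve abs_mult
    using gauss_L1_poincare[OF primU2] U2_int U2_mass ve_integrable
    by (simp add: power2_eq_square ve)
  show ?thesis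
    unfolding deficit L1
  proof (rule quarter_power_bound[OF deficit_nonneg])
    show "(\<integral>x. \<bar>U x * U x - 1\<bar> * \<phi> x \<partial>lborel) \<le> 2"
    proof -
      have "(\<integral>x. \<bar>U x * U x - 1\<bar> * \<phi> x \<partial>lborel) \<le> (\<integral>x. (U x)\<^sup>2 * \<phi> x + \<phi> x \<partial>lborel)"
      proof (rule integral_mono_AE')
        show "integrable lborel (\<lambda>x. (U x)\<^sup>2 * \<phi> x + \<phi> x)" using U2_int by simp
        show "AE x in lborel. \<bar>U x * U x - 1\<bar> * \<phi> x \<le> (U x)\<^sup>2 * \<phi> x + \<phi> x"
        proof (rule AE_I2)
          fix x
          have "\<bar>U x * U x - 1\<bar> \<le> (U x)\<^sup>2 + 1"
            using zero_le_power2[of "U x"] by (simp add: power2_eq_square abs_le_iff)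
          then have "\<bar>U x * U x - 1\<bar> * \<phi> x \<le> ((U x)\<^sup>2 + 1) * \<phi> x" by (rule mult_right_mono) simp
          then show "\<bar>U x * U x - 1\<bar> * \<phi> x \<le> (U x)\<^sup>2 * \<phi> x + \<phi> x" by (simp add: distrib_right)
        qed
      qed simp
      also have "\<dots> = 2" using U2_int U2_mass by simp
      finally show ?thesis .
    qed
    show "0 \<le> 6 * (78 + 6 * sqrt M)" using M by simp
    fix h :: real assume "0 < h" "h \<le> 1 / 9" "deficit \<le> h ^ 4"
    from stein_L1_bound[OF this] poincare
    show "(\<integral>x. \<bar>U x * U x - 1\<bar> * \<phi> x \<partial>lborel) \<le> 6 * (78 + 6 * sqrt M) * h" by linarith
  qed
qed

theorem theorem1p1:
  fixes M :: real
  assumes "M \<ge> 1"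
  shows "\<exists>C>0. \<forall>f :: real \<Rightarrow> real.
    gauss_prob_density f \<longrightarrow>
    centered (density gauss (\<lambda>x. ennreal (f x))) \<longrightarrow>
    (\<integral>\<^sup>+ x. ennreal (\<bar>x\<bar>\<^sup>2 * f x) \<partial>gauss) \<le> ennreal M \<longrightarrow>
    (\<lambda>x. sqrt (f x)) \<in> sobolev_W12_gauss \<longrightarrow>
    (\<integral>x. \<bar>f x - 1\<bar> \<partial>gauss) \<le> C * lsi_deficit f powr (1 / 4)"
proof (intro exI[of _ "6 * (78 + 6 * sqrt M) + 18"] conjI allI impI)
  have "0 \<le> 6 * (78 + 6 * sqrt M)" using assms by simp
  then show "0 < 6 * (78 + 6 * sqrt M) + 18" by (rule add_nonneg_pos) simp
qed (rule L1_le_deficit, use assms in auto)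

end
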